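(* Let $j:\mathbb{H}\to\mathbb{C}$ be Klein's $j$-function and let $$U=\left\{ z\in\mathbb{H} : |z|\ge 1,\ -\tfrac12<\operatorname{Re}(z)\le \tfrac12,\ \text{and if } \operatorname{Re}(z)<0 \text{ then } |z|>1\right\}.$$ Identify $\mathbb{C}$ with $\mathbb{R}^2$ via $z=x+iy$. Let $V\subset U$ be any nonempty open set. Then there is no (real) Pfaffian chain $(f_1,\ldots,f_l)$ on $V$ such that both $\operatorname{Re}(j(x+iy))$ and $\operatorname{Im}(j(x+iy))$ are algebraic over the field $\mathbb{R}(x,y,f_1,\ldots,f_l)$ of functions on $V$.
   Context: $\mathbb{H}=\{z\in\mathbb{C}:\operatorname{Im} z>0\}$. Klein's $j$-function is the classical modular function, holomorphic on $\mathbb{H}$, invariant under $\mathrm{SL}_2(\mathbb{Z})$, normalized by $j(i)=1728$, $j(e^{2\pi i/3})=0$. A Pfaffian chain on a domain $V\subseteq\mathbb{R}^n$ is a tuple $(f_1,\ldots,f_l)$ of real analytic functions on $V$ for which there exist polynomials $p_{ij}(u_1,\ldots,u_n,v_1,\ldots,v_i)$ with real coefficients such that $\frac{\partial f_i}{\partial x_j}=p_{ij}(\bar x,f_1(\bar x),\ldots,f_i(\bar x))$ for all $1\le i\le l$, $1\le j\le n$. Here $n=2$ with coordinates $(x,y)$. *)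

theory Defs
  imports "HOL-Complex_Analysis.Complex_Analysis" "HOL-Library.Poly_Mapping"
begin

section \<open>Klein's j-function\<close>

text \<open>The lattice sums converge absolutely for \<open>k \<ge> 3\<close> and \<open>Im z > 0\<close>; for odd \<open>k\<close> they vanish.\<close>

definition eisenstein_sum :: "nat \<Rightarrow> complex \<Rightarrow> complex" where
  "eisenstein_sum k z =
     (\<Sum>\<^sub>\<infinity>(m, n) \<in> UNIV - {(0 :: int, 0 :: int)}. 1 / (of_int m * z + of_int n) ^ k)"

definition weierstrass_g2 :: "complex \<Rightarrow> complex" where
  "weierstrass_g2 z = 60 * eisenstein_sum 4 z"

definition weierstrass_g3 :: "complex \<Rightarrow> complex" where
  "weierstrass_g3 z = 140 * eisenstein_sum 6 z"

text \<open>
  The factor 1728 gives the normalization \<open>j(i) = 1728\<close> (as \<open>g\<^sub>3(i) = 0\<close>), and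
  \<open>j(e\<^bsup>2\<pi>i/3\<^esup>) = 0\<close> (as \<open>g\<^sub>2\<close> vanishes there). Only values on the upper half plane are meaningful.
\<close>

definition klein_j :: "complex \<Rightarrow> complex" where
  "klein_j z = 1728 * weierstrass_g2 z ^ 3 / (weierstrass_g2 z ^ 3 - 27 * weierstrass_g3 z ^ 2)"

definition modular_domain :: "complex set" where
  "modular_domain =
     {z. Im z > 0 \<and> norm z \<ge> 1 \<and> - 1/2 < Re z \<and> Re z \<le> 1/2 \<and> (Re z < 0 \<longrightarrow> norm z > 1)}"


section \<open>Real polynomials in several variables\<close>

text \<open>
  A polynomial maps monomials to coefficients, and a monomial maps variables to exponents
  (both finitely supported).
\<close>

type_synonym 'v rpoly = "('v \<Rightarrow>\<^sub>0 nat) \<Rightarrow>\<^sub>0 real"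

definition rpoly_vars :: "'v rpoly \<Rightarrow> 'v set" where
  "rpoly_vars p = (\<Union>m \<in> Poly_Mapping.keys p. Poly_Mapping.keys m)"

definition rpoly_eval :: "'v rpoly \<Rightarrow> ('v \<Rightarrow> real) \<Rightarrow> real" where
  "rpoly_eval p s =
     (\<Sum>m \<in> Poly_Mapping.keys p. Poly_Mapping.lookup p m *
        (\<Prod>v \<in> Poly_Mapping.keys m. s v ^ Poly_Mapping.lookup m v))"


section \<open>Pfaffian chains\<close>

text \<open>
  The space \<open>\<real>\<^sup>n\<close> is an arbitrary Euclidean space; its coordinates are the functions
  \<open>x \<mapsto> x \<bullet> b\<close> for \<open>b \<in> Basis\<close>. For the type \<^typ>\<open>complex\<close>, \<open>Basis = {1, \<i>}\<close> and the coordinates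
  are \<open>Re\<close> and \<open>Im\<close>.
\<close>

definition real_analytic_on :: "('a :: euclidean_space \<Rightarrow> real) \<Rightarrow> 'a set \<Rightarrow> bool" where
  "real_analytic_on f V \<longleftrightarrow>
     (\<forall>a\<in>V. \<exists>(c :: ('a \<Rightarrow> nat) \<Rightarrow> real) r. r > 0 \<and>
        (\<forall>x\<in>ball a r.
           ((\<lambda>\<alpha>. c \<alpha> * (\<Prod>b\<in>Basis. ((x - a) \<bullet> b) ^ \<alpha> b)) has_sum f x)
             (Basis \<rightarrow>\<^sub>E UNIV)))"

text \<open>
  The variable \<open>Inl b\<close> stands for the coordinate with respect to \<open>b\<close>, and \<open>Inr k\<close> for
  the \<open>k\<close>-th function of the chain. Chains are indexed from 0, so the polynomials belonging
  to \<open>fs ! i\<close> may use \<open>Inr 0, \<dots>, Inr i\<close>.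
\<close>

definition chain_values :: "('a :: euclidean_space \<Rightarrow> real) list \<Rightarrow> 'a \<Rightarrow> 'a + nat \<Rightarrow> real" where
  "chain_values fs x = case_sum (\<lambda>b. x \<bullet> b) (\<lambda>k. (fs ! k) x)"

definition pfaffian_chain :: "'a :: euclidean_space set \<Rightarrow> ('a \<Rightarrow> real) list \<Rightarrow> bool" where
  "pfaffian_chain V fs \<longleftrightarrow>
     (\<forall>f\<in>set fs. real_analytic_on f V) \<and>
     (\<forall>i<length fs. \<forall>b\<in>Basis. \<exists>p. rpoly_vars p \<subseteq> Inl ` Basis \<union> Inr ` {..i} \<and>
        (\<forall>x\<in>V. ((\<lambda>t. (fs ! i) (x + t *\<^sub>R b)) has_real_derivative
                   rpoly_eval p (chain_values fs x)) (at 0)))"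


section \<open>The field generated by the coordinates and a chain\<close>

text \<open>
  Elements of \<open>\<real>(x\<^sub>1, \<dots>, x\<^sub>n, f\<^sub>1, \<dots>, f\<^sub>l)\<close> are quotients of polynomial expressions, undefined
  (in HOL: 0) on the zero set of the denominator. Hence they are identified when they
  agree on a dense subset of \<open>V\<close>. On a connected \<open>V\<close>, a real analytic function
  that is not identically zero is nonzero on a dense subset, so \<open>nonzero_elem\<close> is
  then the usual condition on denominators and is the negation of \<open>zero_elem\<close> for elements of
  the field. If \<open>V\<close> is open but disconnected, \<open>nonzero_elem\<close> demands this on every component.
\<close>

definition zero_elem :: "'a :: topological_space set \<Rightarrow> ('a \<Rightarrow> real) \<Rightarrow> bool" where
  "zero_elem V h \<longleftrightarrow> V \<subseteq> closure {x\<in>V. h x = 0}"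

definition nonzero_elem :: "'a :: topological_space set \<Rightarrow> ('a \<Rightarrow> real) \<Rightarrow> bool" where
  "nonzero_elem V h \<longleftrightarrow> V \<subseteq> closure {x\<in>V. h x \<noteq> 0}"

definition chain_field ::
    "'a :: euclidean_space set \<Rightarrow> ('a \<Rightarrow> real) list \<Rightarrow> ('a \<Rightarrow> real) set" where
  "chain_field V fs =
     {\<lambda>x. rpoly_eval p (chain_values fs x) / rpoly_eval q (chain_values fs x) | p q.
        rpoly_vars p \<union> rpoly_vars q \<subseteq> Inl ` Basis \<union> Inr ` {..<length fs} \<and>
        nonzero_elem V (\<lambda>x. rpoly_eval q (chain_values fs x))}"

definition algebraic_over_field ::
    "'a :: topological_space set \<Rightarrow> ('a \<Rightarrow> real) set \<Rightarrow> ('a \<Rightarrow> real) \<Rightarrow> bool" where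
  "algebraic_over_field V K g \<longleftrightarrow>
     (\<exists>(d :: nat) h. (\<forall>i\<le>d. h i \<in> K) \<and> (\<exists>i\<le>d. nonzero_elem V (h i)) \<and>
        zero_elem V (\<lambda>x. \<Sum>i\<le>d. h i x * g x ^ i))"

end

theory Submission
  imports Defs
begin

text \<open>
  On a horizontal line a Pfaffian chain satisfies a triangular system of ordinary differential equations
  \<open>f\<^sub>i' = p\<^sub>i(x, f\<^sub>1, \<dots>, f\<^sub>i)\<close>, and the power series of the \<open>f\<^sub>i\<close> turn it into the same system for
  holomorphic functions. By an argument of Painleve a scalar equation \<open>u' = p(z, u)\<close>, polynomial
  in \<open>u\<close>, has no natural boundaries. At a singularity reached along a vertical line \<open>u\<close> tends to
  infinity. Near it, the equation for \<open>z\<close> as a function of \<open>w = 1 / u\<close> is regular at \<open>w = 0\<close>, so the singularity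
  is the value at 0 of a local inverse of \<open>1 / u\<close>. There are only countably many such values,
  so almost every vertical line is free of singularities, and inductively all the \<open>f\<^sub>i\<close> continue to a
  rectangle that crosses the real axis.

  On the horizontal line \<open>Re j\<close> equals \<open>(j + j\<^sup>*) / 2\<close>, where \<open>j\<^sup>*\<close> is the reflection of \<open>j\<close> in this line, and
  \<open>j\<^sup>*\<close> is holomorphic beyond the real axis. So if \<open>Re j\<close> is algebraic over the field of the chain, then \<open>j\<close>
  satisfies a polynomial equation whose coefficients \<open>A\<^sub>k\<close> are holomorphic across the real axis. Every value
  \<open>c\<close> of \<open>j\<close> is attained on an orbit of the modular group, which accumulates at real points,
  so \<open>\<Sum> A\<^sub>k c\<^sup>k\<close> vanishes identically. As \<open>j\<close> takes infinitely many values, all \<open>A\<^sub>k\<close> vanish, a contradiction.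
\<close>

section \<open>Holomorphic ordinary differential equations\<close>

text \<open>Continuation downwards must reach below the real axis, but it may lose width at every
  step: orbits of the modular group accumulate at every real point, so an arbitrarily thin strip is
  enough. Hence every extension result returns some subinterval of real parts, and a countable set
  of bad vertical lines is harmless.

  Passing to 1 / u requires the leading coefficient of the equation in u to be free of zeros. Its
  zeros are isolated, so a thinner strip avoids them; if it vanishes identically, the degree drops.
  In degree at most 1 the radius of existence does not depend on the initial value, so no
  singularity can occur.

  \<open>klein_j\<close> is a quotient, and the relation is first known only where its denominator
  \<open>disc\<close> is nonzero. A numerical estimate gives that \<open>disc\<close> is nonzero at
  rho, so its zeros are isolated, and after multiplication by a power of \<open>disc\<close> the
  relation is holomorphic through them. That j takes infinitely many values follows from the
  vanishing of g2 at rho and its nonvanishing at 10 i, the latter again by an estimate.\<close>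

lemma complex_ode_exists:
  fixes H :: "complex \<Rightarrow> complex \<Rightarrow> complex"
  assumes "r > 0" and R0: "R \<ge> 0"
    and hol: "\<And>g. g holomorphic_on ball z0 r \<Longrightarrow> g ` ball z0 r \<subseteq> cball u0 R \<Longrightarrow>
               (\<lambda>z. H z (g z)) holomorphic_on ball z0 r"
    and bound: "\<And>z u. z \<in> ball z0 r \<Longrightarrow> u \<in> cball u0 R \<Longrightarrow> norm (H z u) \<le> M"
    and lip: "\<And>z u v. z \<in> ball z0 r \<Longrightarrow> u \<in> cball u0 R \<Longrightarrow> v \<in> cball u0 R \<Longrightarrow>
               norm (H z u - H z v) \<le> K * norm (u - v)"
    and "r * M \<le> R" "r * K \<le> 1 / 2" "K \<ge> 0"
  obtains u where "u z0 = u0" "u ` ball z0 r \<subseteq> cball u0 R"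
    "\<And>z. z \<in> ball z0 r \<Longrightarrow> (u has_field_derivative H z (u z)) (at z)"
proof -
  define B where "B = ball z0 r"
  have z0B: "z0 \<in> B" using \<open>r > 0\<close> by (simp add: B_def)
  have oB: "open B" and cB: "convex B" by (auto simp: B_def)
  define adm where "adm = (\<lambda>g. g holomorphic_on B \<and> g ` B \<subseteq> cball u0 R)"
  \<comment> \<open>One Picard iteration, with the path integral replaced by a primitive normalized
    at z0. Joint holomorphy of H is replaced by the assumption \<open>hol\<close>, which is just
    what makes the integrand of an admissible g holomorphic.\<close>
  define step where "step = (\<lambda>g h. h z0 = u0 \<and> (\<forall>z\<in>B. (h has_field_derivative H z (g z)) (at z)))"
  have step_ex: "\<exists>h. step g h" if "adm g" for g
  proof -
    have "(\<lambda>z. H z (g z)) holomorphic_on B"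
      using that hol unfolding adm_def B_def by blast
    then obtain h where h: "\<And>z. z \<in> B \<Longrightarrow> (h has_field_derivative H z (g z)) (at z within B)"
      using holomorphic_convex_primitive'[OF cB oB] by blast
    have "step g (\<lambda>z. h z - h z0 + u0)"
      using h oB by (auto simp: step_def at_within_open[OF _ oB] intro!: derivative_eq_intros)
    thus ?thesis by blast
  qed
  have mv: "norm (h z - h z0) \<le> C * r"
    if "\<And>w. w \<in> B \<Longrightarrow> (h has_field_derivative h' w) (at w)" "\<And>w. w \<in> B \<Longrightarrow> norm (h' w) \<le> C" "z \<in> B" for h h' C z
  proof -
    have "norm (h z - h z0) \<le> C * norm (z - z0)"
      by (rule field_differentiable_bound[OF cB, where f' = h'])
         (use that z0B in \<open>auto intro: has_field_derivative_at_within\<close>)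
    also have "\<dots> \<le> C * r"
      using that z0B norm_ge_zero order_trans[OF norm_ge_zero that(2)[OF z0B]]
      by (intro mult_left_mono) (auto simp: B_def dist_norm norm_minus_commute)
    finally show ?thesis .
  qed
  have step_adm: "adm h" if "adm g" "step g h" for g h
  proof -
    have "norm (h z - h z0) \<le> M * r" if "z \<in> B" for z
      using \<open>step g h\<close> \<open>adm g\<close> that
      by (intro mv[where h' = "\<lambda>z. H z (g z)"]) (auto simp: step_def adm_def B_def intro!: bound)
    hence "h ` B \<subseteq> cball u0 R"
      using \<open>r * M \<le> R\<close> \<open>step g h\<close> by (fastforce simp: step_def dist_norm norm_minus_commute mult.commute)
    moreover have "h holomorphic_on B"
      using \<open>step g h\<close> oB unfolding step_def holomorphic_on_open[OF oB] by blast
    ultimately show ?thesis by (simp add: adm_def)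
  qed
  define u where "u = rec_nat (\<lambda>_. u0) (\<lambda>_ g. SOME h. step g h)"
  have u0: "u 0 = (\<lambda>_. u0)" and uS: "\<And>n. u (Suc n) = (SOME h. step (u n) h)"
    by (simp_all add: u_def)
  have u_adm: "adm (u n)" and u_step: "step (u n) (u (Suc n))" for n
  proof -
    have *: "adm (u n) \<and> step (u n) (u (Suc n))" for n
    proof (induction n)
      case 0
      have "adm (u 0)" using R0 by (auto simp: u0 adm_def)
      thus ?case using step_ex someI_ex uS by metis
    next
      case (Suc n)
      hence "adm (u (Suc n))" using step_adm by blast
      thus ?case using step_ex someI_ex uS by metis
    qed
    show "adm (u n)" "step (u n) (u (Suc n))" using * by blast+
  qed
  have u_in: "u n z \<in> cball u0 R" if "z \<in> B" for n z
    using u_adm[of n] that by (auto simp: adm_def)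
  \<comment> \<open>Each iteration contracts by r K <= 1/2, so the iterates converge uniformly on
    the whole ball.\<close>
  have diff: "norm (u (Suc n) z - u n z) \<le> R * (1/2) ^ n" if "z \<in> B" for n z
    using that
  proof (induction n arbitrary: z)
    case 0
    thus ?case using u_in[of z 1] by (simp add: u0 dist_norm norm_minus_commute)
  next
    case (Suc n)
    have "norm ((u (Suc (Suc n)) z - u (Suc n) z) - (u (Suc (Suc n)) z0 - u (Suc n) z0)) \<le> (K * (R * (1/2) ^ n)) * r"
    proof (rule mv[where h = "\<lambda>z. u (Suc (Suc n)) z - u (Suc n) z" and h' = "\<lambda>z. H z (u (Suc n) z) - H z (u n z)"])
      fix w assume w: "w \<in> B"
      show "((\<lambda>z. u (Suc (Suc n)) z - u (Suc n) z) has_field_derivative H w (u (Suc n) w) - H w (u n w)) (at w)"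
        using u_step[of n] u_step[of "Suc n"] w by (auto simp: step_def intro!: derivative_intros)
      have "norm (H w (u (Suc n) w) - H w (u n w)) \<le> K * norm (u (Suc n) w - u n w)"
        using w u_in by (intro lip) (auto simp: B_def)
      also have "\<dots> \<le> K * (R * (1/2) ^ n)"
        using Suc.IH w \<open>K \<ge> 0\<close> by (intro mult_left_mono) auto
      finally show "norm (H w (u (Suc n) w) - H w (u n w)) \<le> K * (R * (1/2) ^ n)" .
    qed (use Suc in auto)
    also have "\<dots> = (r * K) * (R * (1/2) ^ n)" by simp
    also have "\<dots> \<le> 1/2 * (R * (1/2) ^ n)"
      using \<open>r * K \<le> 1/2\<close> R0 by (intro mult_right_mono) auto
    finally show ?case
      using u_step[of n] u_step[of "Suc n"] by (simp add: step_def)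
  qed
  define U where "U = (\<lambda>z. u0 + suminf (\<lambda>n. u (Suc n) z - u n z))"
  have "uniform_limit B (\<lambda>n z. \<Sum>i<n. u (Suc i) z - u i z) (\<lambda>z. suminf (\<lambda>n. u (Suc n) z - u n z)) sequentially"
    by (rule Weierstrass_m_test[OF diff]) (auto intro: summable_mult)
  hence "uniform_limit B (\<lambda>n z. u0 + (\<Sum>i<n. u (Suc i) z - u i z)) U sequentially"
    unfolding U_def by (intro uniform_limit_intros)
  moreover have "(\<lambda>n z. u0 + (\<Sum>i<n. u (Suc i) z - u i z)) = u"
    using sum_lessThan_telescope[of "\<lambda>i. u i z" for z] by (simp add: fun_eq_iff u0)
  ultimately have ul: "uniform_limit B u U sequentially" by simp
  have lim: "(\<lambda>n. u n z) \<longlonglongrightarrow> U z" if "z \<in> B" for z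
    using ul that by (rule tendsto_uniform_limitI)
  have U_in: "U z \<in> cball u0 R" if "z \<in> B" for z
    using closed_sequentially[OF closed_cball, of "\<lambda>n. u n z" u0 R "U z"] u_in[OF that] lim[OF that] by blast
  have "\<exists>g'. \<forall>x\<in>B. (U has_field_derivative g' x) (at x) \<and> (\<lambda>n. H x (u n x)) \<longlonglongrightarrow> g' x"
  proof (rule has_complex_derivative_uniform_sequence[OF oB, where f = "\<lambda>n. u (Suc n)"])
    show "(u (Suc n) has_field_derivative H x (u n x)) (at x)" if "x \<in> B" for n x
      using u_step that by (auto simp: step_def)
    fix x assume "x \<in> B"
    then obtain d where "d > 0" "cball x d \<subseteq> B" using oB open_contains_cball by blast
    moreover have "uniform_limit B (\<lambda>n. u (Suc n)) U sequentially"
      using ul by (simp add: filterlim_sequentially_Suc)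
    ultimately show "\<exists>d>0. cball x d \<subseteq> B \<and> uniform_limit (cball x d) (\<lambda>n. u (Suc n)) U sequentially"
      using uniform_limit_on_subset by blast
  qed
  then obtain g' where g': "\<And>x. x \<in> B \<Longrightarrow> (U has_field_derivative g' x) (at x)"
     "\<And>x. x \<in> B \<Longrightarrow> (\<lambda>n. H x (u n x)) \<longlonglongrightarrow> g' x" by blast
  have "(U has_field_derivative H x (U x)) (at x)" if x: "x \<in> B" for x
  proof -
    have "(\<lambda>n. H x (u n x)) \<longlonglongrightarrow> H x (U x)"
    proof (rule LIM_zero_cancel, rule Lim_null_comparison)
      show "\<forall>\<^sub>F n in sequentially. norm (H x (u n x) - H x (U x)) \<le> K * norm (u n x - U x)"
        using x u_in U_in by (intro always_eventually allI lip) (auto simp: B_def)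
      show "(\<lambda>n. K * norm (u n x - U x)) \<longlonglongrightarrow> 0"
        using lim[OF x] by (intro tendsto_mult_right_zero tendsto_norm_zero LIM_zero)
    qed
    with g' x show ?thesis using LIMSEQ_unique by metis
  qed
  moreover have "U z0 = u0"
  proof (rule LIMSEQ_unique[OF lim[OF z0B]])
    have "u n z0 = u0" for n using u_step[of "n-1"] by (cases n) (auto simp: step_def u0)
    thus "(\<lambda>n. u n z0) \<longlonglongrightarrow> u0" by simp
  qed
  moreover have "U ` ball z0 r \<subseteq> cball u0 R" using U_in unfolding B_def by blast
  ultimately show ?thesis using that unfolding B_def by blast
qed

text \<open>On a disc of radius s with |K| s <= 1/2, integrating the inequality bounds the maximum
  of |h| by half of itself. So h vanishes near z0, and the identity theorem does the rest.\<close>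

lemma complex_gronwall_zero:
  fixes h :: "complex \<Rightarrow> complex"
  assumes "r > 0" "h holomorphic_on ball z0 r" "h z0 = 0"
    and le: "\<And>z. z \<in> ball z0 r \<Longrightarrow> norm (deriv h z) \<le> K * norm (h z)"
    and z: "z \<in> ball z0 r"
  shows "h z = 0"
proof -
  define s where "s = min (r / 2) (1 / (2 * (\<bar>K\<bar> + 1)))"
  have s: "s > 0" "s < r" using \<open>r > 0\<close> by (auto simp: s_def)
  have sK: "\<bar>K\<bar> * s \<le> 1 / 2"
  proof -
    have "s * (2 * (\<bar>K\<bar> + 1)) \<le> 1"
      by (subst pos_le_divide_eq[symmetric]) (auto simp: s_def)
    thus ?thesis using s by (simp add: algebra_simps)
  qed
  have sub: "cball z0 s \<subseteq> ball z0 r" using s by auto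
  have "continuous_on (cball z0 s) (\<lambda>z. norm (h z))"
    by (intro continuous_intros holomorphic_on_imp_continuous_on holomorphic_on_subset[OF assms(2) sub])
  then obtain m where m: "m \<in> cball z0 s" "\<And>z. z \<in> cball z0 s \<Longrightarrow> norm (h z) \<le> norm (h m)"
    using continuous_attains_sup[of "cball z0 s" "\<lambda>z. norm (h z)"] s by auto
  have der: "(h has_field_derivative deriv h w) (at w)" if "w \<in> ball z0 r" for w
    by (rule holomorphic_derivI[OF assms(2) open_ball that])
  have "norm (h m - h z0) \<le> (\<bar>K\<bar> * norm (h m)) * norm (m - z0)"
  proof (rule field_differentiable_bound[of "cball z0 s" h "deriv h"])
    fix w assume w: "w \<in> cball z0 s"
    show "(h has_field_derivative deriv h w) (at w within cball z0 s)"
      using der w sub by (auto intro!: has_field_derivative_at_within[OF der])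
    have "norm (deriv h w) \<le> K * norm (h w)" using le w sub by auto
    also have "\<dots> \<le> \<bar>K\<bar> * norm (h m)" using m w by (intro mult_mono) auto
    finally show "norm (deriv h w) \<le> \<bar>K\<bar> * norm (h m)" .
  qed (use m s in auto)
  also have "\<dots> \<le> (\<bar>K\<bar> * norm (h m)) * s"
    using m by (intro mult_left_mono) (auto simp: dist_norm norm_minus_commute)
  also have "\<dots> = (\<bar>K\<bar> * s) * norm (h m)" by simp
  also have "\<dots> \<le> 1 / 2 * norm (h m)" using sK by (intro mult_right_mono) auto
  finally have "h m = 0" using assms(3) by simp
  hence 0: "h w = 0" if "w \<in> ball z0 s" for w using m that by force
  show ?thesis
    by (rule analytic_continuation_open[of "ball z0 s" "ball z0 r" h "\<lambda>_. 0"])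
       (use 0 s assms z in \<open>auto simp: holomorphic_on_const\<close>)
qed

text \<open>Cauchy's inequality on discs of radius R / 2 bounds the derivative on the ball of radius
  R.\<close>

lemma bounded_holomorphic_lipschitz:
  assumes hol: "g holomorphic_on ball u0 (2 * R)" and "R > 0"
    and bd: "\<And>u. u \<in> ball u0 (2 * R) \<Longrightarrow> norm (g u) \<le> M"
    and "u \<in> cball u0 R" "v \<in> cball u0 R"
  shows "norm (g u - g v) \<le> 2 * M / R * norm (u - v)"
proof (rule field_differentiable_bound[of "cball u0 R" g "deriv g"])
  fix z assume z: "z \<in> cball u0 R"
  have zb: "z \<in> ball u0 (2 * R)" using z \<open>R > 0\<close> by auto
  show "(g has_field_derivative deriv g z) (at z within cball u0 R)"
    by (rule has_field_derivative_at_within[OF holomorphic_derivI[OF hol open_ball zb]])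
  have sub: "cball z (R / 2) \<subseteq> ball u0 (2 * R)"
  proof
    fix y assume "y \<in> cball z (R / 2)"
    thus "y \<in> ball u0 (2 * R)"
      using z \<open>R > 0\<close> dist_triangle[of u0 y z] by (auto simp: dist_commute)
  qed
  have "norm ((deriv ^^ 1) g z) \<le> fact 1 * M / (R / 2) ^ 1"
  proof (rule Cauchy_inequality)
    show "g holomorphic_on ball z (R / 2)" "continuous_on (cball z (R / 2)) g"
      using sub by (auto intro!: holomorphic_on_subset[OF hol] holomorphic_on_imp_continuous_on)
    show "norm (g x) \<le> M" if "norm (z - x) = R / 2" for x
      using that sub by (intro bd) (auto simp: dist_norm subset_iff)
  qed (use \<open>R > 0\<close> in auto)
  thus "norm (deriv g z) \<le> 2 * M / R" by (simp add: field_simps)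
qed (use assms in auto)

text \<open>With the Lipschitz constant K = 2 M / R from Cauchy's inequality, the single condition 4
  r M <= R covers both r M <= R (the iterates stay in the ball) and r K <= 1/2
  (contraction).\<close>

corollary complex_ode_exists_holomorphic:
  fixes H :: "complex \<Rightarrow> complex \<Rightarrow> complex"
  assumes "r > 0" "R > 0"
    and hol: "\<And>g. g holomorphic_on ball z0 r \<Longrightarrow> g ` ball z0 r \<subseteq> cball u0 R \<Longrightarrow>
               (\<lambda>z. H z (g z)) holomorphic_on ball z0 r"
    and holu: "\<And>z. z \<in> ball z0 r \<Longrightarrow> H z holomorphic_on ball u0 (2 * R)"
    and bound: "\<And>z u. z \<in> ball z0 r \<Longrightarrow> u \<in> ball u0 (2 * R) \<Longrightarrow> norm (H z u) \<le> M"
    and rM: "4 * r * M \<le> R"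
  obtains u where "u z0 = u0" "u ` ball z0 r \<subseteq> cball u0 R"
    "\<And>z. z \<in> ball z0 r \<Longrightarrow> (u has_field_derivative H z (u z)) (at z)"
proof (rule complex_ode_exists[of r R z0 u0 H M "2 * M / R"])
  have M0: "M \<ge> 0"
    using order_trans[OF norm_ge_zero bound[of z0 u0]] assms(1,2) by simp
  have "r * M \<ge> 0" using M0 \<open>r > 0\<close> by simp
  thus "r * M \<le> R" using rM by linarith
  show "r * (2 * M / R) \<le> 1 / 2" "2 * M / R \<ge> 0"
    using rM M0 \<open>R > 0\<close> by (auto simp: field_simps)
  fix z u v assume *: "z \<in> ball z0 r" "u \<in> cball u0 R" "v \<in> cball u0 R"
  thus "norm (H z u - H z v) \<le> 2 * M / R * norm (u - v)"
    by (intro bounded_holomorphic_lipschitz[OF holu \<open>R > 0\<close> bound]) auto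
next
  fix z u assume "z \<in> ball z0 r" "u \<in> cball u0 R"
  thus "norm (H z u) \<le> M" using \<open>R > 0\<close> by (intro bound) auto
qed (use assms that in auto)

text \<open>Constants uniform over all initial points in K, so that radii of existence do not shrink
  as an initial point approaches the boundary of the domain of a solution.\<close>

lemma compact_nbhd_bounds:
  fixes A :: "nat \<Rightarrow> complex \<Rightarrow> complex"
  assumes "compact K" "open W" "K \<subseteq> W" and hol: "\<And>k. k \<le> D \<Longrightarrow> A k holomorphic_on W"
  obtains \<epsilon> C where "\<epsilon> > 0" "C \<ge> 1" "\<And>z0. z0 \<in> K \<Longrightarrow> cball z0 \<epsilon> \<subseteq> W"
    "\<And>z0 z k. z0 \<in> K \<Longrightarrow> z \<in> cball z0 \<epsilon> \<Longrightarrow> k \<le> D \<Longrightarrow> norm (A k z) \<le> C"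
    "compact (\<Union>z0\<in>K. cball z0 \<epsilon>)"
proof -
  obtain \<epsilon> where \<epsilon>: "\<epsilon> > 0" "(\<Union>z0\<in>K. cball z0 \<epsilon>) \<subseteq> W"
    using compact_subset_open_imp_cball_epsilon_subset[OF assms(1-3)] by blast
  define K' where "K' = (\<Union>z0\<in>K. cball z0 \<epsilon>)"
  have "K' = {x + y | x y. x \<in> K \<and> y \<in> cball 0 \<epsilon>}"
  proof (intro equalityI subsetI)
    fix z assume "z \<in> K'"
    then obtain z0 where "z0 \<in> K" "z \<in> cball z0 \<epsilon>" by (auto simp: K'_def)
    thus "z \<in> {x + y | x y. x \<in> K \<and> y \<in> cball 0 \<epsilon>}"
      by (intro CollectI exI[of _ z0] exI[of _ "z - z0"]) (auto simp: dist_norm norm_minus_commute)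
  qed (force simp: K'_def dist_norm)
  hence comp: "compact K'" using compact_sums[OF \<open>compact K\<close> compact_cball[of 0 \<epsilon>]] by simp
  have "\<exists>C. \<forall>k\<le>D. \<forall>z\<in>K'. norm (A k z) \<le> C"
  proof -
    have "\<forall>k\<in>{..D}. \<exists>C. \<forall>z\<in>K'. norm (A k z) \<le> C"
    proof
      fix k assume "k \<in> {..D}"
      hence "continuous_on K' (A k)"
        using hol \<epsilon> unfolding K'_def by (metis atMost_iff holomorphic_on_imp_continuous_on holomorphic_on_subset)
      hence "bounded (A k ` K')" using comp by (intro compact_imp_bounded compact_continuous_image)
      thus "\<exists>C. \<forall>z\<in>K'. norm (A k z) \<le> C" by (auto simp: bounded_iff)
    qed
    then obtain C where C: "\<And>k z. k \<in> {..D} \<Longrightarrow> z \<in> K' \<Longrightarrow> norm (A k z) \<le> C k" by metis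
    have "norm (A k z) \<le> Max (C ` {..D})" if "k \<le> D" "z \<in> K'" for k z
      using C[of k z] that by (auto intro: order_trans Max_ge)
    thus ?thesis by blast
  qed
  then obtain C where C: "\<And>k z. k \<le> D \<Longrightarrow> z \<in> K' \<Longrightarrow> norm (A k z) \<le> C" by blast
  show ?thesis
  proof (rule that[of \<epsilon> "max 1 C"])
    show "norm (A k z) \<le> max 1 C" if "z0 \<in> K" "z \<in> cball z0 \<epsilon>" "k \<le> D" for z0 z k
      using C[of k z] that by (force simp: K'_def max_def)
  qed (use \<epsilon> comp in \<open>auto simp: K'_def\<close>)
qed

lemma poly_ode_exists_ball:
  fixes A :: "nat \<Rightarrow> complex \<Rightarrow> complex"
  assumes "r > 0" "R > 0" and hol: "\<And>k. k \<le> D \<Longrightarrow> A k holomorphic_on ball z0 r"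
    and bound: "\<And>z u. z \<in> ball z0 r \<Longrightarrow> u \<in> ball u0 (2 * R) \<Longrightarrow> norm (\<Sum>k\<le>D. A k z * u ^ k) \<le> M"
    and rM: "4 * r * M \<le> R"
  shows "\<exists>u. u z0 = u0 \<and> (\<forall>z\<in>ball z0 r. (u has_field_derivative (\<Sum>k\<le>D. A k z * u z ^ k)) (at z))"
proof -
  obtain u where "u z0 = u0"
    "\<And>z. z \<in> ball z0 r \<Longrightarrow> (u has_field_derivative (\<Sum>k\<le>D. A k z * u z ^ k)) (at z)"
    by (rule complex_ode_exists_holomorphic[of r R z0 u0 "\<lambda>z u. \<Sum>k\<le>D. A k z * u ^ k" M])
       (use assms in \<open>auto intro!: holomorphic_intros\<close>)
  thus ?thesis by blast
qed

text \<open>The radius \<delta> depends only on the bound L for the initial value, so a solution can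
  stop inside K only by becoming unbounded. For D <= 1 the right-hand side grows at most linearly in
  u, and even the dependence on L disappears.\<close>

lemma poly_ode_exists:
  fixes A :: "nat \<Rightarrow> complex \<Rightarrow> complex"
  assumes "compact K" "open W" "K \<subseteq> W" and hol: "\<And>k. k \<le> D \<Longrightarrow> A k holomorphic_on W"
  obtains \<delta> where "\<delta> > 0" "\<And>z0. z0 \<in> K \<Longrightarrow> ball z0 \<delta> \<subseteq> W"
    "\<And>z0 u0. z0 \<in> K \<Longrightarrow> norm u0 \<le> L \<or> D \<le> 1 \<Longrightarrow>
       \<exists>u. u z0 = u0 \<and> (\<forall>z\<in>ball z0 \<delta>. (u has_field_derivative (\<Sum>k\<le>D. A k z * u z ^ k)) (at z))"
proof -
  obtain \<epsilon> C where \<epsilon>: "\<epsilon> > 0" "C \<ge> 1" "\<And>z0. z0 \<in> K \<Longrightarrow> cball z0 \<epsilon> \<subseteq> W"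
    "\<And>z0 z k. z0 \<in> K \<Longrightarrow> z \<in> cball z0 \<epsilon> \<Longrightarrow> k \<le> D \<Longrightarrow> norm (A k z) \<le> C"
    by (rule compact_nbhd_bounds[OF assms]) (assumption, rule that)
  \<comment> \<open>The equation is solved with R = 1 + |u0|. On the ball of radius 2 R around u0
    one has |u| <= |u0| + 2 (1 + |u0|) <= T |u0|, and \<open>M\<close> bounds the right-hand side
    there.\<close>
  define T where "T = (\<lambda>l::real. 3 * (1 + \<bar>l\<bar>))"
  define M where "M = (\<lambda>l. real (D + 1) * (C * T l ^ D))"
  \<comment> \<open>Both choices aim at 4 \<delta> M <= 1 + |u0|. For D <= 1, M is at most 2 C * 3
    (1 + |u0|), the factor 1 + |u0| cancels, and 4 * 2 * 3 = 24 remains.\<close>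
  define \<delta> where "\<delta> = (if D \<le> 1 then min \<epsilon> (1 / (24 * C)) else min \<epsilon> (1 / (4 * M L)))"
  have T1: "T l \<ge> 1" for l by (simp add: T_def)
  have Mpos: "M l > 0" for l using \<epsilon>(2) T1[of l] by (auto simp: M_def intro!: mult_pos_pos zero_less_power)
  have \<delta>0: "\<delta> > 0" "\<delta> \<le> \<epsilon>" using \<epsilon>(1,2) Mpos[of L] by (auto simp: \<delta>_def)
  have bd: "norm (\<Sum>k\<le>D. A k z * u ^ k) \<le> M l"
    if "z0 \<in> K" "z \<in> ball z0 \<delta>" "norm u \<le> T l" for z0 z u l
  proof -
    have "norm (\<Sum>k\<le>D. A k z * u ^ k) \<le> real (card {..D}) * (C * T l ^ D)"
    proof (intro sum_norm_bound)
      fix k assume "k \<in> {..D}"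
      have "norm (u ^ k) \<le> T l ^ k" using that by (auto simp: norm_power intro!: power_mono)
      also have "\<dots> \<le> T l ^ D" using T1[of l] \<open>k \<in> {..D}\<close> by (auto intro!: power_increasing)
      finally show "norm (A k z * u ^ k) \<le> C * T l ^ D"
        using \<epsilon>(2) \<epsilon>(4)[of z0 z k] that \<open>k \<in> {..D}\<close> \<delta>0 by (auto simp: norm_mult intro!: mult_mono)
    qed
    thus ?thesis by (simp add: M_def)
  qed
  have "\<exists>u. u z0 = u0 \<and> (\<forall>z\<in>ball z0 \<delta>. (u has_field_derivative (\<Sum>k\<le>D. A k z * u z ^ k)) (at z))"
    if z0: "z0 \<in> K" and u0: "norm u0 \<le> L \<or> D \<le> 1" for z0 u0
  proof (rule poly_ode_exists_ball[of \<delta> "1 + norm u0" D A z0 u0 "M (norm u0)"])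
    show "A k holomorphic_on ball z0 \<delta>" if "k \<le> D" for k
      by (rule holomorphic_on_subset[OF hol[OF that]]) (use \<epsilon>(3)[OF z0] \<delta>0 in force)
    show "norm (\<Sum>k\<le>D. A k z * u ^ k) \<le> M (norm u0)"
      if "z \<in> ball z0 \<delta>" "u \<in> ball u0 (2 * (1 + norm u0))" for z u
    proof (rule bd[OF z0 that(1)])
      have "norm u \<le> norm u0 + norm (u - u0)" by (metis add.commute norm_triangle_sub)
      also have "\<dots> \<le> T (norm u0)"
        using that(2) by (simp add: T_def dist_norm norm_minus_commute)
      finally show "norm u \<le> T (norm u0)" .
    qed
    show "4 * \<delta> * M (norm u0) \<le> 1 + norm u0"
    proof (cases "D \<le> 1")
      case True
      have "M (norm u0) \<le> 2 * (C * (3 * (1 + norm u0)))"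
        unfolding M_def T_def using True \<epsilon>(2)
        by (intro mult_mono mult_left_mono) (auto simp: le_Suc_eq)
      moreover have "\<delta> * (24 * C) \<le> 1"
        using True \<epsilon>(2) by (subst pos_le_divide_eq[symmetric]) (auto simp: \<delta>_def)
      ultimately have "4 * \<delta> * M (norm u0) \<le> 4 * \<delta> * (2 * (C * (3 * (1 + norm u0))))"
        using \<delta>0 by (intro mult_left_mono) auto
      also have "\<dots> = (\<delta> * (24 * C)) * (1 + norm u0)" by (simp add: algebra_simps)
      also have "\<dots> \<le> 1 * (1 + norm u0)"
        using \<open>\<delta> * (24 * C) \<le> 1\<close> by (intro mult_right_mono) auto
      finally show ?thesis by simp
    next
      case False
      have "M (norm u0) \<le> M L"
        unfolding M_def T_def using u0 False \<epsilon>(2) by (intro mult_left_mono power_mono) auto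
      hence "\<delta> * (4 * M (norm u0)) \<le> \<delta> * (4 * M L)"
        using \<delta>0 by (intro mult_left_mono) auto
      also have "\<dots> \<le> 1"
        using False Mpos[of L] by (subst pos_le_divide_eq[symmetric]) (auto simp: \<delta>_def)
      finally show ?thesis by (simp add: algebra_simps add_increasing2)
    qed
  qed (use \<delta>0 in \<open>auto intro: add_pos_nonneg\<close>)
  moreover have "ball z0 \<delta> \<subseteq> W" if "z0 \<in> K" for z0 using \<epsilon>(3)[OF that] \<delta>0 by force
  ultimately show ?thesis using that \<delta>0 by blast
qed

text \<open>Since f - g divides every f^k - g^k, the difference of two solutions satisfies a linear
  differential inequality near z0, and Gronwall's argument makes it vanish.\<close>

lemma poly_ode_unique:
  fixes A :: "nat \<Rightarrow> complex \<Rightarrow> complex"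
  assumes S: "open S" "connected S" and hol: "\<And>k. k \<le> D \<Longrightarrow> A k holomorphic_on S"
    and f: "\<And>z. z \<in> S \<Longrightarrow> (f has_field_derivative (\<Sum>k\<le>D. A k z * f z ^ k)) (at z)"
    and g: "\<And>z. z \<in> S \<Longrightarrow> (g has_field_derivative (\<Sum>k\<le>D. A k z * g z ^ k)) (at z)"
    and eq: "z0 \<in> S" "f z0 = g z0" and z: "z \<in> S"
  shows "f z = g z"
proof -
  have hf: "f holomorphic_on S" and hg: "g holomorphic_on S"
    using f g S by (auto simp: holomorphic_on_open)
  obtain r where r: "r > 0" "cball z0 r \<subseteq> S" using S eq open_contains_cball by blast
  define Q where "Q = (\<lambda>z. \<Sum>k\<le>D. A k z * (\<Sum>i<k. g z ^ (k - Suc i) * f z ^ i))"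
  have "continuous_on (cball z0 r) Q"
    unfolding Q_def using r(2)
    by (intro continuous_intros holomorphic_on_imp_continuous_on holomorphic_on_subset[OF hol]
          holomorphic_on_subset[OF hf] holomorphic_on_subset[OF hg]) auto
  hence "bounded (Q ` cball z0 r)" by (intro compact_imp_bounded compact_continuous_image) auto
  then obtain B where B: "\<And>z. z \<in> cball z0 r \<Longrightarrow> norm (Q z) \<le> B"
    unfolding bounded_iff by blast
  have *: "f z - g z = 0" if "z \<in> ball z0 r" for z
  proof (rule complex_gronwall_zero[OF r(1) _ _ _ that, of "\<lambda>z. f z - g z" B])
    show "(\<lambda>z. f z - g z) holomorphic_on ball z0 r"
      using r(2) by (intro holomorphic_on_diff holomorphic_on_subset[OF hf] holomorphic_on_subset[OF hg]) auto
    fix z assume z: "z \<in> ball z0 r"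
    hence "z \<in> S" using r by auto
    hence "deriv (\<lambda>z. f z - g z) z = (\<Sum>k\<le>D. A k z * f z ^ k) - (\<Sum>k\<le>D. A k z * g z ^ k)"
      using f g by (intro DERIV_imp_deriv derivative_intros) auto
    also have "\<dots> = (\<Sum>k\<le>D. A k z * (f z ^ k - g z ^ k))"
      by (simp add: sum_subtractf right_diff_distrib)
    also have "\<dots> = Q z * (f z - g z)"
      unfolding Q_def sum_distrib_right
      by (intro sum.cong refl, subst power_diff_sumr2) (simp only: mult_ac)
    finally show "norm (deriv (\<lambda>z. f z - g z) z) \<le> B * norm (f z - g z)"
      using B[of z] z by (auto simp: norm_mult intro!: mult_right_mono)
  qed (use eq in auto)
  show ?thesis
  proof (rule analytic_continuation_open[OF open_ball[of z0 r] S(1) _ S(2) _ hf hg _ z])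
    show "ball z0 r \<subseteq> S" using r(2) by auto
    show "f y = g y" if "y \<in> ball z0 r" for y using *[OF that] by simp
  qed (use r(1) in simp)
qed

text \<open>For w = 1 / u the equation u' = (sum of A_k u^k) becomes w' = - q(z, w) / w^(D - 2) when
  D >= 2, so the inverse function z(w) satisfies dz/dw = - w^(D - 2) / q(z, w). This is regular at w
  = 0, because q(z, 0) = A_D(z) is nonzero. The radius is uniform over K, and since |w0| < \<rho> /
  2, the disc around w0 contains 0.\<close>

lemma inverse_ode_exists:
  fixes A :: "nat \<Rightarrow> complex \<Rightarrow> complex" and D :: nat
  defines "q \<equiv> \<lambda>z w. \<Sum>k\<le>D. A k z * w ^ (D - k)"
  assumes K: "compact K" "open W" "K \<subseteq> W" and hol: "\<And>k. k \<le> D \<Longrightarrow> A k holomorphic_on W"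
    and nz: "\<And>z. z \<in> W \<Longrightarrow> A D z \<noteq> 0"
  obtains \<rho> R m where "\<rho> > 0" "R > 0" "m > 0" "\<rho> \<le> 1" "\<And>z0. z0 \<in> K \<Longrightarrow> ball z0 R \<subseteq> W"
    "\<And>z0 z w. z0 \<in> K \<Longrightarrow> z \<in> ball z0 R \<Longrightarrow> norm w < \<rho> \<Longrightarrow> norm (q z w) \<ge> m"
    "\<And>z0 w0. z0 \<in> K \<Longrightarrow> norm w0 < \<rho> / 2 \<Longrightarrow>
       \<exists>Z. Z w0 = z0 \<and> (\<forall>w\<in>ball w0 (\<rho> / 2). (Z has_field_derivative - (w ^ (D - 2) / q (Z w) w)) (at w))"
proof -
  obtain \<epsilon> C where \<epsilon>: "\<epsilon> > 0" "C \<ge> 1" "\<And>z0. z0 \<in> K \<Longrightarrow> cball z0 \<epsilon> \<subseteq> W"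
    "\<And>z0 z k. z0 \<in> K \<Longrightarrow> z \<in> cball z0 \<epsilon> \<Longrightarrow> k \<le> D \<Longrightarrow> norm (A k z) \<le> C"
    "compact (\<Union>z0\<in>K. cball z0 \<epsilon>)"
    by (rule compact_nbhd_bounds[OF K hol]) (assumption, rule that)
  define K' where "K' = (\<Union>z0\<in>K. cball z0 \<epsilon>)"
  have K'W: "K' \<subseteq> W" using \<epsilon>(3) by (auto simp: K'_def)
  obtain m0 where m0: "m0 > 0" "\<And>z. z \<in> K' \<Longrightarrow> norm (A D z) \<ge> m0"
  proof (cases "K' = {}")
    case False
    have "continuous_on K' (\<lambda>z. norm (A D z))"
      by (intro continuous_intros holomorphic_on_imp_continuous_on holomorphic_on_subset[OF hol K'W]) simp
    then obtain z1 where "z1 \<in> K'" "\<And>z. z \<in> K' \<Longrightarrow> norm (A D z1) \<le> norm (A D z)"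
      using continuous_attains_inf[of K' "\<lambda>z. norm (A D z)"] \<epsilon>(5) False unfolding K'_def by blast
    thus ?thesis using nz K'W that[of "norm (A D z1)"] by auto
  qed (use that[of 1] in auto)
  \<comment> \<open>Chosen so that the terms of q other than A_D contribute at most D C \<rho>0 <=
    m0 / 2, which leaves |q| >= m0 / 2.\<close>
  define \<rho>0 where "\<rho>0 = min 1 (m0 / (2 * (real D * C + 1)))"
  have DC: "real D * C + 1 > 0" using \<epsilon>(2) by (smt (verit) mult_nonneg_nonneg of_nat_0_le_iff)
  have \<rho>0: "\<rho>0 > 0" "\<rho>0 \<le> 1" using m0(1) DC by (auto simp: \<rho>0_def)
  have \<rho>0': "\<rho>0 * (2 * (real D * C + 1)) \<le> m0"
    using DC by (subst pos_le_divide_eq[symmetric]) (auto simp: \<rho>0_def)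
  have qm: "norm (q z w) \<ge> m0 / 2" if z: "z \<in> K'" and w: "norm w < \<rho>0" for z w
  proof -
    have "norm (\<Sum>k<D. A k z * w ^ (D - k)) \<le> real (card {..<D}) * (C * \<rho>0)"
    proof (rule sum_norm_bound)
      fix k assume k: "k \<in> {..<D}"
      have "norm w ^ (D - k) \<le> norm w ^ 1"
        using w \<rho>0 k by (intro power_decreasing) auto
      hence "norm w ^ (D - k) \<le> \<rho>0" using w by simp
      moreover have "norm (A k z) \<le> C" using z \<epsilon>(4)[of _ z k] k by (auto simp: K'_def)
      ultimately show "norm (A k z * w ^ (D - k)) \<le> C * \<rho>0"
        using \<epsilon>(2) by (simp add: norm_mult norm_power mult_mono)
    qed
    also have "\<dots> \<le> \<rho>0 * (real D * C + 1)" using \<rho>0 by (simp add: algebra_simps)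
    also have "\<dots> \<le> m0 / 2" using \<rho>0' by (simp add: algebra_simps)
    finally have 1: "norm (\<Sum>k<D. A k z * w ^ (D - k)) \<le> m0 / 2" .
    have "q z w = A D z + (\<Sum>k<D. A k z * w ^ (D - k))"
      by (simp add: q_def lessThan_Suc_atMost[symmetric])
    hence "norm (q z w) \<ge> norm (A D z) - norm (\<Sum>k<D. A k z * w ^ (D - k))"
      by (simp add: norm_diff_ineq)
    thus ?thesis using 1 m0(2)[OF z] by linarith
  qed
  \<comment> \<open>The bound \<epsilon> m0 / 8 is the condition 4 r M <= R for the radius r =
    \<rho> / 2, the bound M = 2 / m0 and R = \<epsilon> / 2.\<close>
  define \<rho> where "\<rho> = min \<rho>0 (\<epsilon> * m0 / 8)"
  have \<rho>: "\<rho> > 0" "\<rho> \<le> \<rho>0" using \<rho>0 m0 \<epsilon>(1) by (auto simp: \<rho>_def)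
  have "4 * (\<rho> / 2) * (2 / m0) \<le> \<epsilon> / 2"
    using m0 by (simp add: \<rho>_def field_simps min_def)
  have Zex: "\<exists>Z. Z w0 = z0 \<and> (\<forall>w\<in>ball w0 (\<rho> / 2). (Z has_field_derivative - (w ^ (D - 2) / q (Z w) w)) (at w))"
    if z0: "z0 \<in> K" and w0: "norm w0 < \<rho> / 2" for z0 w0
  proof -
    have w: "norm w < \<rho>0" "norm w \<le> 1" if "w \<in> ball w0 (\<rho> / 2)" for w
    proof -
      have "norm w \<le> norm w0 + norm (w - w0)" by (metis add.commute norm_triangle_sub)
      thus "norm w < \<rho>0" using that w0 \<rho> by (simp add: dist_norm norm_minus_commute)
      thus "norm w \<le> 1" using \<rho>0 by simp
    qed
    have zK: "z \<in> K'" if "z \<in> ball z0 \<epsilon>" for z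
      using that z0 by (force simp: K'_def)
    have qnz: "q z w \<noteq> 0" if "w \<in> ball w0 (\<rho> / 2)" "z \<in> ball z0 \<epsilon>" for z w
      using qm[OF zK w(1), of z w] that m0 by auto
    obtain Z where "Z w0 = z0"
      "\<And>w. w \<in> ball w0 (\<rho> / 2) \<Longrightarrow> (Z has_field_derivative - (w ^ (D - 2) / q (Z w) w)) (at w)"
    proof (rule complex_ode_exists_holomorphic[of "\<rho> / 2" "\<epsilon> / 2" w0 z0 "\<lambda>w z. - (w ^ (D - 2) / q z w)" "2 / m0"])
      fix g assume g: "g holomorphic_on ball w0 (\<rho> / 2)" "g ` ball w0 (\<rho> / 2) \<subseteq> cball z0 (\<epsilon> / 2)"
      have gW: "g ` ball w0 (\<rho> / 2) \<subseteq> W" using g(2) \<epsilon>(1) \<epsilon>(3)[OF z0] by force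
      have "(\<lambda>w. A k (g w)) holomorphic_on ball w0 (\<rho> / 2)" if "k \<le> D" for k
        using holomorphic_on_compose_gen[OF g(1) hol[OF that] gW] by (simp add: o_def)
      moreover have "q (g w) w \<noteq> 0" if "w \<in> ball w0 (\<rho> / 2)" for w
        by (rule qnz[OF that]) (use g(2) that \<epsilon>(1) in force)
      ultimately show "(\<lambda>w. - (w ^ (D - 2) / q (g w) w)) holomorphic_on ball w0 (\<rho> / 2)"
        unfolding q_def by (intro holomorphic_intros) auto
    next
      fix w assume wb: "w \<in> ball w0 (\<rho> / 2)"
      have "A k holomorphic_on ball z0 (2 * (\<epsilon> / 2))" if "k \<le> D" for k
        by (rule holomorphic_on_subset[OF hol[OF that]]) (use \<epsilon>(3)[OF z0] in force)
      thus "(\<lambda>z. - (w ^ (D - 2) / q z w)) holomorphic_on ball z0 (2 * (\<epsilon> / 2))"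
        using qnz[OF wb] unfolding q_def by (intro holomorphic_intros) auto
      fix z assume "z \<in> ball z0 (2 * (\<epsilon> / 2))"
      hence "norm (q z w) \<ge> m0 / 2" using qm zK w(1)[OF wb] by simp
      moreover have "norm w ^ (D - 2) \<le> 1" using w(2)[OF wb] by (simp add: power_le_one)
      ultimately have "norm w ^ (D - 2) / norm (q z w) \<le> 1 / (m0 / 2)"
        using m0(1) by (intro frac_le) auto
      thus "norm (- (w ^ (D - 2) / q z w)) \<le> 2 / m0" by (simp add: norm_divide norm_power)
    qed (use \<rho> \<epsilon>(1) \<open>4 * (\<rho> / 2) * (2 / m0) \<le> \<epsilon> / 2\<close> in auto)
    thus ?thesis by blast
  qed
  show ?thesis
  proof (rule that[of \<rho> \<epsilon> "m0 / 2"])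
    show "ball z0 \<epsilon> \<subseteq> W" if "z0 \<in> K" for z0 using \<epsilon>(3)[OF that] by force
    show "m0 / 2 \<le> norm (q z w)" if "z0 \<in> K" "z \<in> ball z0 \<epsilon>" "norm w < \<rho>" for z0 z w
      using that \<rho> by (intro qm) (force simp: K'_def)+
  qed (use \<rho> \<rho>0 \<epsilon>(1) m0(1) Zex in auto)
qed

section \<open>Open rectangles and strips free of zeros\<close>

definition rect :: "real \<Rightarrow> real \<Rightarrow> real \<Rightarrow> real \<Rightarrow> complex set" where
  "rect a b c d = {z. a < Re z \<and> Re z < b \<and> c < Im z \<and> Im z < d}"

lemma mem_rect: "z \<in> rect a b c d \<longleftrightarrow> a < Re z \<and> Re z < b \<and> c < Im z \<and> Im z < d"
  by (simp add: rect_def)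

lemma rect_eq_box: "rect a b c d = box (Complex a c) (Complex b d)"
  by (auto simp: rect_def in_box_complex_iff)

lemma open_rect [simp]: "open (rect a b c d)"
  by (simp add: rect_eq_box open_box)

lemma convex_rect [simp]: "convex (rect a b c d)"
  by (simp add: rect_eq_box convex_box)

lemma connected_rect [simp]: "connected (rect a b c d)"
  by (simp add: convex_connected)

lemma rect_nonempty: "a < b \<Longrightarrow> c < d \<Longrightarrow> rect a b c d \<noteq> {}"
  using mem_rect[of "Complex ((a + b) / 2) ((c + d) / 2)"] by force

lemma rect_subset: "a \<le> a' \<Longrightarrow> b' \<le> b \<Longrightarrow> c \<le> c' \<Longrightarrow> d' \<le> d \<Longrightarrow> rect a' b' c' d' \<subseteq> rect a b c d"
  by (auto simp: mem_rect)

lemma open_imp_fsigma: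
  fixes S :: "'a :: euclidean_space set"
  assumes "open S"
  shows "fsigma S"
  unfolding fsigma_Union_compact
  using open_Union_compact_subsets[OF assms] by (metis image_subset_iff mem_Collect_eq)

text \<open>The zeros are countable, so some vertical line in the rectangle avoids all of them. A
  compact segment of that line has a neighbourhood without zeros.\<close>

lemma nonzero_strip:
  assumes hol: "g holomorphic_on rect a b c d" and ex: "\<exists>z\<in>rect a b c d. g z \<noteq> 0"
    and "a < b" and cd: "c < c'" "c' \<le> d'" "d' < d"
  obtains a' b' where "a < a'" "a' < b'" "b' < b"
    "\<And>z. a' \<le> Re z \<Longrightarrow> Re z \<le> b' \<Longrightarrow> c' \<le> Im z \<Longrightarrow> Im z \<le> d' \<Longrightarrow> g z \<noteq> 0"
proof -
  define Z where "Z = {z \<in> rect a b c d. g z = 0}"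
  have "countable Z"
  proof (cases "g constant_on rect a b c d")
    case True
    hence "Z = {}" using ex by (auto simp: Z_def constant_on_def)
    thus ?thesis by simp
  next
    case False
    thus ?thesis
      unfolding Z_def by (intro holomorphic_countable_zeros[OF hol] open_imp_fsigma) auto
  qed
  hence "countable (Re ` Z)" by simp
  hence "\<not> {a<..<b} \<subseteq> Re ` Z"
    using uncountable_open_interval[of a b] \<open>a < b\<close> countable_subset by blast
  then obtain x where "x \<in> {a<..<b}" "x \<notin> Re ` Z" by blast
  hence x: "a < x" "x < b" "x \<notin> Re ` Z" by simp_all
  define S where "S = {z \<in> rect a b c d. g z \<noteq> 0}"
  have "open S"
  proof -
    have "open (rect a b c d \<inter> g -` (- {0}))"
      by (intro continuous_open_preimage holomorphic_on_imp_continuous_on[OF hol]) auto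
    also have "rect a b c d \<inter> g -` (- {0}) = S" by (auto simp: S_def)
    finally show ?thesis .
  qed
  moreover have "closed_segment (Complex x c') (Complex x d') \<subseteq> S"
  proof
    fix z assume "z \<in> closed_segment (Complex x c') (Complex x d')"
    hence "Re z = x" "c' \<le> Im z" "Im z \<le> d'"
      using cd by (simp_all add: closed_segment_same_Re closed_segment_eq_real_ivl)
    thus "z \<in> S" using x cd by (force simp: S_def Z_def mem_rect)
  qed
  ultimately obtain e where e: "e > 0" "(\<Union>z\<in>closed_segment (Complex x c') (Complex x d'). cball z e) \<subseteq> S"
    using compact_subset_open_imp_cball_epsilon_subset[of "closed_segment (Complex x c') (Complex x d')" S] by auto
  define e' where "e' = min e (min (x - a) (b - x) / 2)"
  have e': "e' > 0" "e' \<le> e" "a < x - e'" "x + e' < b" using e x by (auto simp: e'_def min_def field_simps)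
  show ?thesis
  proof (rule that[of "x - e'" "x + e'"])
    fix z assume z: "x - e' \<le> Re z" "Re z \<le> x + e'" "c' \<le> Im z" "Im z \<le> d'"
    have "Complex x (Im z) \<in> closed_segment (Complex x c') (Complex x d')"
      using z cd by (auto simp: closed_segment_same_Re closed_segment_eq_real_ivl)
    moreover have "z \<in> cball (Complex x (Im z)) e"
      using z e' by (auto simp: dist_norm cmod_def)
    ultimately have "z \<in> S" using e(2) by blast
    thus "g z \<noteq> 0" by (simp add: S_def)
  qed (use e' in auto)
qed

section \<open>Vertical continuation of solutions\<close>

lemma holomorphic_on_derivI:
  assumes "\<And>z. z \<in> S \<Longrightarrow> (f has_field_derivative f' z) (at z)"
  shows "f holomorphic_on S"
  unfolding holomorphic_on_def field_differentiable_def
  using assms has_field_derivative_at_within by blast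

text \<open>A solution f is given above height e and is to be pushed down towards height c. The
  closed rectangle contained in W supplies the compact set over which existence radii are
  uniform.\<close>

locale vertical_ode =
  fixes A :: "nat \<Rightarrow> complex \<Rightarrow> complex" and D :: nat and a b c d e :: real
    and W :: "complex set" and f :: "complex \<Rightarrow> complex"
  assumes ab: "a < b" and ce: "c < e" and ed: "e < d"
    and oW: "open W" and KW: "{z. a \<le> Re z \<and> Re z \<le> b \<and> c \<le> Im z \<and> Im z \<le> d} \<subseteq> W"
    and hol: "\<And>k. k \<le> D \<Longrightarrow> A k holomorphic_on W"
    and ode: "\<And>z. z \<in> rect a b e d \<Longrightarrow> (f has_field_derivative (\<Sum>k\<le>D. A k z * f z ^ k)) (at z)"
begin

definition K where "K = {z. a \<le> Re z \<and> Re z \<le> b \<and> c \<le> Im z \<and> Im z \<le> d}"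

lemma compact_K: "compact K"
proof -
  have "K = cbox (Complex a c) (Complex b d)" by (auto simp: K_def in_cbox_complex_iff)
  thus ?thesis by simp
qed

text \<open>All continuations live on rectangles with the common top edge d. Two overlapping ones
  then meet in a rectangle that reaches above height e, where both equal f; so they agree on the
  overlap, and all of them glue to the single function \<open>F\<close> on
  \<open>\<Omega>\<close>.\<close>

definition ext where
  "ext \<alpha> \<beta> t g \<longleftrightarrow> a \<le> \<alpha> \<and> \<alpha> < \<beta> \<and> \<beta> \<le> b \<and> c \<le> t \<and> t \<le> e \<and>
     g holomorphic_on rect \<alpha> \<beta> t d \<and> (\<forall>z\<in>rect \<alpha> \<beta> e d. g z = f z)"

definition \<Omega> where "\<Omega> = {z. \<exists>\<alpha> \<beta> t g. ext \<alpha> \<beta> t g \<and> z \<in> rect \<alpha> \<beta> t d}"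

definition F where "F z = (SOME v. \<exists>\<alpha> \<beta> t g. ext \<alpha> \<beta> t g \<and> z \<in> rect \<alpha> \<beta> t d \<and> v = g z)"

lemma ext_unique:
  assumes 1: "ext \<alpha> \<beta> t g" "z \<in> rect \<alpha> \<beta> t d" and 2: "ext \<alpha>' \<beta>' t' g'" "z \<in> rect \<alpha>' \<beta>' t' d"
  shows "g z = g' z"
proof (rule analytic_continuation_open[of "rect (max \<alpha> \<alpha>') (min \<beta> \<beta>') e d" "rect (max \<alpha> \<alpha>') (min \<beta> \<beta>') (max t t') d" g g'])
  show "rect (max \<alpha> \<alpha>') (min \<beta> \<beta>') e d \<noteq> {}"
    using 1 2 ed by (intro rect_nonempty) (auto simp: mem_rect)
  show "rect (max \<alpha> \<alpha>') (min \<beta> \<beta>') e d \<subseteq> rect (max \<alpha> \<alpha>') (min \<beta> \<beta>') (max t t') d"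
    using 1 2 by (intro rect_subset) (auto simp: ext_def)
  show "g holomorphic_on rect (max \<alpha> \<alpha>') (min \<beta> \<beta>') (max t t') d"
    by (rule holomorphic_on_subset[of _ "rect \<alpha> \<beta> t d"]) (use 1 in \<open>auto simp: ext_def mem_rect\<close>)
  show "g' holomorphic_on rect (max \<alpha> \<alpha>') (min \<beta> \<beta>') (max t t') d"
    by (rule holomorphic_on_subset[of _ "rect \<alpha>' \<beta>' t' d"]) (use 2 in \<open>auto simp: ext_def mem_rect\<close>)
  show "g w = g' w" if "w \<in> rect (max \<alpha> \<alpha>') (min \<beta> \<beta>') e d" for w
  proof -
    have "w \<in> rect \<alpha> \<beta> e d" "w \<in> rect \<alpha>' \<beta>' e d" using that by (auto simp: mem_rect)
    thus ?thesis using 1(1) 2(1) by (simp add: ext_def)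
  qed
  show "z \<in> rect (max \<alpha> \<alpha>') (min \<beta> \<beta>') (max t t') d"
    using 1 2 by (auto simp: mem_rect)
qed auto

lemma F_eq:
  assumes "ext \<alpha> \<beta> t g" "z \<in> rect \<alpha> \<beta> t d"
  shows "F z = g z"
proof -
  have "\<exists>\<alpha>' \<beta>' t' g'. ext \<alpha>' \<beta>' t' g' \<and> z \<in> rect \<alpha>' \<beta>' t' d \<and> F z = g' z"
    unfolding F_def by (rule someI_ex) (use assms in blast)
  thus ?thesis using ext_unique[OF assms] by auto
qed

lemma open_\<Omega>: "open \<Omega>"
proof -
  have "\<Omega> = (\<Union>(\<alpha>, \<beta>, t, g)\<in>{(\<alpha>, \<beta>, t, g). ext \<alpha> \<beta> t g}. rect \<alpha> \<beta> t d)"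
    by (auto simp: \<Omega>_def)
  thus ?thesis by (simp only:) (auto intro!: open_UN)
qed

lemma \<Omega>_subset: "\<Omega> \<subseteq> K"
  by (auto simp: \<Omega>_def K_def ext_def mem_rect)

lemma K_subset: "K \<subseteq> W"
  using KW by (simp add: K_def)

lemma ext_f: "ext a b e f"
proof -
  have "f holomorphic_on rect a b e d"
    by (rule holomorphic_on_derivI[OF ode])
  thus ?thesis using ab ce by (auto simp: ext_def)
qed

text \<open>Permanence of the equation: both sides are holomorphic on the whole rectangle and agree
  above height e.\<close>

lemma ext_ode:
  assumes g: "ext \<alpha> \<beta> t g" and z: "z \<in> rect \<alpha> \<beta> t d"
  shows "(g has_field_derivative (\<Sum>k\<le>D. A k z * g z ^ k)) (at z)"
proof -
  have hg: "g holomorphic_on rect \<alpha> \<beta> t d" using g by (simp add: ext_def)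
  have sub: "rect \<alpha> \<beta> t d \<subseteq> W"
    using g K_subset by (auto simp: ext_def K_def mem_rect)
  have "deriv g z = (\<Sum>k\<le>D. A k z * g z ^ k)"
  proof (rule analytic_continuation_open[of "rect \<alpha> \<beta> e d" "rect \<alpha> \<beta> t d"
        "deriv g" "\<lambda>z. \<Sum>k\<le>D. A k z * g z ^ k"])
    show "rect \<alpha> \<beta> e d \<noteq> {}" using g ed by (intro rect_nonempty) (auto simp: ext_def)
    show "rect \<alpha> \<beta> e d \<subseteq> rect \<alpha> \<beta> t d" using g by (intro rect_subset) (auto simp: ext_def)
    show "deriv g holomorphic_on rect \<alpha> \<beta> t d" by (intro holomorphic_deriv hg) auto
    show "(\<lambda>z. \<Sum>k\<le>D. A k z * g z ^ k) holomorphic_on rect \<alpha> \<beta> t d"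
      by (intro holomorphic_intros hg holomorphic_on_subset[OF hol sub]) auto
    fix w assume w: "w \<in> rect \<alpha> \<beta> e d"
    have gf: "g y = f y" if "y \<in> rect \<alpha> \<beta> e d" for y using g that by (simp add: ext_def)
    have "w \<in> rect a b e d" using g w by (auto simp: ext_def mem_rect)
    hence "(f has_field_derivative (\<Sum>k\<le>D. A k w * g w ^ k)) (at w)"
      using ode[of w] gf[OF w] by simp
    hence "(g has_field_derivative (\<Sum>k\<le>D. A k w * g w ^ k)) (at w)"
      by (rule has_field_derivative_transform_within_open[OF _ open_rect w]) (simp add: gf)
    thus "deriv g w = (\<Sum>k\<le>D. A k w * g w ^ k)" by (rule DERIV_imp_deriv)
  qed (use z in auto)
  thus ?thesis using holomorphic_derivI[OF hg open_rect z] by simp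
qed

lemma F_ode:
  assumes "z \<in> \<Omega>"
  shows "(F has_field_derivative (\<Sum>k\<le>D. A k z * F z ^ k)) (at z)"
proof -
  obtain \<alpha> \<beta> t g where g: "ext \<alpha> \<beta> t g" and z: "z \<in> rect \<alpha> \<beta> t d"
    using assms by (auto simp: \<Omega>_def)
  have "(g has_field_derivative (\<Sum>k\<le>D. A k z * F z ^ k)) (at z)"
    using ext_ode[OF g z] F_eq[OF g z] by simp
  thus ?thesis
    by (rule has_field_derivative_transform_within_open[OF _ open_rect z]) (simp add: F_eq[OF g])
qed

lemma continuous_F: "continuous_on \<Omega> F"
  by (rule DERIV_continuous_on) (rule has_field_derivative_at_within[OF F_ode])

lemma \<Omega>_up:
  assumes "Complex x y \<in> \<Omega>" "y \<le> y'" "y' < d"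
  shows "Complex x y' \<in> \<Omega>"
  using assms unfolding \<Omega>_def mem_rect by fastforce

text \<open>A solution that stays bounded on approach to a boundary point extends past it, since the
  radius of existence depends only on a bound for the initial value.\<close>

lemma extend_down:
  assumes z0: "z0 \<in> \<Omega>" and \<delta>: "\<delta> > 0" "ball z0 \<delta> \<subseteq> W"
    and u: "u z0 = F z0" "\<And>z. z \<in> ball z0 \<delta> \<Longrightarrow> (u has_field_derivative (\<Sum>k\<le>D. A k z * u z ^ k)) (at z)"
    and y: "Im z0 - \<delta> / 2 < y" "c < y" "y \<le> Im z0"
  shows "Complex (Re z0) y \<in> \<Omega>"
proof -
  obtain \<alpha> \<beta> t g where g: "ext \<alpha> \<beta> t g" and zg: "z0 \<in> rect \<alpha> \<beta> t d"
    using z0 by (auto simp: \<Omega>_def)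
  \<comment> \<open>Below height t the new rectangle keeps within \<delta> / 2 of z0 in both
    coordinates, so it lies in the ball because |z| <= |Re z| + |Im z|. Above t it lies in the old
    rectangle. The maximum with c in \<open>t'\<close> keeps it inside K.\<close>
  define \<eta> where "\<eta> = min (\<delta> / 2) (min (Re z0 - \<alpha>) (\<beta> - Re z0))"
  define t' where "t' = max c (min t (Im z0 - \<delta> / 2))"
  define g' where "g' = (\<lambda>z. if z \<in> ball z0 \<delta> then u z else g z)"
  have \<eta>: "\<eta> > 0" "\<eta> \<le> \<delta> / 2" "\<alpha> \<le> Re z0 - \<eta>" "Re z0 + \<eta> \<le> \<beta>"
    using zg \<delta> by (auto simp: \<eta>_def mem_rect min_def)
  have tc: "c \<le> t" "t \<le> e" "t < Im z0" "Im z0 < d" using g zg by (auto simp: ext_def mem_rect)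
  have ug: "u z = g z" if "z \<in> ball z0 \<delta> \<inter> rect \<alpha> \<beta> t d" for z
  proof (rule poly_ode_unique[where S = "ball z0 \<delta> \<inter> rect \<alpha> \<beta> t d" and A = A and D = D and f = u and g = g])
    show "connected (ball z0 \<delta> \<inter> rect \<alpha> \<beta> t d)"
      by (intro convex_connected convex_Int) auto
    show "A k holomorphic_on ball z0 \<delta> \<inter> rect \<alpha> \<beta> t d" if "k \<le> D" for k
      by (rule holomorphic_on_subset[OF hol[OF that]]) (use \<delta> in auto)
    show "u z0 = g z0" using u(1) F_eq[OF g zg] by simp
    show "z0 \<in> ball z0 \<delta> \<inter> rect \<alpha> \<beta> t d" using zg \<delta> by auto
  qed (use u(2) ext_ode[OF g] that in auto)
  have hol': "g' holomorphic_on ball z0 \<delta> \<union> rect \<alpha> \<beta> t d"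
    unfolding g'_def
  proof (rule holomorphic_on_If_Un)
    show "u holomorphic_on ball z0 \<delta>" by (rule holomorphic_on_derivI[OF u(2)])
    show "g holomorphic_on rect \<alpha> \<beta> t d" using g by (simp add: ext_def)
    show "u z = g z" if "z \<in> ball z0 \<delta>" "z \<in> rect \<alpha> \<beta> t d" for z using ug that by blast
  qed auto
  have sub: "rect (Re z0 - \<eta>) (Re z0 + \<eta>) t' d \<subseteq> ball z0 \<delta> \<union> rect \<alpha> \<beta> t d"
  proof
    fix z assume z: "z \<in> rect (Re z0 - \<eta>) (Re z0 + \<eta>) t' d"
    show "z \<in> ball z0 \<delta> \<union> rect \<alpha> \<beta> t d"
    proof (cases "Im z > t")
      case True
      thus ?thesis using z \<eta> by (auto simp: mem_rect)
    next
      case False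
      have "Re z0 - \<eta> < Re z" "Re z < Re z0 + \<eta>" "min t (Im z0 - \<delta> / 2) < Im z"
        using z by (auto simp: mem_rect t'_def)
      hence "\<bar>Re (z0 - z)\<bar> < \<delta> / 2" "\<bar>Im (z0 - z)\<bar> < \<delta> / 2"
        using False \<eta>(2) tc(3) unfolding minus_complex.simps by linarith+
      hence "norm (z0 - z) < \<delta>" using cmod_le[of "z0 - z"] by linarith
      thus ?thesis by (simp add: dist_norm)
    qed
  qed
  have "ext (Re z0 - \<eta>) (Re z0 + \<eta>) t' g'"
    unfolding ext_def
  proof (intro conjI ballI)
    show "g' holomorphic_on rect (Re z0 - \<eta>) (Re z0 + \<eta>) t' d"
      by (rule holomorphic_on_subset[OF hol' sub])
    fix z assume "z \<in> rect (Re z0 - \<eta>) (Re z0 + \<eta>) e d"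
    hence z: "z \<in> rect \<alpha> \<beta> e d" "z \<in> rect \<alpha> \<beta> t d" using \<eta> tc by (auto simp: mem_rect)
    have "g' z = g z" using ug z(2) by (auto simp: g'_def)
    also have "\<dots> = f z" using g z(1) by (simp add: ext_def)
    finally show "g' z = f z" .
  qed (use g \<eta> tc in \<open>auto simp: ext_def t'_def\<close>)
  moreover have "Complex (Re z0) y \<in> rect (Re z0 - \<eta>) (Re z0 + \<eta>) t' d"
    using y \<eta> tc by (auto simp: mem_rect t'_def)
  ultimately show ?thesis unfolding \<Omega>_def by blast
qed

text \<open>The height \<tau> is the infimum of the heights at which the vertical line lies in
  \<open>\<Omega>\<close>. It is not attained, because \<open>\<Omega>\<close> is open.\<close>

lemma boundary_point:
  assumes "a < x" "x < b" "c < c'" "c' < e" and none: "Complex x c' \<notin> \<Omega>"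
  obtains \<tau> where "c' \<le> \<tau>" "\<tau> \<le> e" "Complex x \<tau> \<notin> \<Omega>" "\<And>y. \<tau> < y \<Longrightarrow> y < d \<Longrightarrow> Complex x y \<in> \<Omega>"
proof -
  define T where "T = {y. y < d \<and> Complex x y \<in> \<Omega>}"
  have top: "y \<in> T" if "e < y" "y < d" for y
  proof -
    have "Complex x y \<in> rect a b e d" using that assms by (simp add: mem_rect)
    hence "Complex x y \<in> \<Omega>" using ext_f unfolding \<Omega>_def by blast
    thus ?thesis using that by (simp add: T_def)
  qed
  have lower: "c' < y" if "y \<in> T" for y
  proof (rule ccontr)
    assume "\<not> c' < y"
    hence "Complex x c' \<in> \<Omega>"
      using \<Omega>_up[of x y c'] that \<open>c' < e\<close> ed by (simp add: T_def)
    thus False using none by blast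
  qed
  have bdd: "bdd_below T" by (rule bdd_belowI[of _ c']) (use lower in \<open>simp add: less_imp_le\<close>)
  have ne: "T \<noteq> {}" using top[of "(e + d) / 2"] ed by auto
  have "Inf T \<le> e"
    by (rule dense_ge_bounded[OF ed]) (intro cInf_lower top bdd)
  moreover have up: "Complex x y \<in> \<Omega>" if lt: "Inf T < y" "y < d" for y
  proof -
    obtain y' where "y' \<in> T" "y' < y" using cInf_lessD[OF ne lt(1)] by blast
    thus ?thesis using \<Omega>_up[of x y' y] lt by (simp add: T_def)
  qed
  moreover have "Complex x (Inf T) \<notin> \<Omega>"
  proof
    assume "Complex x (Inf T) \<in> \<Omega>"
    then obtain r where r: "r > 0" "ball (Complex x (Inf T)) r \<subseteq> \<Omega>"
      using openE[OF open_\<Omega>] by blast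
    have "Complex x (Inf T - r / 2) \<in> ball (Complex x (Inf T)) r"
      using r by (simp add: dist_norm cmod_def)
    hence "Inf T - r / 2 \<in> T"
      using r \<open>Inf T \<le> e\<close> ed unfolding T_def by auto
    thus False using cInf_lower[OF _ bdd, of "Inf T - r / 2"] r by simp
  qed
  moreover have "c' \<le> Inf T" using lower ne by (intro cInf_greatest) (auto intro: less_imp_le)
  ultimately show ?thesis using that by blast
qed

text \<open>If |F| <= L at a point of the line less than \<delta> / 2 above \<tau>, the solution
  through this point exists on a disc of radius \<delta> and \<open>extend_down\<close> reaches
  \<tau>. For D <= 1 this works without any bound, so singularities force D >= 2.\<close>

lemma blow_up:
  assumes \<tau>: "c < \<tau>" "\<tau> < d" "Complex x \<tau> \<notin> \<Omega>" "\<And>y. \<tau> < y \<Longrightarrow> y < d \<Longrightarrow> Complex x y \<in> \<Omega>"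
  shows "\<exists>y1>\<tau>. y1 \<le> d \<and> (\<forall>y. \<tau> < y \<and> y < y1 \<longrightarrow> norm (F (Complex x y)) > L)" and "D \<ge> 2"
proof -
  obtain \<delta> where \<delta>: "\<delta> > 0" "\<And>z0. z0 \<in> K \<Longrightarrow> ball z0 \<delta> \<subseteq> W"
    "\<And>z0 u0. z0 \<in> K \<Longrightarrow> norm u0 \<le> L \<or> D \<le> 1 \<Longrightarrow>
       \<exists>u. u z0 = u0 \<and> (\<forall>z\<in>ball z0 \<delta>. (u has_field_derivative (\<Sum>k\<le>D. A k z * u z ^ k)) (at z))"
    by (rule poly_ode_exists[OF compact_K oW K_subset hol, where L = L]) (assumption, rule that)
  define y1 where "y1 = min d (\<tau> + \<delta> / 2)"
  have y1: "\<tau> < y1" "y1 \<le> d" using \<delta>(1) \<tau>(2) by (auto simp: y1_def)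
  have *: "norm (F (Complex x y)) > L \<and> D \<ge> 2" if y: "\<tau> < y" "y < y1" for y
  proof (rule ccontr)
    assume neg: "\<not> (norm (F (Complex x y)) > L \<and> D \<ge> 2)"
    have in\<Omega>: "Complex x y \<in> \<Omega>" using \<tau>(4)[of y] y y1 by simp
    hence inK: "Complex x y \<in> K" using \<Omega>_subset by blast
    obtain u where u: "u (Complex x y) = F (Complex x y)"
      "\<And>z. z \<in> ball (Complex x y) \<delta> \<Longrightarrow> (u has_field_derivative (\<Sum>k\<le>D. A k z * u z ^ k)) (at z)"
      using \<delta>(3)[OF inK, of "F (Complex x y)"] neg by force
    have "Complex (Re (Complex x y)) \<tau> \<in> \<Omega>"
      by (rule extend_down[OF in\<Omega> \<delta>(1) \<delta>(2)[OF inK] u]) (use y \<tau> in \<open>auto simp: y1_def\<close>)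
    thus False using \<tau>(3) by simp
  qed
  show "\<exists>y1>\<tau>. y1 \<le> d \<and> (\<forall>y. \<tau> < y \<and> y < y1 \<longrightarrow> norm (F (Complex x y)) > L)"
    using * y1 by blast
  show "D \<ge> 2" using *[of "(\<tau> + y1) / 2"] y1 by auto
qed

text \<open>Near a singularity the inverse function of \<open>1 / F\<close> extends, with a uniform radius, through 0, and its
  value at 0 is the singularity. Hence each singularity is determined by any regular point close
  to it, for instance one of a countable dense set.\<close>

lemma singularities_countable:
  assumes nz: "\<And>z. z \<in> W \<Longrightarrow> A D z \<noteq> 0"
  shows "countable {Complex x \<tau> | x \<tau>. c < \<tau> \<and> \<tau> < d \<and> Complex x \<tau> \<notin> \<Omega> \<and>
           (\<forall>y. \<tau> < y \<and> y < d \<longrightarrow> Complex x y \<in> \<Omega>)}" (is "countable ?S")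
proof (cases "D \<ge> 2")
  case False
  hence "?S = {}" using blow_up(2) by blast
  thus ?thesis by (metis countable_empty)
next
  case D2: True
  define q where "q z w = (\<Sum>k\<le>D. A k z * w ^ (D - k))" for z w
  define G where "G w z = - (w ^ (D - 2) / q z w)" for w z
  obtain \<rho> R m where raw: "\<rho> > 0" "R > 0" "m > 0" "\<rho> \<le> 1" "\<And>z0. z0 \<in> K \<Longrightarrow> ball z0 R \<subseteq> W"
    "\<And>z0 z w. z0 \<in> K \<Longrightarrow> z \<in> ball z0 R \<Longrightarrow> norm w < \<rho> \<Longrightarrow> norm (\<Sum>k\<le>D. A k z * w ^ (D - k)) \<ge> m"
    "\<And>z0 w0. z0 \<in> K \<Longrightarrow> norm w0 < \<rho> / 2 \<Longrightarrow>
       \<exists>Z. Z w0 = z0 \<and> (\<forall>w\<in>ball w0 (\<rho> / 2).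
         (Z has_field_derivative - (w ^ (D - 2) / (\<Sum>k\<le>D. A k (Z w) * w ^ (D - k)))) (at w))"
    by (rule inverse_ode_exists[OF compact_K oW K_subset, where A = A and D = D])
       (erule hol, erule nz, rule that)
  note \<rho> = raw(1-5) raw(6)[folded q_def] raw(7)[folded q_def, folded G_def]
  define w where "w = (\<lambda>z. 1 / F z)"
  \<comment> \<open>The bound \<rho> / 4 ensures that for every z0 in \<open>U\<close> the disc of
    radius \<rho> / 2 around \<open>w z0\<close>, where the inverse function through z0 exists,
    contains 0 and all values of \<open>w\<close> on \<open>U\<close>.\<close>
  define U where "U = {z \<in> \<Omega>. F z \<noteq> 0 \<and> norm (w z) < \<rho> / 4}"
  have U: "U \<subseteq> \<Omega>" "\<And>z. z \<in> U \<Longrightarrow> F z \<noteq> 0 \<and> norm (w z) < \<rho> / 4" by (auto simp: U_def)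
  have w_nz: "w z \<noteq> 0" if "z \<in> U" for z using U(2)[OF that] by (simp add: w_def)
  have w_deriv: "(w has_field_derivative 1 / G (w z) z) (at z)" if z: "z \<in> U" for z
  proof -
    \<comment> \<open>As w' = - F' w^2 and D >= 2, multiplication by w^D turns the powers of F into
      powers of w and gives w' = - q / w^(D - 2) = 1 / G.\<close>
    have "w z ^ (D - 2) * w z ^ 2 * (\<Sum>k\<le>D. A k z * F z ^ k) = (\<Sum>k\<le>D. A k z * (w z ^ D * F z ^ k))"
    proof -
      have "w z ^ (D - 2) * w z ^ 2 = w z ^ D" by (metis D2 le_add_diff_inverse2 power_add)
      thus ?thesis by (simp only: sum_distrib_left mult_ac)
    qed
    also have "\<dots> = q z (w z)"
      unfolding q_def
    proof (intro sum.cong refl arg_cong[where f = "\<lambda>t. _ * t"])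
      fix k assume "k \<in> {..D}"
      hence "w z ^ D = w z ^ (D - k) * w z ^ k" by (simp flip: power_add)
      thus "w z ^ D * F z ^ k = w z ^ (D - k)"
        using U(2)[OF z] by (simp add: w_def power_one_over)
    qed
    finally have "(\<Sum>k\<le>D. A k z * F z ^ k) * w z ^ 2 = q z (w z) / w z ^ (D - 2)"
      using w_nz[OF z] by (simp add: field_simps)
    moreover have "(w has_field_derivative - ((\<Sum>k\<le>D. A k z * F z ^ k) * w z ^ 2)) (at z)"
      unfolding w_def using U z
      by (auto intro!: derivative_eq_intros F_ode simp: power2_eq_square divide_simps)
    ultimately show ?thesis by (simp add: G_def)
  qed
  have hw: "w holomorphic_on U'" if "U' \<subseteq> U" for U'
    by (rule holomorphic_on_derivI[OF w_deriv]) (use that in blast)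
  have "open U"
  proof -
    have "open (\<Omega> \<inter> F -` (- cball 0 (4 / \<rho>)))"
      by (intro continuous_open_preimage continuous_F open_\<Omega> open_Compl closed_cball)
    moreover have eq: "norm v > 4 / \<rho> \<longleftrightarrow> v \<noteq> 0 \<and> norm (1 / v) < \<rho> / 4" for v :: complex
    proof (cases "v = 0")
      case False
      thus ?thesis using \<rho>(1) by (simp add: norm_divide field_simps)
    qed (use \<rho>(1) in simp)
    have "\<Omega> \<inter> F -` (- cball 0 (4 / \<rho>)) = U"
      unfolding U_def w_def eq[symmetric] by auto
    ultimately show ?thesis by simp
  qed
  \<comment> \<open>The candidate for the inverse of \<open>w\<close> near z0, obtained from the
    equation dz/dw = G.\<close>
  define Zs where "Zs = (\<lambda>z0. SOME Z. Z (w z0) = z0 \<and>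
     (\<forall>v\<in>ball (w z0) (\<rho> / 2). (Z has_field_derivative G v (Z v)) (at v)))"
  have Zs: "Zs z0 (w z0) = z0" "\<And>v. v \<in> ball (w z0) (\<rho> / 2) \<Longrightarrow> (Zs z0 has_field_derivative G v (Zs z0 v)) (at v)"
    if "z0 \<in> U" for z0
  proof -
    have "\<exists>Z. Z (w z0) = z0 \<and> (\<forall>v\<in>ball (w z0) (\<rho> / 2). (Z has_field_derivative G v (Z v)) (at v))"
    proof (rule \<rho>(7)[of z0 "w z0"])
      show "z0 \<in> K" using U(1) that \<Omega>_subset by blast
      show "norm (w z0) < \<rho> / 2" using U(2)[OF that] \<rho>(1) by simp
    qed
    from someI_ex[OF this] show "Zs z0 (w z0) = z0"
      "\<And>v. v \<in> ball (w z0) (\<rho> / 2) \<Longrightarrow> (Zs z0 has_field_derivative G v (Zs z0 v)) (at v)"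
      unfolding Zs_def by blast+
  qed
  have w_ball: "w z \<in> ball (w z0) (\<rho> / 2)" if "z \<in> U" "z0 \<in> U" for z z0
    using U(2)[OF that(1)] U(2)[OF that(2)] norm_triangle_ineq4[of "w z0" "w z"]
    by (simp add: dist_norm)
  have local_inv: "\<exists>s>0. ball z0 s \<subseteq> U \<and> (\<forall>z\<in>ball z0 s. Zs z0 (w z) = z)" if z0: "z0 \<in> U" for z0
  proof -
    have z0K: "z0 \<in> K" using z0 U \<Omega>_subset by blast
    obtain s0 where s0: "s0 > 0" "cball z0 s0 \<subseteq> U" using \<open>open U\<close> z0 open_contains_cball by blast
    have cw: "continuous_on (cball z0 s0) w" by (intro holomorphic_on_imp_continuous_on hw s0)
    have "continuous_on (cball z0 s0) (\<lambda>z. deriv w z)"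
      by (intro holomorphic_on_imp_continuous_on holomorphic_on_subset[OF holomorphic_deriv[OF hw \<open>open U\<close>]] s0) auto
    hence "bounded (deriv w ` cball z0 s0)" by (intro compact_imp_bounded compact_continuous_image) auto
    then obtain B where B: "\<And>z. z \<in> cball z0 s0 \<Longrightarrow> norm (deriv w z) \<le> B" unfolding bounded_iff by blast
    have hZ: "Zs z0 holomorphic_on ball (w z0) (\<rho> / 2)"
      by (rule holomorphic_on_derivI[OF Zs(2)[OF z0]])
    have cZ: "continuous_on (cball z0 s0) (\<lambda>z. Zs z0 (w z))"
      by (rule continuous_on_compose2[OF holomorphic_on_imp_continuous_on[OF hZ] cw]) (use w_ball z0 s0 in blast)
    obtain s1 where s1: "s1 > 0" "\<And>z. z \<in> cball z0 s0 \<Longrightarrow> dist z z0 < s1 \<Longrightarrow> dist (Zs z0 (w z)) (Zs z0 (w z0)) < R / 2"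
      using cZ s0(1) \<rho>(2) unfolding continuous_on_iff by (metis centre_in_cball half_gt_zero less_imp_le)
    define s where "s = min s0 (min s1 (R / 2))"
    have s: "s > 0" "s \<le> s0" "s \<le> s1" "s \<le> R / 2" using s0 s1 \<rho>(2) by (auto simp: s_def)
    have sub: "ball z0 s \<subseteq> U" using s s0 by force
    \<comment> \<open>Here h' = w' (G(w, Zs(w)) - G(w, z)), and G is Lipschitz in its second
      argument on the ball of radius R / 2. Hence |h'| is bounded by a multiple of |h| and h
      vanishes. The radius s1 keeps Zs(w) inside that ball.\<close>
    define h where "h = (\<lambda>z. Zs z0 (w z) - z)"
    have hd: "(h has_field_derivative (G (w z) (Zs z0 (w z)) * (1 / G (w z) z) - 1)) (at z)" if "z \<in> U" for z
      unfolding h_def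
      using DERIV_chain2[OF Zs(2)[OF z0 w_ball[OF that z0]] w_deriv[OF that]]
      by (auto intro!: derivative_eq_intros)
    have "h z = 0" if "z \<in> ball z0 s" for z
    proof (rule complex_gronwall_zero[OF s(1) _ _ _ that, of h "B * (2 * (1 / m) / (R / 2))"])
      show "h holomorphic_on ball z0 s"
        by (rule holomorphic_on_derivI[OF hd]) (use sub in blast)
      show "h z0 = 0" by (simp add: h_def Zs(1)[OF z0])
      fix z assume z: "z \<in> ball z0 s"
      hence zU: "z \<in> U" and zs: "z \<in> cball z0 s0" using sub s by auto
      have wz: "norm (w z) < \<rho>" using U(2)[OF zU] \<rho>(1) by simp
      have Gnz: "G (w z) z \<noteq> 0"
        using \<rho>(6)[OF z0K, of z "w z"] z s wz w_nz[OF zU] \<rho>(3) by (auto simp: G_def)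
      have wd: "deriv w z = 1 / G (w z) z" by (rule DERIV_imp_deriv[OF w_deriv[OF zU]])
      have "deriv h z = deriv w z * (G (w z) (Zs z0 (w z)) - G (w z) z)"
        using Gnz unfolding wd DERIV_imp_deriv[OF hd[OF zU]] by (simp add: field_simps)
      moreover have "norm (G (w z) (Zs z0 (w z)) - G (w z) z) \<le> 2 * (1 / m) / (R / 2) * norm (Zs z0 (w z) - z)"
      proof (rule bounded_holomorphic_lipschitz[where g = "G (w z)" and ?u0.0 = z0])
        have qnz: "q y (w z) \<noteq> 0" if "y \<in> ball z0 (2 * (R / 2))" for y
          using \<rho>(6)[OF z0K, of y "w z"] that wz \<rho>(3) by auto
        have "A k holomorphic_on ball z0 (2 * (R / 2))" if "k \<le> D" for k
          by (rule holomorphic_on_subset[OF hol[OF that]]) (use \<rho>(5)[OF z0K] in simp)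
        thus "G (w z) holomorphic_on ball z0 (2 * (R / 2))"
          using qnz unfolding G_def[abs_def] q_def by (intro holomorphic_intros) auto
        show "norm (G (w z) y) \<le> 1 / m" if y: "y \<in> ball z0 (2 * (R / 2))" for y
        proof -
          have "norm (w z) ^ (D - 2) \<le> 1" using wz \<rho>(4) by (simp add: power_le_one)
          hence "norm (w z) ^ (D - 2) / norm (q y (w z)) \<le> 1 / m"
            using \<rho>(6)[OF z0K _ wz, of y] y \<rho>(3) by (intro frac_le) auto
          thus ?thesis by (simp add: G_def norm_divide norm_power)
        qed
        show "Zs z0 (w z) \<in> cball z0 (R / 2)"
          using s1(2)[OF zs] z s Zs(1)[OF z0] by (simp add: dist_commute)
      qed (use \<rho>(2) z s in auto)
      ultimately show "norm (deriv h z) \<le> B * (2 * (1 / m) / (R / 2)) * norm (h z)"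
        using B[OF zs] order_trans[OF norm_ge_zero B[OF zs]]
        by (simp only: norm_mult h_def mult.assoc) (intro mult_mono, auto)
    qed
    hence "\<forall>z\<in>ball z0 s. Zs z0 (w z) = z" by (simp add: h_def)
    thus ?thesis using s(1) sub by blast
  qed
  obtain Q :: "complex set" where Q: "countable Q" "\<And>X. open X \<Longrightarrow> X \<noteq> {} \<Longrightarrow> \<exists>z\<in>Q. z \<in> X"
    using countable_dense_setE by metis
  have "?S \<subseteq> (\<lambda>z0. Zs z0 0) ` Q"
  proof
    fix p assume "p \<in> ?S"
    then obtain x \<tau> where p: "p = Complex x \<tau>" and \<tau>: "c < \<tau>" "\<tau> < d" "Complex x \<tau> \<notin> \<Omega>"
      "\<And>y. \<tau> < y \<Longrightarrow> y < d \<Longrightarrow> Complex x y \<in> \<Omega>" by blast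
    obtain y1 where y1: "\<tau> < y1" "y1 \<le> d" "\<And>y. \<tau> < y \<Longrightarrow> y < y1 \<Longrightarrow> norm (F (Complex x y)) > 4 / \<rho>"
      using blow_up(1)[OF \<tau>, of "4 / \<rho>"] by blast
    define ray where "ray = Complex x ` {\<tau><..<y1}"
    have inU: "Complex x y \<in> U" if "\<tau> < y" "y < y1" for y
    proof -
      have "norm (F (Complex x y)) > 4 / \<rho>" using y1(3) that by blast
      moreover from this have "F (Complex x y) \<noteq> 0" using \<rho>(1) by (auto simp: field_simps)
      ultimately show ?thesis
        using \<tau>(4)[of y] that y1(2) \<rho>(1) by (simp add: U_def w_def norm_divide field_simps)
    qed
    have "continuous_on {\<tau><..<y1} (\<lambda>y. of_real x + \<i> * of_real y)"
      by (intro continuous_intros)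
    hence "continuous_on {\<tau><..<y1} (Complex x)" by (simp add: Complex_eq)
    hence conn: "connected ray" unfolding ray_def by (intro connected_continuous_image) auto
    \<comment> \<open>The dense set supplies a point z0 in the component of \<open>U\<close> that
      contains the end of the vertical line. Along this component the identity theorem carries
      Zs(w(z)) = z from a neighbourhood of z0 to the line, however far away it is.\<close>
    define C where "C = connected_component_set U (Complex x ((\<tau> + y1) / 2))"
    have mid: "Complex x ((\<tau> + y1) / 2) \<in> ray" using y1(1) by (auto simp: ray_def)
    have rayU: "ray \<subseteq> U" using inU by (auto simp: ray_def)
    have rayC: "ray \<subseteq> C" unfolding C_def by (rule connected_component_maximal[OF mid conn rayU])
    have C: "open C" "connected C" "C \<subseteq> U"
      unfolding C_def by (simp_all only: open_connected_component[OF \<open>open U\<close>] connected_connected_component connected_component_subset)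
    obtain z0 where z0: "z0 \<in> Q" "z0 \<in> C" using Q(2)[OF C(1)] mid rayC by blast
    hence z0U: "z0 \<in> U" using C by blast
    obtain s where s: "s > 0" "\<And>z. z \<in> ball z0 s \<Longrightarrow> Zs z0 (w z) = z" using local_inv[OF z0U] by blast
    have hZ: "Zs z0 holomorphic_on ball (w z0) (\<rho> / 2)"
      by (rule holomorphic_on_derivI[OF Zs(2)[OF z0U]])
    have id: "Zs z0 (w z) = z" if "z \<in> C" for z
    proof (rule analytic_continuation_open[of "ball z0 s \<inter> C" C "\<lambda>z. Zs z0 (w z)" "\<lambda>z. z"])
      have "w ` C \<subseteq> ball (w z0) (\<rho> / 2)" using w_ball[OF _ z0U] C(3) by blast
      thus "(\<lambda>z. Zs z0 (w z)) holomorphic_on C"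
        using holomorphic_on_compose_gen[OF hw[OF C(3)] hZ] by (simp add: o_def)
      show "ball z0 s \<inter> C \<noteq> {}" using s(1) z0(2) centre_in_ball[of z0 s] by blast
    qed (use C s z0 that in auto)
    define y where "y = (\<lambda>n. \<tau> + (y1 - \<tau>) / 2 * inverse (real (Suc n)))"
    have y: "\<tau> < y n" "y n < y1" for n
    proof -
      have "(y1 - \<tau>) / 2 * inverse (real (Suc n)) \<le> (y1 - \<tau>) / 2 * 1"
        using y1(1) by (intro mult_left_mono) (auto simp: field_simps)
      also have "\<dots> < y1 - \<tau>" using y1(1) by simp
      finally show "y n < y1" unfolding y_def by (simp only: less_diff_eq add.commute)
    qed (use y1(1) in \<open>simp add: y_def\<close>)
    have ylim: "y \<longlonglongrightarrow> \<tau>"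
      using tendsto_add[OF tendsto_const[of \<tau>] tendsto_mult_right_zero[OF LIMSEQ_inverse_real_of_nat, of "(y1 - \<tau>) / 2"]]
      by (simp add: y_def)
    have wlim: "(\<lambda>n. w (Complex x (y n))) \<longlonglongrightarrow> 0"
    proof (rule tendstoI)
      fix \<epsilon> :: real assume "\<epsilon> > 0"
      obtain y2 where y2: "\<tau> < y2" "\<And>y. \<tau> < y \<Longrightarrow> y < y2 \<Longrightarrow> norm (F (Complex x y)) > 1 / \<epsilon>"
        using blow_up(1)[OF \<tau>, of "1 / \<epsilon>"] by blast
      have "\<forall>\<^sub>F n in sequentially. y n < y2" using ylim y2(1) by (rule order_tendstoD)
      thus "\<forall>\<^sub>F n in sequentially. dist (w (Complex x (y n))) 0 < \<epsilon>"
      proof eventually_elim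
        case (elim n)
        hence "norm (F (Complex x (y n))) > 1 / \<epsilon>" using y2(2) y(1) by blast
        moreover from this have "norm (F (Complex x (y n))) > 0"
          using \<open>\<epsilon> > 0\<close> by (meson divide_pos_pos less_trans zero_less_one)
        ultimately show ?case using \<open>\<epsilon> > 0\<close> by (simp add: w_def norm_divide field_simps)
      qed
    qed
    have "0 \<in> ball (w z0) (\<rho> / 2)" using U(2)[OF z0U] \<rho>(1) by simp
    hence "isCont (Zs z0) 0" by (rule DERIV_isCont[OF Zs(2)[OF z0U]])
    hence "(\<lambda>n. Zs z0 (w (Complex x (y n)))) \<longlonglongrightarrow> Zs z0 0"
      using wlim by (rule isCont_tendsto_compose)
    moreover have "Zs z0 (w (Complex x (y n))) = Complex x (y n)" for n
      using rayC y[of n] by (intro id) (auto simp: ray_def)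
    moreover have "(\<lambda>n. Complex x (y n)) \<longlonglongrightarrow> p"
      using tendsto_Complex[OF tendsto_const ylim] by (simp add: p)
    ultimately have "(\<lambda>n. Complex x (y n)) \<longlonglongrightarrow> Zs z0 0" "(\<lambda>n. Complex x (y n)) \<longlonglongrightarrow> p"
      by simp_all
    hence "Zs z0 0 = p" by (rule LIMSEQ_unique)
    thus "p \<in> (\<lambda>z0. Zs z0 0) ` Q" using z0(1) by blast
  qed
  moreover have "countable ((\<lambda>z0. Zs z0 0) ` Q)" using Q(1) by simp
  ultimately show ?thesis by (rule countable_subset)
qed

text \<open>Otherwise every vertical line over the interval runs into a singularity. Different lines
  give different singularities, and the interval would be countable.\<close>

lemma extension_exists:
  assumes nz: "D \<le> 1 \<or> (\<forall>z\<in>W. A D z \<noteq> 0)" and c': "c < c'" "c' < e"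
  obtains \<alpha> \<beta> t g where "ext \<alpha> \<beta> t g" "t < c'"
proof -
  have "\<exists>x. a < x \<and> x < b \<and> Complex x c' \<in> \<Omega>"
  proof (rule ccontr)
    assume none: "\<not> ?thesis"
    have "\<forall>x\<in>{a<..<b}. \<exists>\<tau>. c < \<tau> \<and> \<tau> < d \<and> Complex x \<tau> \<notin> \<Omega> \<and> (\<forall>y. \<tau> < y \<and> y < d \<longrightarrow> Complex x y \<in> \<Omega>)"
    proof
      fix x assume "x \<in> {a<..<b}"
      hence x: "a < x" "x < b" by auto
      hence "Complex x c' \<notin> \<Omega>" using none by blast
      from boundary_point[OF x c' this] obtain \<tau> where
        "c' \<le> \<tau>" "\<tau> \<le> e" "Complex x \<tau> \<notin> \<Omega>" "\<And>y. \<tau> < y \<Longrightarrow> y < d \<Longrightarrow> Complex x y \<in> \<Omega>"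
        by metis
      thus "\<exists>\<tau>. c < \<tau> \<and> \<tau> < d \<and> Complex x \<tau> \<notin> \<Omega> \<and> (\<forall>y. \<tau> < y \<and> y < d \<longrightarrow> Complex x y \<in> \<Omega>)"
        using c' ed by (intro exI[of _ \<tau>]) auto
    qed
    then obtain \<tau> where \<tau>: "\<And>x. x \<in> {a<..<b} \<Longrightarrow> c < \<tau> x \<and> \<tau> x < d \<and> Complex x (\<tau> x) \<notin> \<Omega> \<and>
        (\<forall>y. \<tau> x < y \<and> y < d \<longrightarrow> Complex x y \<in> \<Omega>)" by metis
    define S where "S = {Complex x \<tau> | x \<tau>. c < \<tau> \<and> \<tau> < d \<and> Complex x \<tau> \<notin> \<Omega> \<and>
           (\<forall>y. \<tau> < y \<and> y < d \<longrightarrow> Complex x y \<in> \<Omega>)}"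
    have "countable S"
    proof (cases "D \<le> 1")
      case True
      have "D \<ge> 2" using \<tau>[of "(a + b) / 2"] ab blow_up(2)[of "\<tau> ((a + b) / 2)" "(a + b) / 2"] by auto
      thus ?thesis using True by simp
    next
      case False
      thus ?thesis unfolding S_def using nz by (intro singularities_countable) auto
    qed
    moreover have "{a<..<b} \<subseteq> Re ` S"
    proof
      fix x assume "x \<in> {a<..<b}"
      hence "Complex x (\<tau> x) \<in> S" using \<tau> unfolding S_def by blast
      thus "x \<in> Re ` S" by (metis complex.sel(1) imageI)
    qed
    ultimately have "countable {a<..<b}" using countable_subset countable_image by metis
    thus False using uncountable_open_interval[of a b] ab by simp
  qed
  then obtain x where "Complex x c' \<in> \<Omega>" by blast
  then obtain \<alpha> \<beta> t g where g: "ext \<alpha> \<beta> t g" and x: "Complex x c' \<in> rect \<alpha> \<beta> t d"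
    unfolding \<Omega>_def by blast
  show ?thesis by (rule that[OF g]) (use x in \<open>simp add: mem_rect\<close>)
qed

end

text \<open>Induction on the degree bound D. A leading coefficient that vanishes identically is
  dropped; any other is free of zeros on a thinner strip, where the inverse function argument
  applies. The strict inequalities c < c' and d' < d leave room for a closed rectangle inside the
  domain of the coefficients.\<close>

lemma ode_extend_step:
  fixes A :: "nat \<Rightarrow> complex \<Rightarrow> complex"
  assumes "a < b" "c < c'" "c' < e" "e < d'" "d' < d"
    and hol: "\<And>k. k \<le> D \<Longrightarrow> A k holomorphic_on rect a b c d"
    and ode: "\<And>z. z \<in> rect a b e d \<Longrightarrow> (f has_field_derivative (\<Sum>k\<le>D. A k z * f z ^ k)) (at z)"
  shows "\<exists>a' b' g. a \<le> a' \<and> a' < b' \<and> b' \<le> b \<and> g holomorphic_on rect a' b' c' d' \<and>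
           (\<forall>z\<in>rect a' b' e d'. g z = f z)"
  using hol ode
proof (induction D)
  case (Suc D)
  note hol = Suc.prems(1) and ode = Suc.prems(2)
  show ?case
  proof (cases "\<forall>z\<in>rect a b c d. A (Suc D) z = 0")
    case True
    have "(f has_field_derivative (\<Sum>k\<le>D. A k z * f z ^ k)) (at z)" if "z \<in> rect a b e d" for z
    proof -
      have "z \<in> rect a b c d" using that assms by (auto simp: mem_rect)
      thus ?thesis using ode[OF that] True by simp
    qed
    thus ?thesis using hol by (intro Suc.IH) auto
  next
    case False
    \<comment> \<open>The closed rectangle has to start strictly above c, and its bottom has to be
      strictly below c', the height to be reached.\<close>
    define c0 where "c0 = (c + c') / 2"
    have c0: "c < c0" "c0 < c'" using \<open>c < c'\<close> by (auto simp: c0_def)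
    obtain a0 b0 where ab0: "a < a0" "a0 < b0" "b0 < b"
      "\<And>z. a0 \<le> Re z \<Longrightarrow> Re z \<le> b0 \<Longrightarrow> c0 \<le> Im z \<Longrightarrow> Im z \<le> d' \<Longrightarrow> A (Suc D) z \<noteq> 0"
      using nonzero_strip[OF hol[of "Suc D"], of c0 d'] False assms c0 by auto
    define W where "W = rect a b c d \<inter> A (Suc D) -` (- {0})"
    interpret vertical_ode A "Suc D" a0 b0 c0 d' e W f
    proof
      show "open W"
        unfolding W_def by (intro continuous_open_preimage holomorphic_on_imp_continuous_on[OF hol]) auto
      show "A k holomorphic_on W" if "k \<le> Suc D" for k
        by (rule holomorphic_on_subset[OF hol[OF that]]) (auto simp: W_def)
      show "{z. a0 \<le> Re z \<and> Re z \<le> b0 \<and> c0 \<le> Im z \<and> Im z \<le> d'} \<subseteq> W"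
        using ab0 c0 assms by (auto simp: W_def mem_rect)
      show "(f has_field_derivative (\<Sum>k\<le>Suc D. A k z * f z ^ k)) (at z)" if "z \<in> rect a0 b0 e d'" for z
        by (rule ode) (use that ab0 assms in \<open>auto simp: mem_rect\<close>)
    qed (use assms ab0 c0 in auto)
    obtain \<alpha> \<beta> t g where g: "ext \<alpha> \<beta> t g" "t < c'"
      by (rule extension_exists[OF _ c0(2) \<open>c' < e\<close>]) (auto simp: W_def)
    have "g holomorphic_on rect \<alpha> \<beta> c' d'"
      using g by (auto simp: ext_def mem_rect intro: holomorphic_on_subset)
    thus ?thesis using g(1) ab0 unfolding ext_def by (intro exI[of _ \<alpha>] exI[of _ \<beta>] exI[of _ g]) auto
  qed
next
  case 0
  note hol = 0(1) and ode = 0(2)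
  define c0 where "c0 = (c + c') / 2"
  define a0 where "a0 = a + (b - a) / 3"
  define b0 where "b0 = a + (b - a) / 3 * 2"
  have c0: "c < c0" "c0 < c'" "a < a0" "a0 < b0" "b0 < b"
    using assms by (auto simp: c0_def a0_def b0_def field_simps)
  interpret vertical_ode A 0 a0 b0 c0 d' e "rect a b c d" f
  proof
    show "(f has_field_derivative (\<Sum>k\<le>0. A k z * f z ^ k)) (at z)" if "z \<in> rect a0 b0 e d'" for z
      by (rule ode) (use that c0 assms in \<open>auto simp: mem_rect\<close>)
  qed (use assms c0 hol in \<open>auto simp: mem_rect\<close>)
  obtain \<alpha> \<beta> t g where g: "ext \<alpha> \<beta> t g" "t < c'"
    by (rule extension_exists[OF _ c0(2) \<open>c' < e\<close>]) auto
  have "g holomorphic_on rect \<alpha> \<beta> c' d'"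
    using g by (auto simp: ext_def mem_rect intro: holomorphic_on_subset)
  thus ?case using g(1) c0 unfolding ext_def by (intro exI[of _ \<alpha>] exI[of _ \<beta>] exI[of _ g]) auto
qed

section \<open>Continuation of chains\<close>

definition cpoly_eval :: "'v rpoly \<Rightarrow> ('v \<Rightarrow> complex) \<Rightarrow> complex" where
  "cpoly_eval p s =
     (\<Sum>m \<in> Poly_Mapping.keys p. of_real (Poly_Mapping.lookup p m) *
        (\<Prod>v \<in> Poly_Mapping.keys m. s v ^ Poly_Mapping.lookup m v))"

lemma cpoly_eval_of_real: "cpoly_eval p (\<lambda>v. of_real (s v)) = of_real (rpoly_eval p s)"
  by (simp add: cpoly_eval_def rpoly_eval_def)

lemma cpoly_eval_cong:
  assumes "\<And>v. v \<in> rpoly_vars p \<Longrightarrow> s v = s' v"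
  shows "cpoly_eval p s = cpoly_eval p s'"
  unfolding cpoly_eval_def
  by (intro sum.cong prod.cong arg_cong2[where f = "(*)"] arg_cong2[where f = "(^)"] refl assms)
     (auto simp: rpoly_vars_def)

lemma holomorphic_cpoly_eval:
  assumes "\<And>v. v \<in> rpoly_vars p \<Longrightarrow> (\<lambda>z. s z v) holomorphic_on S"
  shows "(\<lambda>z. cpoly_eval p (s z)) holomorphic_on S"
  unfolding cpoly_eval_def
  by (intro holomorphic_intros assms) (auto simp: rpoly_vars_def)

lemma continuous_on_rpoly_eval:
  assumes "\<And>v. v \<in> rpoly_vars p \<Longrightarrow> continuous_on S (\<lambda>z. s z v)"
  shows "continuous_on S (\<lambda>z. rpoly_eval p (s z))"
  unfolding rpoly_eval_def
  by (intro continuous_intros assms) (auto simp: rpoly_vars_def)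

text \<open>The coefficient of the k-th power of v, with p read as a polynomial in v over the other
  variables.\<close>

definition cpoly_coeff :: "'v rpoly \<Rightarrow> 'v \<Rightarrow> nat \<Rightarrow> ('v \<Rightarrow> complex) \<Rightarrow> complex" where
  "cpoly_coeff p v k s =
     (\<Sum>m | m \<in> Poly_Mapping.keys p \<and> Poly_Mapping.lookup m v = k. of_real (Poly_Mapping.lookup p m) *
        (\<Prod>w \<in> Poly_Mapping.keys m - {v}. s w ^ Poly_Mapping.lookup m w))"

lemma cpoly_coeff_cong:
  assumes "\<And>w. w \<in> rpoly_vars p - {v} \<Longrightarrow> s w = s' w"
  shows "cpoly_coeff p v k s = cpoly_coeff p v k s'"
  unfolding cpoly_coeff_def
  by (intro sum.cong prod.cong arg_cong2[where f = "(*)"] arg_cong2[where f = "(^)"] refl assms)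
     (auto simp: rpoly_vars_def)

lemma holomorphic_cpoly_coeff:
  assumes "\<And>w. w \<in> rpoly_vars p - {v} \<Longrightarrow> (\<lambda>z. s z w) holomorphic_on S"
  shows "(\<lambda>z. cpoly_coeff p v k (s z)) holomorphic_on S"
  unfolding cpoly_coeff_def
  by (intro holomorphic_intros assms) (auto simp: rpoly_vars_def)

lemma cpoly_eval_expand:
  assumes "\<And>m. m \<in> Poly_Mapping.keys p \<Longrightarrow> Poly_Mapping.lookup m v \<le> D"
  shows "cpoly_eval p s = (\<Sum>k\<le>D. cpoly_coeff p v k s * s v ^ k)"
proof -
  have split: "(\<Prod>w \<in> Poly_Mapping.keys m. s w ^ Poly_Mapping.lookup m w) =
      (\<Prod>w \<in> Poly_Mapping.keys m - {v}. s w ^ Poly_Mapping.lookup m w) * s v ^ Poly_Mapping.lookup m v" for m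
  proof (cases "v \<in> Poly_Mapping.keys m")
    case True
    thus ?thesis by (subst prod.remove[of _ v]) (auto simp: mult.commute)
  next
    case False
    thus ?thesis by (simp add: in_keys_iff)
  qed
  have "cpoly_eval p s = (\<Sum>k\<le>D. \<Sum>m | m \<in> Poly_Mapping.keys p \<and> Poly_Mapping.lookup m v = k.
      of_real (Poly_Mapping.lookup p m) * (\<Prod>w \<in> Poly_Mapping.keys m. s w ^ Poly_Mapping.lookup m w))"
    unfolding cpoly_eval_def by (rule sum.group[symmetric]) (use assms in auto)
  also have "\<dots> = (\<Sum>k\<le>D. cpoly_coeff p v k s * s v ^ k)"
    unfolding cpoly_coeff_def sum_distrib_right
    by (intro sum.cong refl) (auto simp: split)
  finally show ?thesis .
qed

text \<open>Triangularity reduces the system to scalar equations: once the earlier functions are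
  continued, the equation for the last one is polynomial in it with holomorphic coefficients. The
  entire functions X stand for the coordinates, one of which is constant on a horizontal
  line.\<close>

lemma chain_extend:
  fixes p :: "nat \<Rightarrow> ('b + nat) rpoly" and X :: "'b \<Rightarrow> complex \<Rightarrow> complex"
    and \<phi> :: "nat \<Rightarrow> complex \<Rightarrow> complex"
  assumes ab: "a < b" and X: "\<And>x. X x holomorphic_on UNIV"
    and vars: "\<And>i. i < l \<Longrightarrow> rpoly_vars (p i) \<subseteq> range Inl \<union> Inr ` {..i}"
    and ode: "\<And>i z. i < l \<Longrightarrow> z \<in> rect a b e d \<Longrightarrow>
        (\<phi> i has_field_derivative cpoly_eval (p i) (case_sum (\<lambda>x. X x z) (\<lambda>k. \<phi> k z))) (at z)"
    and "c < e" "e < d'" "d' < d"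
  shows "\<exists>a' b' g. a \<le> a' \<and> a' < b' \<and> b' \<le> b \<and>
           (\<forall>i<l. g i holomorphic_on rect a' b' c d' \<and> (\<forall>z\<in>rect a' b' e d'. g i z = \<phi> i z))"
  using vars ode \<open>c < e\<close> \<open>e < d'\<close> \<open>d' < d\<close>
proof (induction l arbitrary: c d')
  case 0
  thus ?case using ab by auto
next
  case (Suc l)
  note vars = Suc.prems(1) and ode = Suc.prems(2)
  \<comment> \<open>A scalar step loses some room at the bottom and at the top, so the induction
    hypothesis is used for the larger rectangle from c - 1 to d1.\<close>
  define d1 where "d1 = (d' + d) / 2"
  have d1: "d' < d1" "d1 < d" "e < d1" using Suc.prems by (auto simp: d1_def)
  obtain a1 b1 g where ab1: "a \<le> a1" "a1 < b1" "b1 \<le> b"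
    and g: "\<And>i. i < l \<Longrightarrow> g i holomorphic_on rect a1 b1 (c - 1) d1"
      "\<And>i z. i < l \<Longrightarrow> z \<in> rect a1 b1 e d1 \<Longrightarrow> g i z = \<phi> i z"
  proof -
    have "\<exists>a' b' g. a \<le> a' \<and> a' < b' \<and> b' \<le> b \<and> (\<forall>i<l. g i holomorphic_on rect a' b' (c - 1) d1 \<and>
            (\<forall>z\<in>rect a' b' e d1. g i z = \<phi> i z))"
      by (rule Suc.IH) (use vars ode d1 \<open>c < e\<close> in auto)
    thus ?thesis using that by blast
  qed
  define s where "s = (\<lambda>z. case_sum (\<lambda>x. X x z) (\<lambda>k. g k z))"
  define s\<phi> where "s\<phi> = (\<lambda>z. case_sum (\<lambda>x. X x z) (\<lambda>k. \<phi> k z))"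
  define A where "A = (\<lambda>k z. cpoly_coeff (p l) (Inr l) k (s z))"
  define D where "D = Max (insert 0 ((\<lambda>m. Poly_Mapping.lookup m (Inr l)) ` Poly_Mapping.keys (p l)))"
  have D: "Poly_Mapping.lookup m (Inr l) \<le> D" if "m \<in> Poly_Mapping.keys (p l)" for m
    unfolding D_def using that by (intro Max_ge) auto
  have v: "w \<in> range Inl \<union> Inr ` {..<l}" if "w \<in> rpoly_vars (p l) - {Inr l}" for w
  proof -
    have "w \<in> range Inl \<union> Inr ` {..l}" using vars[of l] that by blast
    thus ?thesis using that by (auto simp: le_less)
  qed
  have "\<exists>a' b' h. a1 \<le> a' \<and> a' < b' \<and> b' \<le> b1 \<and> h holomorphic_on rect a' b' c d' \<and>
           (\<forall>z\<in>rect a' b' e d'. h z = \<phi> l z)"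
  proof (rule ode_extend_step[of a1 b1 "c - 1" c e d' d1 D A])
    have hs: "(\<lambda>z. s z w) holomorphic_on rect a1 b1 (c - 1) d1" if "w \<in> rpoly_vars (p l) - {Inr l}" for w
      using v[OF that] by (auto simp: s_def intro: g(1) holomorphic_on_subset[OF X subset_UNIV])
    show "A k holomorphic_on rect a1 b1 (c - 1) d1" for k
      unfolding A_def using hs by (rule holomorphic_cpoly_coeff)
    fix z assume z: "z \<in> rect a1 b1 e d1"
    have "(\<phi> l has_field_derivative cpoly_eval (p l) (s\<phi> z)) (at z)"
      unfolding s\<phi>_def by (rule ode) (use z ab1 d1 in \<open>auto simp: mem_rect\<close>)
    also have "cpoly_eval (p l) (s\<phi> z) = (\<Sum>k\<le>D. cpoly_coeff (p l) (Inr l) k (s\<phi> z) * s\<phi> z (Inr l) ^ k)"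
      by (rule cpoly_eval_expand[OF D])
    also have "\<dots> = (\<Sum>k\<le>D. A k z * \<phi> l z ^ k)"
    proof (intro sum.cong refl arg_cong2[where f = "(*)"])
      show "cpoly_coeff (p l) (Inr l) k (s\<phi> z) = A k z" for k
        unfolding A_def by (rule cpoly_coeff_cong) (use v g(2) z in \<open>force simp: s_def s\<phi>_def\<close>)
    qed (simp add: s\<phi>_def)
    finally show "(\<phi> l has_field_derivative (\<Sum>k\<le>D. A k z * \<phi> l z ^ k)) (at z)" .
  qed (use ab1 d1 Suc.prems in auto)
  then obtain a2 b2 h where ab2: "a1 \<le> a2" "a2 < b2" "b2 \<le> b1"
    and h: "h holomorphic_on rect a2 b2 c d'" "\<And>z. z \<in> rect a2 b2 e d' \<Longrightarrow> h z = \<phi> l z" by blast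
  have "(g(l := h)) i holomorphic_on rect a2 b2 c d' \<and> (\<forall>z\<in>rect a2 b2 e d'. (g(l := h)) i z = \<phi> i z)"
    if "i < Suc l" for i
  proof (cases "i = l")
    case False
    hence "i < l" using that by simp
    moreover have "rect a2 b2 c d' \<subseteq> rect a1 b1 (c - 1) d1" "rect a2 b2 e d' \<subseteq> rect a1 b1 e d1"
      using ab2 d1 by (auto simp: mem_rect)
    ultimately show ?thesis using g False by (auto intro: holomorphic_on_subset)
  qed (use h in auto)
  thus ?case using ab1 ab2 by (intro exI[of _ a2] exI[of _ b2] exI[of _ "g(l := h)"]) auto
qed

section \<open>Eisenstein series\<close>

text \<open>The absolute value with 0 replaced by 1. Products of its inverse powers majorize the
  lattice terms even on the axes, and their double sum factors into one-variable sums.\<close>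

definition ebar :: "int \<Rightarrow> real" where
  "ebar m = max 1 \<bar>real_of_int m\<bar>"

lemma ebar_ge_1: "ebar m \<ge> 1"
  by (simp add: ebar_def)

lemma ebar_0 [simp]: "ebar 0 = 1"
  by (simp add: ebar_def)

lemma ebar_nonzero: "m \<noteq> 0 \<Longrightarrow> ebar m = \<bar>real_of_int m\<bar>"
  unfolding ebar_def by linarith

text \<open>The inequality of arithmetic and geometric means off the axes; on an axis, |k| <= k^2
  for integers.\<close>

lemma ebar_mult_le: "(m, n) \<noteq> (0, 0) \<Longrightarrow> ebar m * ebar n \<le> (real_of_int m)\<^sup>2 + (real_of_int n)\<^sup>2"
proof -
  assume mn: "(m, n) \<noteq> (0, 0)"
  have sq: "\<bar>real_of_int k\<bar> \<le> (real_of_int k)\<^sup>2" if "k \<noteq> 0" for k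
  proof -
    have "1 \<le> \<bar>real_of_int k\<bar>" using that by linarith
    hence "\<bar>real_of_int k\<bar> * 1 \<le> \<bar>real_of_int k\<bar> * \<bar>real_of_int k\<bar>" by (intro mult_left_mono) auto
    thus ?thesis by (simp add: power2_eq_square)
  qed
  show ?thesis
  proof (cases "m = 0 \<or> n = 0")
    case True
    thus ?thesis using mn sq[of m] sq[of n] by (auto simp: ebar_nonzero)
  next
    case False
    have "2 * (\<bar>real_of_int m\<bar> * \<bar>real_of_int n\<bar>) \<le> (real_of_int m)\<^sup>2 + (real_of_int n)\<^sup>2"
      using sum_squares_bound[of "\<bar>real_of_int m\<bar>" "\<bar>real_of_int n\<bar>"] by simp
    moreover have "0 \<le> \<bar>real_of_int m\<bar> * \<bar>real_of_int n\<bar>" by (intro mult_nonneg_nonneg abs_ge_zero)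
    ultimately have "\<bar>real_of_int m\<bar> * \<bar>real_of_int n\<bar> \<le> (real_of_int m)\<^sup>2 + (real_of_int n)\<^sup>2"
      by linarith
    thus ?thesis using False by (simp add: ebar_nonzero)
  qed
qed

text \<open>The sum is 1 + 2 zeta(j). Its explicit bound feeds the estimates at rho and 10
  i.\<close>

lemma has_sum_ebar:
  assumes bd: "\<And>N. (\<Sum>n<N. 1 / real (Suc n) ^ j) \<le> c"
  obtains S where "((\<lambda>m. 1 / ebar m ^ j) has_sum S) UNIV" "0 \<le> S" "S \<le> 1 + 2 * c"
proof -
  define f where "f = (\<lambda>n. 1 / real (Suc n) ^ j)"
  have sf: "summable f" unfolding f_def by (rule summableI_nonneg_bounded[OF _ bd]) simp
  have le: "suminf f \<le> c" by (rule suminf_le_const[OF sf]) (use bd in \<open>simp add: f_def\<close>)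
  have hs: "(f has_sum suminf f) UNIV"
    using sf by (intro norm_summable_imp_has_sum summable_sums) (auto simp: f_def)
  have 1: "((\<lambda>m. 1 / ebar m ^ j) has_sum suminf f) (range (\<lambda>n. int (Suc n)))"
    by (subst has_sum_reindex) (use hs in \<open>auto simp: o_def f_def ebar_def inj_on_def add_ac\<close>)
  have 2: "((\<lambda>m. 1 / ebar m ^ j) has_sum suminf f) (range (\<lambda>n. - int (Suc n)))"
    by (subst has_sum_reindex) (use hs in \<open>auto simp: o_def f_def ebar_def inj_on_def add_ac\<close>)
  have 0: "((\<lambda>m. 1 / ebar m ^ j) has_sum 1) {0}"
    using has_sum_finite[of "{0}" "\<lambda>m. 1 / ebar m ^ j"] by simp
  have "((\<lambda>m. 1 / ebar m ^ j) has_sum (1 + (suminf f + suminf f)))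
          ({0} \<union> (range (\<lambda>n. int (Suc n)) \<union> range (\<lambda>n. - int (Suc n))))"
    by (intro has_sum_Un_disjoint 0 1 2) auto
  also have "{0} \<union> (range (\<lambda>n. int (Suc n)) \<union> range (\<lambda>n. - int (Suc n))) = UNIV"
  proof -
    have "m \<in> {0} \<union> (range (\<lambda>n. int (Suc n)) \<union> range (\<lambda>n. - int (Suc n)))" for m :: int
    proof (cases m rule: int_cases3)
      case (pos n)
      thus ?thesis by (auto intro!: image_eqI[of _ _ "n - 1"])
    next
      case (neg n)
      thus ?thesis by (auto intro!: image_eqI[of _ _ "n - 1"])
    qed auto
    thus ?thesis by blast
  qed
  finally have S: "((\<lambda>m. 1 / ebar m ^ j) has_sum (1 + (suminf f + suminf f))) UNIV" .
  show ?thesis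
  proof (rule that[OF S])
    show "1 + (suminf f + suminf f) \<le> 1 + 2 * c" using le by simp
    show "0 \<le> 1 + (suminf f + suminf f)" using suminf_nonneg[OF sf] by (auto simp: f_def intro!: add_nonneg_nonneg)
  qed
qed

text \<open>From n = 3 on, 1 / n^2 <= 1 / (n - 1) - 1 / n telescopes, which gives 1 + 1/4 + 1/2.
  Telescoping from n = 2 gives only 2, too weak for the estimate at 10 i.\<close>

lemma partial_sum_inverse_squares: "(\<Sum>n<N. 1 / real (Suc n) ^ 2) \<le> 7 / 4"
proof -
  have *: "(\<Sum>n<Suc (Suc N). 1 / real (Suc n) ^ 2) \<le> 7 / 4 - 1 / real (Suc (Suc N))" for N
  proof (induction N)
    case 0
    show ?case by (simp add: numeral_2_eq_2)
  next
    case (Suc N)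
    have "1 / real (Suc (Suc (Suc N))) ^ 2 \<le> 1 / real (Suc (Suc N)) - 1 / real (Suc (Suc (Suc N)))"
      by (simp add: divide_simps power2_eq_square)
    thus ?case using Suc.IH by (simp only: sum.lessThan_Suc[of _ "Suc (Suc N)"])
  qed
  have "(\<Sum>n<N. 1 / real (Suc n) ^ 2) \<le> (\<Sum>n<Suc (Suc N). 1 / real (Suc n) ^ 2)"
    by (intro sum_mono2) auto
  also have "\<dots> \<le> 7 / 4 - 1 / real (Suc (Suc N))" by (rule *)
  also have "\<dots> \<le> 7 / 4" by simp
  finally show ?thesis .
qed

text \<open>From n = 2 on, n^3 is replaced by (n - 1) n (n + 1), whose reciprocal telescopes; the
  bound is 1 + 1/4.\<close>

lemma partial_sum_inverse_cubes: "(\<Sum>n<N. 1 / real (Suc n) ^ 3) \<le> 5 / 4"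
proof -
  have *: "(\<Sum>n<Suc N. 1 / real (Suc n) ^ 3) \<le> 5 / 4 - 1 / (2 * real (Suc N) * real (Suc (Suc N)))" for N
  proof (induction N)
    case 0
    show ?case by simp
  next
    case (Suc N)
    define x where "x = real (Suc (Suc N))"
    have x: "x > 1" by (simp add: x_def)
    have "1 / x ^ 3 \<le> 1 / (x * (x - 1) * (x + 1))"
      using x less_1_mult[OF x x] by (intro divide_left_mono) (auto simp: power3_eq_cube algebra_simps intro!: mult_pos_pos)
    also have "\<dots> = 1 / (2 * (x - 1) * x) - 1 / (2 * x * (x + 1))"
      using x by (simp add: divide_simps)
    finally have "1 / real (Suc (Suc N)) ^ 3 \<le> 1 / (2 * real (Suc N) * real (Suc (Suc N))) -
       1 / (2 * real (Suc (Suc N)) * real (Suc (Suc (Suc N))))"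
      by (simp add: x_def add_ac)
    thus ?case using Suc.IH by (simp only: sum.lessThan_Suc[of _ "Suc N"])
  qed
  have "(\<Sum>n<N. 1 / real (Suc n) ^ 3) \<le> (\<Sum>n<Suc N. 1 / real (Suc n) ^ 3)"
    by (intro sum_mono2) auto
  also have "\<dots> \<le> 5 / 4 - 1 / (2 * real (Suc N) * real (Suc (Suc N)))" by (rule *)
  also have "\<dots> \<le> 5 / 4" by simp
  finally show ?thesis .
qed

lemma has_sum_ebar_2: obtains S where "((\<lambda>m. 1 / ebar m ^ 2) has_sum S) UNIV" "0 \<le> S" "S \<le> 9 / 2"
  by (rule has_sum_ebar[OF partial_sum_inverse_squares]) (use that in simp)

lemma has_sum_ebar_3: obtains S where "((\<lambda>m. 1 / ebar m ^ 3) has_sum S) UNIV" "0 \<le> S" "S \<le> 7 / 2"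
  by (rule has_sum_ebar[OF partial_sum_inverse_cubes]) (use that in simp)

lemma has_sum_product_nonneg:
  fixes g h :: "_ \<Rightarrow> real"
  assumes g: "(g has_sum A) UNIV" and h: "(h has_sum B) UNIV" and "\<And>m. g m \<ge> 0" "\<And>n. h n \<ge> 0"
  shows "((\<lambda>(m, n). g m * h n) has_sum (A * B)) UNIV"
proof -
  have "((\<lambda>(m, n). g m * h n) has_sum (A * B)) (UNIV \<times> UNIV)"
  proof (rule has_sum_SigmaI)
    show 1: "((\<lambda>n. (\<lambda>(m, n). g m * h n) (m, n)) has_sum (g m * B)) UNIV" for m
      using has_sum_cmult_right[OF h] by simp
    show 2: "((\<lambda>m. g m * B) has_sum (A * B)) UNIV"
      by (rule has_sum_cmult_left[OF g])
    show "(\<lambda>(m, n). g m * h n) summable_on UNIV \<times> UNIV"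
      by (rule summable_on_SigmaI[where g = "\<lambda>m. g m * B"])
         (use 1 2 assms(3,4) in \<open>auto simp: summable_on_def\<close>)
  qed
  thus ?thesis by simp
qed

text \<open>Write |m z + n|^2 = (m x + n)^2 + m^2 y^2. A fraction \<theta> of the first square
  controls n^2, by n^2 / 2 <= (m x + n)^2 + m^2 x^2. The error \<theta> m^2 X^2 is absorbed by half
  of m^2 \<eta>^2, and the other half controls m^2.\<close>

lemma lattice_norm_ge:
  assumes "\<eta> > 0"
  obtains \<delta> :: real where "\<delta> > 0" "\<And>z m n. Im z \<ge> \<eta> \<Longrightarrow> \<bar>Re z\<bar> \<le> X \<Longrightarrow>
    norm (of_int m * z + of_int n) ^ 2 \<ge> \<delta> * ((real_of_int m)\<^sup>2 + (real_of_int n)\<^sup>2)"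
proof -
  define \<theta> where "\<theta> = min 1 (\<eta>\<^sup>2 / (2 * X\<^sup>2 + 1))"
  define \<delta> where "\<delta> = min (\<theta> / 2) (\<eta>\<^sup>2 / 2)"
  have X1: "2 * X\<^sup>2 + 1 > 0" by (intro add_nonneg_pos) auto
  have \<theta>: "\<theta> > 0" "\<theta> \<le> 1" using assms X1 by (auto simp: \<theta>_def)
  have \<theta>': "\<theta> * (2 * X\<^sup>2 + 1) \<le> \<eta>\<^sup>2"
    using X1 by (subst pos_le_divide_eq[symmetric]) (auto simp: \<theta>_def)
  have \<delta>: "\<delta> > 0" "\<delta> \<le> \<theta> / 2" "\<delta> \<le> \<eta>\<^sup>2 / 2" using \<theta> assms by (auto simp: \<delta>_def)
  show ?thesis
  proof (rule that[OF \<delta>(1)])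
    fix z :: complex and m n :: int assume z: "Im z \<ge> \<eta>" "\<bar>Re z\<bar> \<le> X"
    define M N x y where "M = real_of_int m" "N = real_of_int n" "x = Re z" "y = Im z"
    have "norm (of_int m * z + of_int n) ^ 2 = (M * x + N)\<^sup>2 + M\<^sup>2 * y\<^sup>2"
      by (simp add: cmod_power2 M_N_x_y_def power_mult_distrib)
    moreover have "M\<^sup>2 * \<eta>\<^sup>2 \<le> M\<^sup>2 * y\<^sup>2"
      using z assms by (intro mult_left_mono power_mono) (auto simp: M_N_x_y_def)
    moreover have "\<theta> * (N\<^sup>2 / 2 - M\<^sup>2 * X\<^sup>2) \<le> (M * x + N)\<^sup>2"
    proof -
      have "N\<^sup>2 / 2 \<le> (M * x + N)\<^sup>2 + M\<^sup>2 * x\<^sup>2"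
        using sum_squares_ge_zero[of "2 * (M * x) + N" 0] by (simp add: power2_eq_square algebra_simps)
      moreover have "x\<^sup>2 \<le> X\<^sup>2" using z by (metis M_N_x_y_def(3) abs_le_square_iff abs_of_nonneg abs_ge_zero order_trans)
      hence "M\<^sup>2 * x\<^sup>2 \<le> M\<^sup>2 * X\<^sup>2" by (intro mult_left_mono) auto
      ultimately have "N\<^sup>2 / 2 - M\<^sup>2 * X\<^sup>2 \<le> (M * x + N)\<^sup>2" by linarith
      hence "\<theta> * (N\<^sup>2 / 2 - M\<^sup>2 * X\<^sup>2) \<le> \<theta> * (M * x + N)\<^sup>2"
        using \<theta> by (intro mult_left_mono) auto
      also have "\<dots> \<le> 1 * (M * x + N)\<^sup>2" using \<theta> by (intro mult_right_mono) auto
      finally show ?thesis by simp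
    qed
    moreover have "M\<^sup>2 * (\<theta> * X\<^sup>2) \<le> M\<^sup>2 * (\<eta>\<^sup>2 / 2)"
      using \<theta>' \<theta> by (intro mult_left_mono) (auto simp: algebra_simps)
    moreover have "\<delta> * M\<^sup>2 \<le> \<eta>\<^sup>2 / 2 * M\<^sup>2" "\<delta> * N\<^sup>2 \<le> \<theta> / 2 * N\<^sup>2"
      using \<delta> by (intro mult_right_mono; simp)+
    ultimately show "norm (of_int m * z + of_int n) ^ 2 \<ge> \<delta> * ((real_of_int m)\<^sup>2 + (real_of_int n)\<^sup>2)"
      unfolding M_N_x_y_def(1,2)[symmetric] by (simp add: algebra_simps)
  qed
qed

lemma norm_term_le:
  fixes w :: complex
  assumes "norm w ^ 2 \<ge> \<delta> * (ebar m * ebar n)" "\<delta> > 0"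
  shows "norm (1 / w ^ (2 * j)) \<le> 1 / \<delta> ^ j * (1 / ebar m ^ j * (1 / ebar n ^ j))"
proof -
  have e: "ebar m > 0" "ebar n > 0" using ebar_ge_1[of m] ebar_ge_1[of n] by linarith+
  have pos: "\<delta> * (ebar m * ebar n) > 0" using e assms(2) by simp
  have "(\<delta> * (ebar m * ebar n)) ^ j \<le> (norm w ^ 2) ^ j"
    using assms(1) pos by (intro power_mono) auto
  hence "1 / (norm w ^ 2) ^ j \<le> 1 / (\<delta> * (ebar m * ebar n)) ^ j"
    using zero_less_power[OF pos, of j] by (intro frac_le) simp_all
  thus ?thesis by (simp add: norm_divide norm_power power_mult power_mult_distrib)
qed

lemma lattice_nonzero:
  assumes "Im z > 0" "(m, n) \<noteq> (0, 0)"
  shows "of_int m * z + of_int n \<noteq> 0"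
proof
  assume eq: "of_int m * z + of_int n = 0"
  from arg_cong[OF eq, of Im] have "m = 0" using assms(1) by simp
  with eq assms(2) show False by simp
qed

text \<open>A majorant that does not depend on z, for the Weierstrass test. The even exponent 2 j
  allows the lower bound for the squared norm to be raised to the power j.\<close>

lemma lattice_sum_bound:
  assumes "\<eta> > 0" and S: "((\<lambda>m. 1 / ebar m ^ j) has_sum S) UNIV"
  obtains M where "M summable_on UNIV" "\<And>z m n. Im z \<ge> \<eta> \<Longrightarrow> \<bar>Re z\<bar> \<le> X \<Longrightarrow> (m, n) \<noteq> (0, 0) \<Longrightarrow>
     norm (1 / (of_int m * z + of_int n) ^ (2 * j)) \<le> M (m, n)"
proof -
  obtain \<delta> where \<delta>: "\<delta> > 0" "\<And>z m n. Im z \<ge> \<eta> \<Longrightarrow> \<bar>Re z\<bar> \<le> X \<Longrightarrow>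
    norm (of_int m * z + of_int n) ^ 2 \<ge> \<delta> * ((real_of_int m)\<^sup>2 + (real_of_int n)\<^sup>2)"
    by (rule lattice_norm_ge[OF assms(1), of X]) (rule that)
  have e: "0 \<le> 1 / ebar m ^ j" for m using ebar_ge_1[of m] by simp
  show ?thesis
  proof (rule that)
    show "(\<lambda>x. 1 / \<delta> ^ j * (case x of (m, n) \<Rightarrow> 1 / ebar m ^ j * (1 / ebar n ^ j))) summable_on UNIV"
      by (intro summable_on_cmult_right has_sum_imp_summable[OF has_sum_product_nonneg[OF S S]] e)
    fix z :: complex and m n :: int
    assume z: "Im z \<ge> \<eta>" "\<bar>Re z\<bar> \<le> X" and mn: "(m, n) \<noteq> (0, 0)"
    have "\<delta> * (ebar m * ebar n) \<le> \<delta> * ((real_of_int m)\<^sup>2 + (real_of_int n)\<^sup>2)"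
      using ebar_mult_le[OF mn] \<delta>(1) by (intro mult_left_mono) auto
    also have "\<dots> \<le> norm (of_int m * z + of_int n) ^ 2" by (rule \<delta>(2)[OF z])
    finally show "norm (1 / (of_int m * z + of_int n) ^ (2 * j)) \<le>
        1 / \<delta> ^ j * (case (m, n) of (m, n) \<Rightarrow> 1 / ebar m ^ j * (1 / ebar n ^ j))"
      using norm_term_le \<delta>(1) by simp
  qed
qed

lemma eisenstein_has_sum:
  assumes "((\<lambda>m. 1 / ebar m ^ j) has_sum S) UNIV" and z: "Im z > 0"
  shows "((\<lambda>(m, n). 1 / (of_int m * z + of_int n) ^ (2 * j)) has_sum eisenstein_sum (2 * j) z) (UNIV - {(0, 0)})"
proof -
  obtain M where M: "M summable_on UNIV" "\<And>w m n. Im w \<ge> Im z \<Longrightarrow> \<bar>Re w\<bar> \<le> \<bar>Re z\<bar> \<Longrightarrow> (m, n) \<noteq> (0, 0) \<Longrightarrow>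
     norm (1 / (of_int m * w + of_int n) ^ (2 * j)) \<le> M (m, n)"
    by (rule lattice_sum_bound[OF z assms(1), of "\<bar>Re z\<bar>"]) (rule that)
  have "(\<lambda>x. norm (case x of (m, n) \<Rightarrow> 1 / (of_int m * z + of_int n) ^ (2 * j))) summable_on UNIV - {(0, 0)}"
    by (rule summable_on_comparison_test[of M])
       (use M in \<open>auto intro: summable_on_subset_banach\<close>)
  thus ?thesis unfolding eisenstein_sum_def by (intro has_sum_infsum) (rule abs_summable_summable)
qed

text \<open>The Weierstrass test along the filter of finite subsets of the lattice, on a closed disc
  that stays away from the real axis.\<close>

lemma holomorphic_eisenstein:
  assumes S: "((\<lambda>m. 1 / ebar m ^ j) has_sum S) UNIV"
  shows "eisenstein_sum (2 * j) holomorphic_on {z. Im z > 0}"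
proof -
  have *: "\<exists>r>0. eisenstein_sum (2 * j) holomorphic_on ball z0 r" if z0: "Im z0 > 0" for z0
  proof -
    define r where "r = Im z0 / 2"
    have r: "r > 0" using z0 by (simp add: r_def)
    have B: "Im z \<ge> r \<and> \<bar>Re z\<bar> \<le> \<bar>Re z0\<bar> + r" if "z \<in> cball z0 r" for z
      using that abs_Re_le_cmod[of "z0 - z"] abs_Im_le_cmod[of "z0 - z"] by (auto simp: r_def dist_norm)
    obtain M where M: "M summable_on UNIV" "\<And>z m n. Im z \<ge> r \<Longrightarrow> \<bar>Re z\<bar> \<le> \<bar>Re z0\<bar> + r \<Longrightarrow> (m, n) \<noteq> (0, 0) \<Longrightarrow>
     norm (1 / (of_int m * z + of_int n) ^ (2 * j)) \<le> M (m, n)"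
      by (rule lattice_sum_bound[OF r S, of "\<bar>Re z0\<bar> + r"]) (rule that)
    define t where "t = (\<lambda>x z. case x of (m, n) \<Rightarrow> 1 / (of_int m * z + of_int n :: complex) ^ (2 * j))"
    have ul: "uniform_limit (cball z0 r) (\<lambda>X z. \<Sum>x\<in>X. t x z) (eisenstein_sum (2 * j))
        (finite_subsets_at_top (UNIV - {(0, 0)}))"
    proof (rule Weierstrass_m_test_general')
      show "norm (t x z) \<le> M x" if "x \<in> UNIV - {(0, 0)}" "z \<in> cball z0 r" for x z
        using M(2)[of z "fst x" "snd x"] B[OF that(2)] that(1) by (cases x) (simp add: t_def)
      show "((\<lambda>x. t x z) has_sum eisenstein_sum (2 * j) z) (UNIV - {(0, 0)})" if "z \<in> cball z0 r" for z
        using eisenstein_has_sum[OF S, of z] B[OF that] r by (simp add: t_def)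
      show "M summable_on UNIV - {(0, 0)}" by (rule summable_on_subset_banach[OF M(1)]) simp
    qed
    have ht: "t x holomorphic_on cball z0 r" if "x \<in> UNIV - {(0, 0)}" for x
    proof -
      obtain m n where x: "x = (m, n)" by (cases x)
      have "of_int m * z + of_int n \<noteq> 0" if "z \<in> cball z0 r" for z
        using lattice_nonzero[of z m n] B[OF that] r \<open>x \<in> _\<close> x by auto
      thus ?thesis unfolding t_def x by (auto intro!: holomorphic_intros)
    qed
    have "\<forall>\<^sub>F X in finite_subsets_at_top (UNIV - {(0, 0)}).
       continuous_on (cball z0 r) (\<lambda>z. \<Sum>x\<in>X. t x z) \<and> (\<lambda>z. \<Sum>x\<in>X. t x z) holomorphic_on ball z0 r"
      unfolding eventually_finite_subsets_at_top
    proof (intro exI[of _ "{}"] conjI allI impI)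
      fix X assume X: "finite X \<and> {} \<subseteq> X \<and> X \<subseteq> UNIV - {(0 :: int, 0 :: int)}"
      have "(\<lambda>z. \<Sum>x\<in>X. t x z) holomorphic_on cball z0 r"
        using X ht by (intro holomorphic_on_sum) blast
      thus "continuous_on (cball z0 r) (\<lambda>z. \<Sum>x\<in>X. t x z)" "(\<lambda>z. \<Sum>x\<in>X. t x z) holomorphic_on ball z0 r"
        by (auto intro: holomorphic_on_imp_continuous_on holomorphic_on_subset[OF _ ball_subset_cball])
    qed auto
    from holomorphic_uniform_limit[OF this ul] show ?thesis using r by auto
  qed
  have "eisenstein_sum (2 * j) field_differentiable at z within {z. Im z > 0}" if "Im z > 0" for z
  proof -
    obtain r where "r > 0" "eisenstein_sum (2 * j) holomorphic_on ball z r" using * \<open>Im z > 0\<close> by blast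
    hence "eisenstein_sum (2 * j) field_differentiable at z"
      by (intro holomorphic_on_imp_differentiable_at[of _ "ball z r"]) auto
    thus ?thesis by (rule field_differentiable_at_within)
  qed
  thus ?thesis by (simp add: holomorphic_on_def)
qed

section \<open>The modular function\<close>

text \<open>The matrix permutes the nonzero lattice vectors by multiplication from the right, and
  \<open>\<gamma>'\<close> is multiplication by its inverse. Reindexing an \<open>infsum\<close> and
  pulling out a constant hold regardless of convergence, so k is arbitrary.\<close>

lemma eisenstein_modular:
  fixes a b c d :: int
  assumes det: "a * d - b * c = 1" and nz: "of_int c * z + of_int d \<noteq> 0"
  shows "eisenstein_sum k ((of_int a * z + of_int b) / (of_int c * z + of_int d)) =
           (of_int c * z + of_int d) ^ k * eisenstein_sum k z"
proof -
  define \<gamma> where "\<gamma> = (\<lambda>(m :: int, n :: int). (m * a + n * c, m * b + n * d))"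
  define w where "w = of_int c * z + of_int d"
  define \<gamma>' where "\<gamma>' = (\<lambda>(m :: int, n :: int). (m * d - n * c, n * a - m * b))"
  have bij: "bij_betw \<gamma> (UNIV - {(0, 0)}) (UNIV - {(0, 0)})"
  proof (rule bij_betwI[where g = \<gamma>'])
    show inv1: "\<gamma>' (\<gamma> x) = x" for x
    proof (cases x)
      case (Pair m n)
      have "(m * a + n * c) * d - (m * b + n * d) * c = m * (a * d - b * c)"
           "(m * b + n * d) * a - (m * a + n * c) * b = n * (a * d - b * c)" by (simp_all add: algebra_simps)
      thus ?thesis using Pair det by (simp add: \<gamma>_def \<gamma>'_def)
    qed
    show inv2: "\<gamma> (\<gamma>' x) = x" for x
    proof (cases x)
      case (Pair m n)
      have "(m * d - n * c) * a + (n * a - m * b) * c = m * (a * d - b * c)"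
           "(m * d - n * c) * b + (n * a - m * b) * d = n * (a * d - b * c)" by (simp_all add: algebra_simps)
      thus ?thesis using Pair det by (simp add: \<gamma>_def \<gamma>'_def)
    qed
    have 0: "\<gamma> (0, 0) = (0, 0)" "\<gamma>' (0, 0) = (0, 0)" by (simp_all add: \<gamma>_def \<gamma>'_def)
    show "\<gamma> \<in> UNIV - {(0, 0)} \<rightarrow> UNIV - {(0, 0)}"
    proof (rule Pi_I)
      fix x :: "int \<times> int" assume "x \<in> UNIV - {(0, 0)}"
      thus "\<gamma> x \<in> UNIV - {(0, 0)}" using inv1[of x] 0(2) by auto
    qed
    show "\<gamma>' \<in> UNIV - {(0, 0)} \<rightarrow> UNIV - {(0, 0)}"
    proof (rule Pi_I)
      fix x :: "int \<times> int" assume "x \<in> UNIV - {(0, 0)}"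
      thus "\<gamma>' x \<in> UNIV - {(0, 0)}" using inv2[of x] 0(1) by auto
    qed
  qed
  have "eisenstein_sum k ((of_int a * z + of_int b) / w) =
     (\<Sum>\<^sub>\<infinity>x\<in>UNIV - {(0, 0)}. w ^ k * (case \<gamma> x of (m, n) \<Rightarrow> 1 / (of_int m * z + of_int n) ^ k))"
    unfolding eisenstein_sum_def
  proof (rule infsum_cong)
    fix x :: "int \<times> int"
    obtain m n where x: "x = (m, n)" by (cases x)
    have "of_int m * ((of_int a * z + of_int b) / w) + of_int n =
            (of_int (m * a + n * c) * z + of_int (m * b + n * d)) / w"
      using nz by (simp add: w_def divide_simps) (simp add: algebra_simps)
    thus "(case x of (m, n) \<Rightarrow> 1 / (of_int m * ((of_int a * z + of_int b) / w) + of_int n) ^ k) =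
       w ^ k * (case \<gamma> x of (m, n) \<Rightarrow> 1 / (of_int m * z + of_int n) ^ k)"
      by (simp add: x \<gamma>_def power_divide)
  qed
  also have "\<dots> = w ^ k * (\<Sum>\<^sub>\<infinity>x\<in>UNIV - {(0, 0)}. (case \<gamma> x of (m, n) \<Rightarrow> 1 / (of_int m * z + of_int n) ^ k))"
    by (rule infsum_cmult_right')
  also have "(\<Sum>\<^sub>\<infinity>x\<in>UNIV - {(0, 0)}. (case \<gamma> x of (m, n) \<Rightarrow> 1 / (of_int m * z + of_int n) ^ k)) = eisenstein_sum k z"
    unfolding eisenstein_sum_def by (rule infsum_reindex_bij_betw[OF bij])
  finally show ?thesis by (simp add: w_def)
qed

text \<open>The distance to a finite partial sum is at most the tail of the majorant, which is its
  total minus finitely many terms. The origin is among the subtracted terms: the majorant has a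
  value there, the series has no term.\<close>

lemma eisenstein_near_partial_sum:
  assumes S: "((\<lambda>m. 1 / ebar m ^ j) has_sum S) UNIV" and z: "Im z > 0"
    and I: "finite I" "(0, 0) \<notin> I"
    and g: "(g has_sum A) UNIV" and h: "(h has_sum B) UNIV" and nonneg: "\<And>m. g m \<ge> 0" "\<And>n. h n \<ge> 0"
    and le: "\<And>m n. (m, n) \<noteq> (0, 0) \<Longrightarrow> (m, n) \<notin> I \<Longrightarrow>
               norm (1 / (of_int m * z + of_int n) ^ (2 * j)) \<le> g m * h n"
  shows "norm (eisenstein_sum (2 * j) z - (\<Sum>(m, n)\<in>I. 1 / (of_int m * z + of_int n) ^ (2 * j)))
           \<le> A * B - (\<Sum>(m, n)\<in>insert (0, 0) I. g m * h n)"
proof (rule norm_infsum_le)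
  have "((\<lambda>(m, n). 1 / (of_int m * z + of_int n) ^ (2 * j)) has_sum
      (eisenstein_sum (2 * j) z - (\<Sum>(m, n)\<in>I. 1 / (of_int m * z + of_int n) ^ (2 * j)))) (UNIV - {(0, 0)} - I)"
    by (intro has_sum_Diff eisenstein_has_sum[OF S z] has_sum_finite I) (use I in auto)
  also have "UNIV - {(0, 0)} - I = UNIV - insert (0, 0) I" by auto
  finally show "((\<lambda>(m, n). 1 / (of_int m * z + of_int n) ^ (2 * j)) has_sum
      (eisenstein_sum (2 * j) z - (\<Sum>(m, n)\<in>I. 1 / (of_int m * z + of_int n) ^ (2 * j)))) (UNIV - insert (0, 0) I)" .
  show "((\<lambda>(m, n). g m * h n) has_sum (A * B - (\<Sum>(m, n)\<in>insert (0, 0) I. g m * h n))) (UNIV - insert (0, 0) I)"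
    by (intro has_sum_Diff has_sum_product_nonneg g h nonneg has_sum_finite) (use I in auto)
qed (use le in auto)

section \<open>Values of the Eisenstein series at rho and 10 i\<close>

definition rho :: complex where "rho = Complex (- 1 / 2) (sqrt 3 / 2)"

lemma Im_rho: "Im rho > 0"
  by (simp add: rho_def)

lemma rho_eq: "rho\<^sup>2 + rho + 1 = 0"
  by (simp add: rho_def complex_eq_iff power2_eq_square field_simps)

lemma rho_plus_1_cube: "(rho + 1) ^ 3 = - 1"
proof -
  have "(rho + 1) ^ 3 + 1 = (rho\<^sup>2 + rho + 1) * (rho + 2)"
    by (simp add: power2_eq_square power3_eq_cube algebra_simps)
  thus ?thesis by (simp add: rho_eq add_eq_0_iff2)
qed

lemma rho_cube: "rho ^ 3 = 1"
proof -
  have "rho ^ 3 - 1 = (rho\<^sup>2 + rho + 1) * (rho - 1)"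
    by (simp add: power2_eq_square power3_eq_cube algebra_simps)
  thus ?thesis by (simp add: rho_eq)
qed

text \<open>The matrix with rows (0, -1) and (1, 1) fixes rho, while its factor (rho + 1)^4 = - (rho
  + 1) differs from 1.\<close>

lemma eisenstein_4_rho: "eisenstein_sum 4 rho = 0"
proof -
  have nz: "rho + 1 \<noteq> 0" using rho_plus_1_cube by auto
  have "- 1 / (rho + 1) = rho"
  proof -
    have "rho * (rho + 1) = (rho\<^sup>2 + rho + 1) - 1" by (simp add: power2_eq_square algebra_simps)
    hence "rho * (rho + 1) = - 1" unfolding rho_eq by simp
    thus ?thesis using nz by (metis nonzero_eq_divide_eq)
  qed
  moreover have "eisenstein_sum 4 ((of_int 0 * rho + of_int (-1)) / (of_int 1 * rho + of_int 1)) =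
      (of_int 1 * rho + of_int 1) ^ 4 * eisenstein_sum 4 rho"
    by (rule eisenstein_modular) (use nz in auto)
  ultimately have "eisenstein_sum 4 rho = (rho + 1) ^ 4 * eisenstein_sum 4 rho" by simp
  also have "(rho + 1) ^ 4 = - (rho + 1)"
    using rho_plus_1_cube power_Suc[of "rho + 1" 3] by simp
  finally have "(rho + 2) * eisenstein_sum 4 rho = 0" by (simp add: algebra_simps)
  moreover have "rho + 2 \<noteq> 0" using Im_rho by (auto simp: complex_eq_iff)
  ultimately show ?thesis by simp
qed

text \<open>The set \<open>I\<close> lists the six units of the ring generated by rho; each
  contributes 1. As m^2 - m n + n^2 >= \<open>ebar m * ebar n\<close>, the remaining terms add up to
  at most (7/2)^2 - 7 < 6, where 7 counts the units and the origin.\<close>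

lemma eisenstein_6_rho: "eisenstein_sum 6 rho \<noteq> 0"
proof
  assume 0: "eisenstein_sum 6 rho = 0"
  obtain S where S: "((\<lambda>m. 1 / ebar m ^ 3) has_sum S) UNIV" "0 \<le> S" "S \<le> 7 / 2"
    by (rule has_sum_ebar_3)
  define I :: "(int \<times> int) set" where "I = {(1, 0), (-1, 0), (0, 1), (0, -1), (1, 1), (-1, -1)}"
  have "norm (eisenstein_sum (2 * 3) rho - (\<Sum>(m, n)\<in>I. 1 / (of_int m * rho + of_int n) ^ (2 * 3)))
      \<le> S * S - (\<Sum>(m, n)\<in>insert (0, 0) I. 1 / ebar m ^ 3 * (1 / ebar n ^ 3))"
  proof (rule eisenstein_near_partial_sum[OF S(1) Im_rho _ _ S(1) S(1)])
    fix m n :: int assume mn: "(m, n) \<noteq> (0, 0)"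
    define M N where "M = real_of_int m" "N = real_of_int n"
    have "norm (of_int m * rho + of_int n) ^ 2 = (N - M / 2)\<^sup>2 + M\<^sup>2 * (3 / 4)"
      by (simp add: cmod_power2 M_N_def rho_def power_mult_distrib power_divide)
    also have "\<dots> = M\<^sup>2 - M * N + N\<^sup>2" by (simp add: power2_eq_square field_simps)
    also have "\<dots> \<ge> ebar m * ebar n"
    proof (cases "m = 0 \<or> n = 0")
      case True
      thus ?thesis using ebar_mult_le[OF mn] by (auto simp: M_N_def)
    next
      case False
      have "ebar m * ebar n = \<bar>M * N\<bar>" using False by (simp add: ebar_nonzero M_N_def abs_mult)
      moreover have "0 \<le> (M - N)\<^sup>2" "0 \<le> (M + N)\<^sup>2" "0 \<le> M\<^sup>2" "0 \<le> N\<^sup>2" by simp_all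
      ultimately show ?thesis by (simp add: power2_eq_square algebra_simps abs_if)
    qed
    finally have "1 * (ebar m * ebar n) \<le> norm (of_int m * rho + of_int n) ^ 2" by simp
    from norm_term_le[OF this, of 3]
    show "norm (1 / (of_int m * rho + of_int n) ^ (2 * 3)) \<le> 1 / ebar m ^ 3 * (1 / ebar n ^ 3)" by simp
  qed (use ebar_ge_1 in \<open>auto simp: I_def intro: order_trans[of 0 1]\<close>)
  moreover have "(\<Sum>(m, n)\<in>insert (0, 0) I. 1 / ebar m ^ 3 * (1 / ebar n ^ 3)) = 7"
    by (simp add: I_def ebar_nonzero)
  moreover have "(\<Sum>(m, n)\<in>I. 1 / (of_int m * rho + of_int n) ^ (2 * 3)) = 6"
  proof -
    have 6: "x ^ 6 = (x ^ 3) ^ 2" for x :: complex by (simp flip: power_mult)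
    have "(- 1 - rho) ^ 3 = - ((rho + 1) ^ 3)" by (simp add: power3_eq_cube algebra_simps)
    hence "(- 1 - rho) ^ 6 = 1" "(rho + 1) ^ 6 = 1" "rho ^ 6 = 1" "rho \<noteq> - 1"
      using rho_plus_1_cube by (auto simp: 6 rho_cube)
    thus ?thesis by (simp add: I_def)
  qed
  moreover have "S * S \<le> 7 / 2 * (7 / 2)" using S by (intro mult_mono) auto
  ultimately show False using 0 by simp
qed

text \<open>High above the real axis the row m = 0 dominates. Its terms n = 1 and n = -1 contribute
  2, and the rest is at most (0.045 + 0.99) * 4.5 - 3 < 2.\<close>

lemma eisenstein_4_nonzero: "eisenstein_sum 4 (10 * \<i>) \<noteq> 0"
proof
  assume 0: "eisenstein_sum 4 (10 * \<i>) = 0"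
  obtain S where S: "((\<lambda>m. 1 / ebar m ^ 2) has_sum S) UNIV" "0 \<le> S" "S \<le> 9 / 2"
    by (rule has_sum_ebar_2)
  \<comment> \<open>The weight of the row m = 0 is 1. In the other rows |10 i m + n|^2 >= 10
    \<open>ebar m * ebar n\<close>, whose square gives the factor 1/100.\<close>
  define g where "g = (\<lambda>m. 1 / 100 * (1 / ebar m ^ 2) + (if m = 0 then 99 / 100 else 0))"
  define I :: "(int \<times> int) set" where "I = {(0, 1), (0, -1)}"
  have "((\<lambda>m. if m = 0 then 99 / 100 else 0 :: real) has_sum 99 / 100) {0 :: int}"
    using has_sum_finite[of "{0 :: int}" "\<lambda>m. if m = 0 then 99 / 100 else 0 :: real"] by simp
  hence "((\<lambda>m. if m = 0 then 99 / 100 else 0 :: real) has_sum 99 / 100) (UNIV :: int set)"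
    by (subst has_sum_cong_neutral[where T = "{0}"]) auto
  hence g: "(g has_sum (1 / 100 * S + 99 / 100)) UNIV"
    unfolding g_def by (intro has_sum_add has_sum_cmult_right S(1))
  have "norm (eisenstein_sum (2 * 2) (10 * \<i>) - (\<Sum>(m, n)\<in>I. 1 / (of_int m * (10 * \<i>) + of_int n) ^ (2 * 2)))
      \<le> (1 / 100 * S + 99 / 100) * S - (\<Sum>(m, n)\<in>insert (0, 0) I. g m * (1 / ebar n ^ 2))"
  proof (rule eisenstein_near_partial_sum[OF S(1) _ _ _ g S(1)])
    fix m n :: int assume mn: "(m, n) \<noteq> (0, 0)"
    have nrm: "norm (of_int m * (10 * \<i>) + of_int n) ^ 2 = 100 * (real_of_int m)\<^sup>2 + (real_of_int n)\<^sup>2"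
      by (simp add: cmod_power2 power_mult_distrib)
    show "norm (1 / (of_int m * (10 * \<i>) + of_int n) ^ (2 * 2)) \<le> g m * (1 / ebar n ^ 2)"
    proof (cases "m = 0")
      case True
      have "1 * (ebar m * ebar n) \<le> norm (of_int m * (10 * \<i>) + of_int n) ^ 2"
        unfolding nrm using ebar_mult_le[OF mn] True by simp
      from norm_term_le[OF this, of 2] show ?thesis using True by (simp add: g_def)
    next
      case False
      have "10 * (ebar m * ebar n) \<le> norm (of_int m * (10 * \<i>) + of_int n) ^ 2"
      proof (cases "n = 0")
        case True
        hence "ebar m * ebar n \<le> (real_of_int m)\<^sup>2" using ebar_mult_le[OF mn] by simp
        moreover have "0 \<le> (real_of_int m)\<^sup>2" by simp
        ultimately have "10 * (ebar m * ebar n) \<le> 100 * (real_of_int m)\<^sup>2" by linarith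
        thus ?thesis unfolding nrm using True by simp
      next
        case n: False
        have "ebar m * ebar n = \<bar>real_of_int m\<bar> * \<bar>real_of_int n\<bar>" using False n by (simp add: ebar_nonzero)
        moreover have "20 * (\<bar>real_of_int m\<bar> * \<bar>real_of_int n\<bar>) \<le> 100 * (real_of_int m)\<^sup>2 + (real_of_int n)\<^sup>2"
          using zero_le_power2[of "10 * \<bar>real_of_int m\<bar> - \<bar>real_of_int n\<bar>"]
          by (simp add: power2_diff power_mult_distrib)
        moreover have "0 \<le> \<bar>real_of_int m\<bar> * \<bar>real_of_int n\<bar>" by (intro mult_nonneg_nonneg abs_ge_zero)
        ultimately show ?thesis unfolding nrm by linarith
      qed
      from norm_term_le[OF this, of 2] show ?thesis using False by (simp add: g_def)
    qed
  qed (auto simp: I_def g_def)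
  moreover have "(\<Sum>(m, n)\<in>insert (0, 0) I. g m * (1 / ebar n ^ 2)) = 3"
    by (simp add: I_def g_def ebar_nonzero)
  moreover have "(\<Sum>(m, n)\<in>I. 1 / (of_int m * (10 * \<i>) + of_int n :: complex) ^ (2 * 2)) = 2"
    by (simp add: I_def)
  moreover have "(1 / 100 * S + 99 / 100) * S \<le> (1 / 100 * (9 / 2) + 99 / 100) * (9 / 2)"
    using S by (intro mult_mono) auto
  ultimately show False using 0 by simp
qed

section \<open>The discriminant and the values of j\<close>

definition disc :: "complex \<Rightarrow> complex" where
  "disc z = weierstrass_g2 z ^ 3 - 27 * weierstrass_g3 z ^ 2"

lemma klein_j_eq: "klein_j z = 1728 * weierstrass_g2 z ^ 3 / disc z"
  by (simp add: klein_j_def disc_def)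

lemma holomorphic_g2: "weierstrass_g2 holomorphic_on {z. Im z > 0}"
proof -
  obtain S where "((\<lambda>m. 1 / ebar m ^ 2) has_sum S) UNIV" by (rule has_sum_ebar_2)
  from holomorphic_eisenstein[OF this] have "eisenstein_sum 4 holomorphic_on {z. Im z > 0}" by simp
  thus ?thesis unfolding weierstrass_g2_def[abs_def] by (intro holomorphic_intros)
qed

lemma holomorphic_g3: "weierstrass_g3 holomorphic_on {z. Im z > 0}"
proof -
  obtain S where "((\<lambda>m. 1 / ebar m ^ 3) has_sum S) UNIV" by (rule has_sum_ebar_3)
  from holomorphic_eisenstein[OF this] have "eisenstein_sum 6 holomorphic_on {z. Im z > 0}" by simp
  thus ?thesis unfolding weierstrass_g3_def[abs_def] by (intro holomorphic_intros)
qed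

lemma holomorphic_disc: "disc holomorphic_on {z. Im z > 0}"
  unfolding disc_def[abs_def] by (intro holomorphic_intros holomorphic_g2 holomorphic_g3)

lemma open_upper_half_plane: "open {z. Im z > 0}"
  by (rule open_halfspace_Im_gt)

lemma connected_upper_half_plane: "connected {z. Im z > 0}"
  by (intro convex_connected convex_halfspace_Im_gt)

lemma disc_rho: "disc rho \<noteq> 0"
  using eisenstein_4_rho eisenstein_6_rho by (simp add: disc_def weierstrass_g2_def weierstrass_g3_def)

lemma modular_transform:
  fixes a b c d :: int
  assumes det: "a * d - b * c = 1" and z: "Im z > 0"
  defines "w \<equiv> (of_int a * z + of_int b) / (of_int c * z + of_int d)"
  shows "disc w = (of_int c * z + of_int d) ^ 12 * disc z" and "klein_j w = klein_j z" and "Im w > 0"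
proof -
  have cd: "(c, d) \<noteq> (0, 0)" using det by auto
  have nz: "of_int c * z + of_int d \<noteq> 0" by (rule lattice_nonzero[OF z cd])
  define u where "u = of_int c * z + of_int d"
  have u: "u \<noteq> 0" using nz by (simp add: u_def)
  have g2: "weierstrass_g2 w = u ^ 4 * weierstrass_g2 z"
    using eisenstein_modular[OF det nz, of 4] by (simp add: weierstrass_g2_def w_def u_def)
  have g3: "weierstrass_g3 w = u ^ 6 * weierstrass_g3 z"
    using eisenstein_modular[OF det nz, of 6] by (simp add: weierstrass_g3_def w_def u_def)
  have g23: "weierstrass_g2 w ^ 3 = u ^ 12 * weierstrass_g2 z ^ 3"
    by (simp add: g2 power_mult_distrib flip: power_mult)
  have disc: "disc w = u ^ 12 * disc z"
    unfolding disc_def g23 g3 power_mult_distrib by (simp add: algebra_simps flip: power_mult)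
  show "disc w = (of_int c * z + of_int d) ^ 12 * disc z" using disc by (simp add: u_def)
  show "klein_j w = klein_j z" unfolding klein_j_eq disc g23 using u by simp
  have "Im w = (real_of_int (a * d - b * c) * Im z) / (norm u)\<^sup>2"
    unfolding w_def u_def[symmetric] by (subst Im_divide) (simp add: u_def cmod_power2 algebra_simps)
  thus "Im w > 0" using z det u by simp
qed

text \<open>With finitely many values, j would be constant on a disc around rho by connectedness,
  with value j(rho) = 0. Then g2 would vanish identically, contrary to its value at 10 i.\<close>

lemma klein_j_range_infinite: "infinite (klein_j ` {w. Im w > 0 \<and> disc w \<noteq> 0})"
proof
  assume fin: "finite (klein_j ` {w. Im w > 0 \<and> disc w \<noteq> 0})"
  have "open ({z. Im z > 0} \<inter> disc -` (- {0}))"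
    by (intro continuous_open_preimage holomorphic_on_imp_continuous_on holomorphic_disc open_upper_half_plane) auto
  moreover have "rho \<in> {z. Im z > 0} \<inter> disc -` (- {0})" using Im_rho disc_rho by auto
  ultimately obtain r where r: "r > 0" "ball rho r \<subseteq> {z. Im z > 0} \<inter> disc -` (- {0})"
    by (rule openE)
  have sub: "ball rho r \<subseteq> {z. Im z > 0}" using r(2) by blast
  have nz: "disc z \<noteq> 0" if "z \<in> ball rho r" for z using r(2) that by blast
  have "(\<lambda>z. 1728 * weierstrass_g2 z ^ 3 / disc z) holomorphic_on ball rho r"
    using nz r(1) sub by (intro holomorphic_intros holomorphic_on_subset[OF holomorphic_g2] holomorphic_on_subset[OF holomorphic_disc]) auto
  hence "continuous_on (ball rho r) klein_j"
    by (simp add: klein_j_eq[abs_def] holomorphic_on_imp_continuous_on)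
  hence "connected (klein_j ` ball rho r)" by (intro connected_continuous_image) auto
  moreover have "finite (klein_j ` ball rho r)"
    by (rule finite_subset[OF _ fin]) (use r(2) in auto)
  ultimately obtain v where v: "klein_j ` ball rho r = {v}"
    using r(1) connected_finite_iff_sing[of "klein_j ` ball rho r"] by auto
  have const: "klein_j z = v" if "z \<in> ball rho r" for z using v that by blast
  have "v = 0"
    using const[of rho] r(1) by (simp add: klein_j_eq weierstrass_g2_def eisenstein_4_rho)
  have "weierstrass_g2 (10 * \<i>) = 0"
  proof (rule analytic_continuation_open[of "ball rho r" "{z. Im z > 0}" weierstrass_g2 "\<lambda>_. 0"])
    show "weierstrass_g2 z = 0" if "z \<in> ball rho r" for z
      using const[OF that] nz[OF that] \<open>v = 0\<close> by (simp add: klein_j_eq)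
  qed (use r sub holomorphic_g2 in \<open>auto simp: open_upper_half_plane connected_upper_half_plane\<close>)
  thus False using eisenstein_4_nonzero by (simp add: weierstrass_g2_def)
qed

text \<open>The matrix with rows \<open>(1 + p N, - p\<^sup>2)\<close> and \<open>(N\<^sup>2, 1 - p N)\<close> used here is parabolic and fixes \<open>p / N\<close>.
  For \<open>p = \<lfloor>x N\<rfloor>\<close> it moves \<open>w\<close> close to \<open>p / N\<close>, hence to \<open>x\<close>.\<close>

lemma orbit_accumulates:
  assumes w: "Im w > 0" and dw: "disc w \<noteq> 0"
  obtains \<zeta> :: "nat \<Rightarrow> complex" where "\<And>n. Im (\<zeta> n) > 0" "\<And>n. disc (\<zeta> n) \<noteq> 0"
    "\<And>n. klein_j (\<zeta> n) = klein_j w" "\<zeta> \<longlonglongrightarrow> of_real x"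
proof -
  define N where "N = (\<lambda>n. int (Suc n))"
  define p where "p = (\<lambda>n. \<lfloor>x * N n\<rfloor>)"
  define a b c d where "a = (\<lambda>n. 1 + p n * N n)" and "b = (\<lambda>n. - (p n * p n))"
    and "c = (\<lambda>n. N n * N n)" and "d = (\<lambda>n. 1 - p n * N n)"
  define \<zeta> where "\<zeta> = (\<lambda>n. (of_int (a n) * w + of_int (b n)) / (of_int (c n) * w + of_int (d n)))"
  have det: "a n * d n - b n * c n = 1" for n
    by (simp add: a_def b_def c_def d_def algebra_simps)
  have nz: "of_int (c n) * w + of_int (d n) \<noteq> 0" for n
    using det[of n] by (intro lattice_nonzero[OF w]) auto
  have N: "N n \<ge> 1" for n by (simp add: N_def)
  \<comment> \<open>The point a / c is the image of infinity. It differs from the image of w by 1 /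
    (c (c w + d)), and it equals p / N + 1 / N^2, where p / N is within 1 / N of x.\<close>
  have est: "norm (\<zeta> n - of_real x) \<le> (2 + 1 / Im w) * inverse (real (Suc n))" for n
  proof -
    define M where "M = real_of_int (N n)"
    have M: "M \<ge> 1" "M = real (Suc n)" using N[of n] by (auto simp: M_def N_def)
    define u where "u = of_int (c n) * w + of_int (d n)"
    have u: "u \<noteq> 0" using nz by (simp add: u_def)
    have C: "real_of_int (c n) = M * M" by (simp add: c_def M_def)
    have "\<bar>Im u\<bar> \<le> norm u" by (rule abs_Im_le_cmod)
    hence nu: "M * M * Im w \<le> norm u" by (simp add: u_def C)
    have "\<zeta> n - of_int (a n) / of_int (c n) = - of_int (a n * d n - b n * c n) / (of_int (c n) * u)"
    proof -
      have "c n \<noteq> 0" using N[of n] by (simp add: c_def)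
      hence "\<zeta> n - of_int (a n) / of_int (c n) =
          ((of_int (a n) * w + of_int (b n)) * of_int (c n) - of_int (a n) * u) / (u * of_int (c n))"
        unfolding \<zeta>_def u_def[symmetric] using u by (intro diff_frac_eq) auto
      also have "(of_int (a n) * w + of_int (b n)) * of_int (c n) - of_int (a n) * u =
          - of_int (a n * d n - b n * c n)"
        by (simp add: u_def algebra_simps)
      finally show ?thesis by (simp only: mult.commute)
    qed
    also have "norm \<dots> = 1 / (M * M * norm u)"
    proof -
      have "norm (of_int (c n) :: complex) = M * M" using M(1) by (simp add: C)
      thus ?thesis unfolding det by (simp add: norm_divide norm_mult)
    qed
    also have "\<dots> \<le> 1 / (M * Im w)"
    proof (rule divide_left_mono)
      have "1 * Im w \<le> M * M * Im w" using M w by (intro mult_right_mono) (auto simp: mult_ge1_I)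
      hence "Im w \<le> norm u" using nu by simp
      moreover have "M * 1 \<le> M * M" using M by (intro mult_left_mono) auto
      ultimately show "M * Im w \<le> M * M * norm u" using M w by (intro mult_mono) auto
    qed (use M w u in auto)
    finally have 1: "norm (\<zeta> n - of_int (a n) / of_int (c n)) \<le> 1 / (M * Im w)" .
    have 2: "norm (of_int (a n) / of_int (c n) - of_real x :: complex) \<le> 2 / M"
    proof -
      have eq: "real_of_int (a n) / real_of_int (c n) - x = 1 / (M * M) + (real_of_int (p n) - x * M) / M"
        using M unfolding C by (simp add: a_def M_def divide_simps) (simp add: algebra_simps)
      have "\<bar>real_of_int (p n) - x * M\<bar> \<le> 1"
        unfolding p_def M_def by linarith
      hence b: "\<bar>(real_of_int (p n) - x * M) / M\<bar> \<le> 1 / M" using M by (simp add: abs_divide divide_right_mono)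
      have b': "\<bar>1 / (M * M)\<bar> \<le> 1 / M" using M by (simp add: divide_simps)
      have "\<bar>real_of_int (a n) / real_of_int (c n) - x\<bar> \<le> \<bar>1 / (M * M)\<bar> + \<bar>(real_of_int (p n) - x * M) / M\<bar>"
        unfolding eq by (rule abs_triangle_ineq)
      also have "\<dots> \<le> 1 / M + 1 / M" by (rule add_mono[OF b' b])
      finally have "\<bar>real_of_int (a n) / real_of_int (c n) - x\<bar> \<le> 2 / M" by simp
      moreover have "of_int (a n) / of_int (c n) - of_real x = (of_real (real_of_int (a n) / real_of_int (c n) - x) :: complex)"
        by simp
      ultimately show ?thesis by (simp only: norm_of_real)
    qed
    have "norm (\<zeta> n - of_real x) \<le> 1 / (M * Im w) + 2 / M"
      using norm_triangle_ineq[of "\<zeta> n - of_int (a n) / of_int (c n)" "of_int (a n) / of_int (c n) - of_real x"] 1 2 by simp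
    also have "\<dots> = (2 + 1 / Im w) * inverse M"
      by (simp add: divide_inverse algebra_simps)
    finally show ?thesis by (simp only: M(2))
  qed
  have "(\<lambda>n. \<zeta> n - of_real x) \<longlonglongrightarrow> 0"
    by (rule Lim_null_comparison[OF always_eventually[OF allI[OF est]]])
       (intro tendsto_mult_right_zero LIMSEQ_inverse_real_of_nat)
  hence "\<zeta> \<longlonglongrightarrow> of_real x" by (rule LIM_zero_cancel)
  moreover have "Im (\<zeta> n) > 0" "disc (\<zeta> n) \<noteq> 0" "klein_j (\<zeta> n) = klein_j w" for n
    using modular_transform[OF det[of n] w] nz[of n] dw by (auto simp: \<zeta>_def)
  ultimately show ?thesis using that by blast
qed

section \<open>Real analytic functions on horizontal lines\<close>

text \<open>The series converges absolutely at the corner \<open>x1\<close> of a cube around a, and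
  its terms there majorize those on the ball of radius s, which is contained in the cube. So the
  Weierstrass test applies.\<close>

lemma real_analytic_on_imp_continuous_on:
  fixes f :: "'a :: euclidean_space \<Rightarrow> real"
  assumes "real_analytic_on f V"
  shows "continuous_on V f"
proof -
  have "isCont f a" if a: "a \<in> V" for a
  proof -
    obtain c :: "('a \<Rightarrow> nat) \<Rightarrow> real" and r where r: "r > 0"
      and c: "\<And>x. x \<in> ball a r \<Longrightarrow>
        ((\<lambda>\<alpha>. c \<alpha> * (\<Prod>b\<in>Basis. ((x - a) \<bullet> b) ^ \<alpha> b)) has_sum f x) (Basis \<rightarrow>\<^sub>E UNIV)"
      using assms a unfolding real_analytic_on_def by blast
    \<comment> \<open>The corner is at distance at most s times the dimension from a, which has to
      be less than r.\<close>
    define s where "s = r / (real DIM('a) + 1)"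
    have s: "s > 0" using r by (simp add: s_def)
    have sr: "s * real DIM('a) < r" "s < r" using r by (auto simp: s_def field_simps)
    define x1 where "x1 = a + (\<Sum>b\<in>Basis. s *\<^sub>R b :: 'a)"
    have "norm (\<Sum>b\<in>Basis. s *\<^sub>R b :: 'a) \<le> (\<Sum>b\<in>(Basis :: 'a set). s)"
      using s by (intro sum_norm_le) simp
    hence "x1 \<in> ball a r" using sr(1) by (simp add: x1_def dist_norm mult.commute)
    note sum1 = c[OF this]
    have x1b: "(x1 - a) \<bullet> b = s" if "b \<in> Basis" for b
      using that by (simp add: x1_def inner_sum_left inner_Basis if_distrib sum.delta cong: if_cong)
    define t where "t = (\<lambda>\<alpha> x. c \<alpha> * (\<Prod>b\<in>Basis. ((x - a) \<bullet> b) ^ \<alpha> b))"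
    have "uniform_limit (cball a s) (\<lambda>X x. \<Sum>\<alpha>\<in>X. t \<alpha> x) f (finite_subsets_at_top (Basis \<rightarrow>\<^sub>E UNIV))"
    proof (rule Weierstrass_m_test_general')
      have "(\<lambda>\<alpha>. t \<alpha> x1) summable_on Basis \<rightarrow>\<^sub>E UNIV"
        using sum1 unfolding t_def by (rule has_sum_imp_summable)
      thus "(\<lambda>\<alpha>. norm (t \<alpha> x1)) summable_on Basis \<rightarrow>\<^sub>E UNIV"
        by (rule iffD1[OF summable_on_iff_abs_summable_on_real])
      show "((\<lambda>\<alpha>. t \<alpha> x) has_sum f x) (Basis \<rightarrow>\<^sub>E UNIV)" if "x \<in> cball a s" for x
        unfolding t_def by (rule c) (use that sr in auto)
      show "norm (t \<alpha> x) \<le> norm (t \<alpha> x1)" if "x \<in> cball a s" for \<alpha> x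
      proof -
        have "\<bar>(x - a) \<bullet> b\<bar> \<le> s" if "b \<in> Basis" for b
          using Basis_le_norm[OF that, of "x - a"] \<open>x \<in> cball a s\<close> by (simp add: dist_norm norm_minus_commute)
        hence "(\<Prod>b\<in>Basis. \<bar>(x - a) \<bullet> b\<bar> ^ \<alpha> b) \<le> (\<Prod>b\<in>(Basis :: 'a set). s ^ \<alpha> b)"
          by (intro prod_mono) (auto intro: power_mono)
        also have "\<dots> = (\<Prod>b\<in>(Basis :: 'a set). \<bar>(x1 - a) \<bullet> b\<bar> ^ \<alpha> b)"
          using s by (intro prod.cong refl) (simp add: x1b)
        finally show ?thesis
          by (simp add: t_def abs_mult abs_prod power_abs mult_left_mono)
      qed
    qed
    hence "continuous_on (cball a s) f"
    proof (rule uniform_limit_theorem[rotated])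
      show "\<forall>\<^sub>F X in finite_subsets_at_top (Basis \<rightarrow>\<^sub>E UNIV). continuous_on (cball a s) (\<lambda>x. \<Sum>\<alpha>\<in>X. t \<alpha> x)"
        unfolding t_def by (intro always_eventually allI continuous_intros)
    qed auto
    thus ?thesis using s by (intro continuous_on_interior[of "cball a s"]) auto
  qed
  thus ?thesis by (intro continuous_at_imp_continuous_on) blast
qed

lemma complexify_horizontal:
  fixes f :: "complex \<Rightarrow> real"
  assumes "real_analytic_on f V" "v \<in> V"
  obtains r F where "r > 0" "F holomorphic_on ball v r"
    "\<And>t :: real. \<bar>t\<bar> < r \<Longrightarrow> F (v + of_real t) = of_real (f (v + of_real t))"
proof -
  obtain c :: "(complex \<Rightarrow> nat) \<Rightarrow> real" and r where r: "r > 0"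
    and c: "\<And>x. x \<in> ball v r \<Longrightarrow>
      ((\<lambda>\<alpha>. c \<alpha> * (\<Prod>b\<in>Basis. ((x - v) \<bullet> b) ^ \<alpha> b)) has_sum f x) (Basis \<rightarrow>\<^sub>E UNIV)"
    using assms unfolding real_analytic_on_def by blast
  \<comment> \<open>The exponents of the monomials that are pure powers of the first coordinate. On
    the line the second coordinate vanishes relative to v, and as 0^0 = 1 exactly these monomials
    survive; they form a power series in one variable.\<close>
  define e :: "nat \<Rightarrow> complex \<Rightarrow> nat" where
    "e = (\<lambda>n. restrict (\<lambda>b. if b = 1 then n else 0) Basis)"
  have e1: "e n 1 = n" "e n \<i> = 0" for n by (simp_all add: e_def Basis_complex_def)
  have inj: "inj e" by (rule injI) (metis e1(1))
  have real_sums: "(\<lambda>n. c (e n) * t ^ n) sums f (v + of_real t)" if t: "\<bar>t\<bar> < r" for t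
  proof -
    have sum2: "((\<lambda>\<alpha>. c \<alpha> * (t ^ \<alpha> 1 * 0 ^ \<alpha> \<i>)) has_sum f (v + of_real t)) (Basis \<rightarrow>\<^sub>E UNIV)"
      using c[of "v + of_real t"] t by (simp add: Basis_complex_def dist_norm inner_complex_def)
    have "((\<lambda>\<alpha>. c \<alpha> * (t ^ \<alpha> 1 * 0 ^ \<alpha> \<i>)) has_sum f (v + of_real t)) (range e)"
    proof (rule has_sum_cong_neutral[THEN iffD1, OF _ _ _ sum2])
      fix \<alpha> :: "complex \<Rightarrow> nat" assume \<alpha>: "\<alpha> \<in> (Basis \<rightarrow>\<^sub>E UNIV) - range e"
      have "\<alpha> \<i> \<noteq> 0"
      proof
        assume "\<alpha> \<i> = 0"
        hence "\<alpha> = e (\<alpha> 1)"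
          using \<alpha> by (auto simp: e_def Basis_complex_def PiE_def extensional_def restrict_def fun_eq_iff)
        thus False using \<alpha> by blast
      qed
      thus "c \<alpha> * (t ^ \<alpha> 1 * 0 ^ \<alpha> \<i>) = 0" by simp
    qed (auto simp: e_def)
    hence "((\<lambda>n. c (e n) * t ^ n) has_sum f (v + of_real t)) UNIV"
      by (subst (asm) has_sum_reindex[OF inj]) (simp add: o_def e1)
    thus ?thesis by (rule has_sum_imp_sums)
  qed
  define F where "F = (\<lambda>z. suminf (\<lambda>n. of_real (c (e n)) * (z - v) ^ n))"
  have "(\<lambda>n. of_real (c (e n)) * (z - v) ^ n) sums F z" if z: "z \<in> ball v r" for z
  proof -
    have "norm (z - v) < r" using z by (simp add: dist_norm norm_minus_commute)
    then obtain t where t: "norm (z - v) < t" "t < r" using dense by blast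
    have "t > 0" using t(1) norm_ge_zero by (rule le_less_trans[rotated])
    hence "(\<lambda>n. c (e n) * t ^ n) sums f (v + of_real t)" using t by (intro real_sums) simp
    hence "(\<lambda>n. of_real (c (e n) * t ^ n)) sums (of_real (f (v + of_real t)) :: complex)"
      by (rule sums_of_real)
    hence "summable (\<lambda>n. of_real (c (e n)) * (of_real t :: complex) ^ n)"
      by (simp add: sums_iff)
    hence "summable (\<lambda>n. of_real (c (e n)) * (z - v) ^ n)"
      by (rule powser_inside) (use t \<open>t > 0\<close> in simp)
    thus ?thesis unfolding F_def by (rule summable_sums)
  qed
  hence "F holomorphic_on ball v r" by (rule power_series_holomorphic)
  moreover have "F (v + of_real t) = of_real (f (v + of_real t))" if "\<bar>t\<bar> < r" for t
  proof -
    have "(\<lambda>n. of_real (c (e n) * t ^ n)) sums (of_real (f (v + of_real t)) :: complex)"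
      by (intro sums_of_real real_sums that)
    thus ?thesis by (simp add: F_def sums_iff)
  qed
  ultimately show ?thesis using that r by blast
qed

lemma holomorphic_eq_on_horizontal:
  fixes v :: complex
  assumes "F holomorphic_on ball v r" "G holomorphic_on ball v r" "r > 0"
    and eq: "\<And>t :: real. \<bar>t\<bar> < r \<Longrightarrow> F (v + of_real t) = G (v + of_real t)" and z: "z \<in> ball v r"
  shows "F z = G z"
proof -
  define U where "U = (\<lambda>t. v + of_real t) ` {- r<..<r}"
  have "v islimpt U"
    unfolding islimpt_sequential
  proof (intro exI[of _ "\<lambda>n. v + of_real (r / 2 * inverse (real (Suc n)))"] conjI allI)
    fix n
    have "r / 2 * inverse (real (Suc n)) \<le> r / 2 * 1"
      using \<open>r > 0\<close> by (intro mult_left_mono) (auto simp: field_simps)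
    hence "r / 2 * inverse (real (Suc n)) < r" using \<open>r > 0\<close> by linarith
    moreover have "0 < r / 2 * inverse (real (Suc n))" using \<open>r > 0\<close> by simp
    moreover have "v + of_real t \<in> U - {v}" if "0 < t" "t < r" for t :: real
      using that \<open>r > 0\<close> by (auto simp: U_def)
    ultimately show "v + of_real (r / 2 * inverse (real (Suc n))) \<in> U - {v}" by blast
  next
    have "(\<lambda>n. v + of_real (r / 2 * inverse (real (Suc n)))) \<longlonglongrightarrow> v + of_real (r / 2 * 0)"
      by (intro tendsto_intros LIMSEQ_inverse_real_of_nat)
    thus "(\<lambda>n. v + of_real (r / 2 * inverse (real (Suc n)))) \<longlonglongrightarrow> v" by simp
  qed
  have "F z - G z = 0"
  proof (rule analytic_continuation[of "\<lambda>z. F z - G z" "ball v r" U v])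
    show "U \<subseteq> ball v r" by (auto simp: U_def dist_norm)
    show "F z - G z = 0" if "z \<in> U" for z using that eq by (auto simp: U_def abs_less_iff)
  qed (use assms \<open>v islimpt U\<close> in \<open>auto intro!: holomorphic_intros\<close>)
  thus ?thesis by simp
qed

section \<open>From the field generated by the chain to identities on an open set\<close>

lemma nonzero_elem_common:
  fixes q :: "'i \<Rightarrow> 'a :: topological_space \<Rightarrow> real"
  assumes "finite I" "open V" and q: "\<And>i. i \<in> I \<Longrightarrow> continuous_on V (q i) \<and> nonzero_elem V (q i)"
    and "open U" "U \<noteq> {}" "U \<subseteq> V"
  shows "\<exists>U'. open U' \<and> U' \<noteq> {} \<and> U' \<subseteq> U \<and> (\<forall>i\<in>I. \<forall>x\<in>U'. q i x \<noteq> 0)"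
  using \<open>finite I\<close> q
proof (induction I rule: finite_induct)
  case empty
  thus ?case using assms(4,5) by blast
next
  case (insert i I)
  have "\<exists>U'. open U' \<and> U' \<noteq> {} \<and> U' \<subseteq> U \<and> (\<forall>i\<in>I. \<forall>x\<in>U'. q i x \<noteq> 0)"
    by (rule insert.IH) (use insert.prems in simp)
  then obtain U1 where U1: "open U1" "U1 \<noteq> {}" "U1 \<subseteq> U" "\<forall>i\<in>I. \<forall>x\<in>U1. q i x \<noteq> 0" by blast
  define U2 where "U2 = U1 \<inter> q i -` (- {0})"
  have qi: "continuous_on V (q i)" "V \<subseteq> closure {x \<in> V. q i x \<noteq> 0}"
    using insert.prems[of i] by (auto simp: nonzero_elem_def)
  have "open U2"
    unfolding U2_def using U1 \<open>U \<subseteq> V\<close>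
    by (intro continuous_open_preimage continuous_on_subset[OF qi(1)]) auto
  moreover have "U2 \<noteq> {}"
  proof -
    have "U1 \<inter> closure {x \<in> V. q i x \<noteq> 0} \<noteq> {}" using qi(2) U1 \<open>U \<subseteq> V\<close> by blast
    hence "U1 \<inter> {x \<in> V. q i x \<noteq> 0} \<noteq> {}" using open_Int_closure_eq_empty[OF U1(1)] by blast
    thus ?thesis by (auto simp: U2_def)
  qed
  moreover have "U2 \<subseteq> U" "\<forall>j\<in>insert i I. \<forall>x\<in>U2. q j x \<noteq> 0" using U1 by (auto simp: U2_def)
  ultimately show ?case by blast
qed

lemma zero_elem_imp_zero:
  fixes G :: "'a :: topological_space \<Rightarrow> real"
  assumes "zero_elem V G" "open U" "U \<subseteq> V" "continuous_on U G" "x \<in> U"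
  shows "G x = 0"
proof (rule ccontr)
  assume "G x \<noteq> 0"
  define U' where "U' = U \<inter> G -` (- {0})"
  have "open U'" unfolding U'_def by (intro continuous_open_preimage assms) auto
  moreover have "x \<in> U' \<inter> closure {x \<in> V. G x = 0}"
    using assms \<open>G x \<noteq> 0\<close> by (auto simp: U'_def zero_elem_def)
  ultimately have "U' \<inter> {x \<in> V. G x = 0} \<noteq> {}" using open_Int_closure_eq_empty by blast
  thus False by (auto simp: U'_def)
qed

lemma continuous_on_chain_poly:
  fixes fs :: "('a :: euclidean_space \<Rightarrow> real) list"
  assumes "\<And>f. f \<in> set fs \<Longrightarrow> continuous_on V f"
    and "rpoly_vars p \<subseteq> Inl ` Basis \<union> Inr ` {..<length fs}"
  shows "continuous_on V (\<lambda>x. rpoly_eval p (chain_values fs x))"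
proof (rule continuous_on_rpoly_eval)
  fix v assume "v \<in> rpoly_vars p"
  hence "v \<in> Inl ` Basis \<union> Inr ` {..<length fs}" using assms(2) by blast
  thus "continuous_on V (\<lambda>x. chain_values fs x v)"
  proof (elim UnE imageE)
    fix b :: 'a assume "v = Inl b"
    thus ?thesis by (auto simp: chain_values_def intro!: continuous_intros)
  next
    fix k assume "v = Inr k" "k \<in> {..<length fs}"
    thus ?thesis by (auto simp: chain_values_def intro!: assms(1))
  qed
qed

text \<open>Finitely many open dense sets have an open dense intersection. Shrinking to an open
  subset of it replaces the density conditions by pointwise ones: all denominators and one numerator
  are nonzero everywhere, and the relation holds exactly.\<close>

lemma algebraic_relation_on_open:
  fixes V U :: "'a :: euclidean_space set"
  assumes V: "open V" and cont: "\<And>f. f \<in> set fs \<Longrightarrow> continuous_on V f"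
    and alg: "algebraic_over_field V (chain_field V fs) g"
    and U: "open U" "U \<noteq> {}" "U \<subseteq> V" "continuous_on U g"
  obtains U' d P Q i0 where "open U'" "U' \<noteq> {}" "U' \<subseteq> U" "i0 \<le> d"
    "\<And>i. i \<le> d \<Longrightarrow> rpoly_vars (P i) \<union> rpoly_vars (Q i) \<subseteq> Inl ` Basis \<union> Inr ` {..<length fs}"
    "\<And>i x. i \<le> d \<Longrightarrow> x \<in> U' \<Longrightarrow> rpoly_eval (Q i) (chain_values fs x) \<noteq> 0"
    "\<And>x. x \<in> U' \<Longrightarrow> rpoly_eval (P i0) (chain_values fs x) \<noteq> 0"
    "\<And>x. x \<in> U' \<Longrightarrow>
       (\<Sum>i\<le>d. rpoly_eval (P i) (chain_values fs x) / rpoly_eval (Q i) (chain_values fs x) * g x ^ i) = 0"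
proof -
  obtain d h i0 where h: "\<And>i. i \<le> d \<Longrightarrow> h i \<in> chain_field V fs" "i0 \<le> d" "nonzero_elem V (h i0)"
    "zero_elem V (\<lambda>x. \<Sum>i\<le>d. h i x * g x ^ i)"
    using alg unfolding algebraic_over_field_def by blast
  have "\<forall>i\<in>{..d}. \<exists>p q. h i = (\<lambda>x. rpoly_eval p (chain_values fs x) / rpoly_eval q (chain_values fs x)) \<and>
      rpoly_vars p \<union> rpoly_vars q \<subseteq> Inl ` Basis \<union> Inr ` {..<length fs} \<and>
      nonzero_elem V (\<lambda>x. rpoly_eval q (chain_values fs x))"
    using h(1) unfolding chain_field_def by blast
  from bchoice[OF this] obtain P where "\<forall>i\<in>{..d}. \<exists>q. h i = (\<lambda>x. rpoly_eval (P i) (chain_values fs x) / rpoly_eval q (chain_values fs x)) \<and>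
      rpoly_vars (P i) \<union> rpoly_vars q \<subseteq> Inl ` Basis \<union> Inr ` {..<length fs} \<and>
      nonzero_elem V (\<lambda>x. rpoly_eval q (chain_values fs x))" by blast
  from bchoice[OF this] obtain Q where PQ: "\<And>i. i \<le> d \<Longrightarrow> h i = (\<lambda>x. rpoly_eval (P i) (chain_values fs x) / rpoly_eval (Q i) (chain_values fs x))"
    "\<And>i. i \<le> d \<Longrightarrow> rpoly_vars (P i) \<union> rpoly_vars (Q i) \<subseteq> Inl ` Basis \<union> Inr ` {..<length fs}"
    "\<And>i. i \<le> d \<Longrightarrow> nonzero_elem V (\<lambda>x. rpoly_eval (Q i) (chain_values fs x))"
    by blast
  have contP: "continuous_on V (\<lambda>x. rpoly_eval (P i) (chain_values fs x))"
    and contQ: "continuous_on V (\<lambda>x. rpoly_eval (Q i) (chain_values fs x))" if "i \<le> d" for i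
    using PQ(2)[OF that] by (intro continuous_on_chain_poly[OF cont]; simp)+
  have "nonzero_elem V (\<lambda>x. rpoly_eval (P i0) (chain_values fs x))"
  proof -
    have "{x \<in> V. h i0 x \<noteq> 0} \<subseteq> {x \<in> V. rpoly_eval (P i0) (chain_values fs x) \<noteq> 0}"
      using PQ(1)[OF h(2)] by auto
    from closure_mono[OF this] show ?thesis using h(3) by (auto simp: nonzero_elem_def)
  qed
  hence "\<exists>U'. open U' \<and> U' \<noteq> {} \<and> U' \<subseteq> U \<and> (\<forall>i\<in>insert (P i0) (Q ` {..d}). \<forall>x\<in>U'. rpoly_eval i (chain_values fs x) \<noteq> 0)"
    using PQ(3) contP[OF h(2)] contQ
    by (intro nonzero_elem_common[where q = "\<lambda>p x. rpoly_eval p (chain_values fs x)", OF _ V _ U(1-3)]) auto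
  then obtain U' where U': "open U'" "U' \<noteq> {}" "U' \<subseteq> U"
    "\<And>i x. i \<in> insert (P i0) (Q ` {..d}) \<Longrightarrow> x \<in> U' \<Longrightarrow> rpoly_eval i (chain_values fs x) \<noteq> 0" by blast
  have Q0: "rpoly_eval (Q i) (chain_values fs x) \<noteq> 0" if "i \<le> d" "x \<in> U'" for i x
    by (rule U'(4)) (use that in auto)
  have sub: "U' \<subseteq> V" using U' U by blast
  have "continuous_on U' (\<lambda>x. \<Sum>i\<le>d. rpoly_eval (P i) (chain_values fs x) / rpoly_eval (Q i) (chain_values fs x) * g x ^ i)"
    using Q0 by (intro continuous_intros continuous_on_subset[OF contP sub] continuous_on_subset[OF contQ sub]
        continuous_on_subset[OF U(4) U'(3)]) auto
  moreover have "zero_elem V (\<lambda>x. \<Sum>i\<le>d. rpoly_eval (P i) (chain_values fs x) / rpoly_eval (Q i) (chain_values fs x) * g x ^ i)"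
    using h(4) by (simp add: PQ(1))
  ultimately have rel: "(\<Sum>i\<le>d. rpoly_eval (P i) (chain_values fs x) / rpoly_eval (Q i) (chain_values fs x) * g x ^ i) = 0" if "x \<in> U'" for x
    by (intro zero_elem_imp_zero[OF _ U'(1) sub _ that])
  show ?thesis
  proof (rule that[of U' i0 d P Q])
    show "rpoly_eval (P i0) (chain_values fs x) \<noteq> 0" if "x \<in> U'" for x
      by (rule U'(4)) (use that in simp_all)
  qed (fact U' h(2) PQ(2) Q0 rel)+
qed

text \<open>On the horizontal line through \<open>v\<close>, the function \<open>hcoord v b\<close> agrees with the coordinate
  \<open>z \<mapsto> z \<bullet> b\<close>, and it is holomorphic.\<close>

definition hcoord :: "complex \<Rightarrow> complex \<Rightarrow> complex \<Rightarrow> complex" where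
  "hcoord v b z = (if b = 1 then z - \<i> * of_real (Im v) else of_real (Im v))"

text \<open>The holomorphic counterpart of \<open>chain_values\<close> along the horizontal line
  through v.\<close>

definition line_values :: "complex \<Rightarrow> (nat \<Rightarrow> complex \<Rightarrow> complex) \<Rightarrow> complex \<Rightarrow> complex + nat \<Rightarrow> complex" where
  "line_values v \<phi> z = case_sum (\<lambda>b. hcoord v b z) (\<lambda>k. \<phi> k z)"

lemma holomorphic_hcoord: "hcoord v b holomorphic_on S"
  unfolding hcoord_def[abs_def] by (cases "b = 1") (auto intro!: holomorphic_intros)

lemma line_values_real:
  assumes "\<And>k. k < length fs \<Longrightarrow> \<phi> k (v + of_real t) = of_real ((fs ! k) (v + of_real t))"
    and w: "w \<in> Inl ` Basis \<union> Inr ` {..<length fs}"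
  shows "line_values v \<phi> (v + of_real t) w = of_real (chain_values fs (v + of_real t) w)"
  using w
proof (elim UnE imageE)
  fix b :: complex assume b: "w = Inl b" "b \<in> Basis"
  have "v - \<i> * of_real (Im v) = of_real (Re v)" by (simp add: complex_eq_iff)
  hence "v + of_real t - \<i> * of_real (Im v) = of_real (Re v + t)"
    by (simp add: algebra_simps)
  thus ?thesis using b by (auto simp: line_values_def chain_values_def hcoord_def Basis_complex_def inner_complex_def)
next
  fix k assume "w = Inr k" "k \<in> {..<length fs}"
  thus ?thesis using assms(1) by (simp add: line_values_def chain_values_def)
qed

lemma cpoly_eval_line_real:
  assumes "\<And>k. k < length fs \<Longrightarrow> \<phi> k (v + of_real t) = of_real ((fs ! k) (v + of_real t))"
    and p: "rpoly_vars p \<subseteq> Inl ` Basis \<union> Inr ` {..<length fs}"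
  shows "cpoly_eval p (line_values v \<phi> (v + of_real t)) = of_real (rpoly_eval p (chain_values fs (v + of_real t)))"
proof -
  have "cpoly_eval p (line_values v \<phi> (v + of_real t)) = cpoly_eval p (\<lambda>w. of_real (chain_values fs (v + of_real t) w))"
    by (intro cpoly_eval_cong line_values_real assms(1)) (use p in blast)+
  thus ?thesis by (simp only: cpoly_eval_of_real)
qed

lemma holomorphic_cpoly_line:
  assumes "\<And>k. k < l \<Longrightarrow> \<phi> k holomorphic_on S" and p: "rpoly_vars p \<subseteq> range Inl \<union> Inr ` {..<l}"
  shows "(\<lambda>z. cpoly_eval p (line_values v \<phi> z)) holomorphic_on S"
proof (rule holomorphic_cpoly_eval)
  fix w assume "w \<in> rpoly_vars p"
  hence "w \<in> range Inl \<union> Inr ` {..<l}" using p by blast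
  thus "(\<lambda>z. line_values v \<phi> z w) holomorphic_on S"
    using assms(1) by (auto simp: line_values_def intro!: holomorphic_hcoord)
qed

text \<open>On the line, the derivatives of the chain in direction 1 are given by its polynomials.
  With the power series substituted, both sides are holomorphic on a disc around v and agree on the
  line, hence on the disc.\<close>

lemma pfaffian_complexify:
  assumes V: "open V" "v \<in> V" and chain: "pfaffian_chain V fs"
  obtains r \<phi> p where "r > 0" "ball v r \<subseteq> V"
    "\<And>i. i < length fs \<Longrightarrow> rpoly_vars (p i) \<subseteq> range Inl \<union> Inr ` {..i}"
    "\<And>i t. i < length fs \<Longrightarrow> \<bar>t\<bar> < r \<Longrightarrow> \<phi> i (v + of_real t) = of_real ((fs ! i) (v + of_real t))"
    "\<And>i z. i < length fs \<Longrightarrow> z \<in> ball v r \<Longrightarrow>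
       (\<phi> i has_field_derivative cpoly_eval (p i) (line_values v \<phi> z)) (at z)"
proof -
  define l where "l = length fs"
  obtain r0 where r0: "r0 > 0" "ball v r0 \<subseteq> V" using openE[OF V] by blast
  have "\<forall>i\<in>{..<l}. \<exists>p. rpoly_vars p \<subseteq> Inl ` Basis \<union> Inr ` {..i} \<and>
      (\<forall>x\<in>V. ((\<lambda>t. (fs ! i) (x + t *\<^sub>R 1)) has_real_derivative rpoly_eval p (chain_values fs x)) (at 0))"
    using chain by (simp add: pfaffian_chain_def l_def Basis_complex_def)
  from bchoice[OF this] obtain p where p: "\<And>i. i < l \<Longrightarrow> rpoly_vars (p i) \<subseteq> Inl ` Basis \<union> Inr ` {..i}"
    "\<And>i x. i < l \<Longrightarrow> x \<in> V \<Longrightarrow>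
       ((\<lambda>t. (fs ! i) (x + t *\<^sub>R 1)) has_real_derivative rpoly_eval (p i) (chain_values fs x)) (at 0)"
    by blast
  have "\<forall>i\<in>{..<l}. \<exists>F. \<exists>r>0. F holomorphic_on ball v r \<and>
      (\<forall>t. \<bar>t\<bar> < r \<longrightarrow> F (v + of_real t) = of_real ((fs ! i) (v + of_real t)))"
  proof
    fix i assume "i \<in> {..<l}"
    hence "real_analytic_on (fs ! i) V" using chain by (auto simp: pfaffian_chain_def l_def)
    from complexify_horizontal[OF this V(2)] show "\<exists>F. \<exists>r>0. F holomorphic_on ball v r \<and>
      (\<forall>t. \<bar>t\<bar> < r \<longrightarrow> F (v + of_real t) = of_real ((fs ! i) (v + of_real t)))" by blast
  qed
  from bchoice[OF this] obtain \<phi> where "\<forall>i\<in>{..<l}. \<exists>r>0. \<phi> i holomorphic_on ball v r \<and>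
      (\<forall>t. \<bar>t\<bar> < r \<longrightarrow> \<phi> i (v + of_real t) = of_real ((fs ! i) (v + of_real t)))" by blast
  from bchoice[OF this] obtain \<rho> where \<rho>: "\<And>i. i < l \<Longrightarrow> \<rho> i > 0" "\<And>i. i < l \<Longrightarrow> \<phi> i holomorphic_on ball v (\<rho> i)"
      "\<And>i t. i < l \<Longrightarrow> \<bar>t\<bar> < \<rho> i \<Longrightarrow> \<phi> i (v + of_real t) = of_real ((fs ! i) (v + of_real t))" by blast
  define r where "r = Min (insert r0 (\<rho> ` {..<l}))"
  have r: "r > 0" "r \<le> r0" "\<And>i. i < l \<Longrightarrow> r \<le> \<rho> i" using r0 \<rho>(1) by (auto simp: r_def)
  have sub: "ball v r \<subseteq> V" using r r0 by force
  have hol: "\<phi> i holomorphic_on ball v r" if "i < l" for i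
    by (rule holomorphic_on_subset[OF \<rho>(2)[OF that]]) (use r(3)[OF that] in auto)
  have real: "\<phi> i (v + of_real t) = of_real ((fs ! i) (v + of_real t))" if "i < l" "\<bar>t\<bar> < r" for i t
    using \<rho>(3)[OF that(1)] that(2) r(3)[OF that(1)] by simp
  have "deriv (\<phi> i) z = cpoly_eval (p i) (line_values v \<phi> z)" if i: "i < l" and z: "z \<in> ball v r" for i z
  proof (rule holomorphic_eq_on_horizontal[OF _ _ r(1) _ z])
    show "deriv (\<phi> i) holomorphic_on ball v r" by (intro holomorphic_deriv hol i) auto
    show "(\<lambda>z. cpoly_eval (p i) (line_values v \<phi> z)) holomorphic_on ball v r"
      by (rule holomorphic_cpoly_line[where l = l]) (use hol p(1)[OF i] i in force)+
    fix t assume t: "\<bar>t\<bar> < r"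
    define x where "x = v + of_real t"
    have x: "x \<in> ball v r" using t by (simp add: x_def dist_norm)
    have "(\<phi> i has_field_derivative deriv (\<phi> i) x) (at (x + of_real 0))"
      using holomorphic_derivI[OF hol[OF i] open_ball x] by simp
    \<comment> \<open>Complex and real derivatives are compared as vector derivatives of the same
      curve along the line.\<close>
    hence "(\<phi> i \<circ> (\<lambda>s. x + of_real s) has_vector_derivative 1 * deriv (\<phi> i) x) (at 0)"
      by (intro field_vector_diff_chain_at) (auto intro!: derivative_eq_intros)
    hence 1: "((\<lambda>s. \<phi> i (x + of_real s)) has_vector_derivative deriv (\<phi> i) x) (at 0)"
      by (simp add: o_def)
    have "((\<lambda>s. of_real ((fs ! i) (x + s *\<^sub>R 1)) :: complex) has_vector_derivative
        of_real (rpoly_eval (p i) (chain_values fs x))) (at 0)"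
      using p(2)[OF i, of x] x sub by (intro has_vector_derivative_of_real) (auto simp: has_real_derivative_iff_has_vector_derivative)
    hence "((\<lambda>s. \<phi> i (x + of_real s)) has_vector_derivative
        of_real (rpoly_eval (p i) (chain_values fs x))) (at 0)"
    proof (rule has_vector_derivative_transform_within_open)
      show "open {- (r - \<bar>t\<bar>)<..<r - \<bar>t\<bar>}" "0 \<in> {- (r - \<bar>t\<bar>)<..<r - \<bar>t\<bar>}" using t by auto
      fix s assume "s \<in> {- (r - \<bar>t\<bar>)<..<r - \<bar>t\<bar>}"
      hence "\<bar>t + s\<bar> < r" by auto
      from real[OF i this] show "of_real ((fs ! i) (x + s *\<^sub>R 1)) = \<phi> i (x + of_real s)"
        by (simp add: x_def scaleR_conv_of_real add_ac)
    qed
    with 1 have "deriv (\<phi> i) x = of_real (rpoly_eval (p i) (chain_values fs x))"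
      by (rule vector_derivative_unique_at)
    also have "\<dots> = cpoly_eval (p i) (line_values v \<phi> x)"
      unfolding x_def by (rule cpoly_eval_line_real[symmetric]) (use real t p(1)[OF i] i in \<open>force simp: l_def\<close>)+
    finally show "deriv (\<phi> i) (v + of_real t) = cpoly_eval (p i) (line_values v \<phi> (v + of_real t))"
      by (simp add: x_def)
  qed
  hence "(\<phi> i has_field_derivative cpoly_eval (p i) (line_values v \<phi> z)) (at z)" if "i < l" "z \<in> ball v r" for i z
    using holomorphic_derivI[OF hol[OF that(1)] open_ball that(2)] that by simp
  moreover have "rpoly_vars (p i) \<subseteq> range Inl \<union> Inr ` {..i}" if "i < l" for i using p(1)[OF that] by blast
  ultimately show ?thesis
    using that[OF r(1) sub, of p \<phi>] real by (simp add: l_def)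
qed

text \<open>For c = 2 i y0 this is Schwarz reflection in the line Im z = y0.\<close>

lemma holomorphic_reflect:
  assumes "open S" and hol: "f holomorphic_on (\<lambda>z. cnj z + c) ` S"
  shows "(\<lambda>z. cnj (f (cnj z + c))) holomorphic_on S"
proof -
  have "(f \<circ> (\<lambda>z. z + c)) holomorphic_on cnj ` S"
    by (intro holomorphic_on_compose holomorphic_intros) (use hol in \<open>simp add: image_image\<close>)
  from holomorphic_on_compose_cnj_cnj[OF this \<open>open S\<close>] show ?thesis by (simp add: o_def)
qed

lemma holomorphic_klein_j:
  assumes "S \<subseteq> {z. Im z > 0 \<and> disc z \<noteq> 0}"
  shows "klein_j holomorphic_on S"
proof -
  have "S \<subseteq> {z. Im z > 0}" using assms by blast
  thus ?thesis unfolding klein_j_eq[abs_def] using assms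
    by (intro holomorphic_intros holomorphic_on_subset[OF holomorphic_g2] holomorphic_on_subset[OF holomorphic_disc]) auto
qed

section \<open>Conclusion\<close>

text \<open>The relation is stated with denominators cleared, so that it extends through zeros of
  the continued denominators. The values at v keep the coefficient of index i0 from vanishing
  identically.\<close>

lemma no_algebraic_relation:
  fixes v :: complex and \<phi> :: "nat \<Rightarrow> complex \<Rightarrow> complex" and p P Q :: "_ \<Rightarrow> (complex + nat) rpoly"
  assumes r: "r > 0" "r \<le> Im v" and dsc: "\<And>z. z \<in> ball v r \<Longrightarrow> disc z \<noteq> 0"
    and p: "\<And>i. i < l \<Longrightarrow> rpoly_vars (p i) \<subseteq> range Inl \<union> Inr ` {..i}"
    and ode: "\<And>i z. i < l \<Longrightarrow> z \<in> ball v r \<Longrightarrow>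
       (\<phi> i has_field_derivative cpoly_eval (p i) (line_values v \<phi> z)) (at z)"
    and PQ: "\<And>i. i \<le> n \<Longrightarrow> rpoly_vars (P i) \<union> rpoly_vars (Q i) \<subseteq> range Inl \<union> Inr ` {..<l}"
    and Q0: "\<And>i. i \<le> n \<Longrightarrow> cpoly_eval (Q i) (line_values v \<phi> v) \<noteq> 0"
    and i0: "i0 \<le> n" and P0: "cpoly_eval (P i0) (line_values v \<phi> v) \<noteq> 0"
    and rel: "\<And>t. \<bar>t\<bar> < r \<Longrightarrow> (\<Sum>k\<le>n. cpoly_eval (P k) (line_values v \<phi> (v + of_real t)) *
       (\<Prod>m\<in>{..n} - {k}. cpoly_eval (Q m) (line_values v \<phi> (v + of_real t))) *
       of_real (Re (klein_j (v + of_real t))) ^ k) = 0"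
  shows False
proof -
  define x0 y0 where "x0 = Re v" and "y0 = Im v"
  have y0: "y0 > 0" "r \<le> y0" using r by (auto simp: y0_def)
  \<comment> \<open>The functions \<psi> are a parameter: the coefficients are formed both from the
    given \<phi> near v and from their continuations g.\<close>
  define B where "B = (\<lambda>\<psi> k z. cpoly_eval (P k) (line_values v \<psi> z) *
      (\<Prod>m\<in>{..n} - {k}. cpoly_eval (Q m) (line_values v \<psi> z)))"
  have holB: "B \<psi> k holomorphic_on S" if "\<And>i. i < l \<Longrightarrow> \<psi> i holomorphic_on S" "k \<le> n" for \<psi> k S
    unfolding B_def using PQ that by (intro holomorphic_intros holomorphic_cpoly_line[where l = l]) auto
  have B_cong: "B \<psi> k z = B \<psi>' k z" if "\<And>i. i < l \<Longrightarrow> \<psi> i z = \<psi>' i z" "k \<le> n" for \<psi> \<psi>' k z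
  proof -
    have "cpoly_eval q (line_values v \<psi> z) = cpoly_eval q (line_values v \<psi>' z)"
      if "rpoly_vars q \<subseteq> range Inl \<union> Inr ` {..<l}" for q
    proof (rule cpoly_eval_cong)
      fix w assume "w \<in> rpoly_vars q"
      hence "w \<in> range Inl \<union> Inr ` {..<l}" using that by blast
      thus "line_values v \<psi> z w = line_values v \<psi>' z w"
        using \<open>\<And>i. i < l \<Longrightarrow> \<psi> i z = \<psi>' i z\<close> by (auto simp: line_values_def)
    qed
    thus ?thesis unfolding B_def using PQ \<open>k \<le> n\<close>
      by (intro arg_cong2[where f = "(*)"] prod.cong refl) auto
  qed
  have hol\<phi>: "\<phi> i holomorphic_on ball v r" if "i < l" for i
    by (rule holomorphic_on_derivI[OF ode[OF that]])
  \<comment> \<open>On the line Im z = y0 this is the conjugate of j. As the reflection of the upper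
    half plane is Im z < 2 y0, the real axis lies in the interior of its domain.\<close>
  define J where "J = (\<lambda>z. cnj (klein_j (cnj z + 2 * \<i> * of_real y0)))"
  have refl_ball: "cnj z + 2 * \<i> * of_real y0 \<in> ball v r" if "z \<in> ball v r" for z
  proof -
    have "v - (cnj z + 2 * \<i> * of_real y0) = cnj (v - z)" by (simp add: complex_eq_iff y0_def)
    hence "norm (v - (cnj z + 2 * \<i> * of_real y0)) = norm (v - z)" by (simp only: complex_mod_cnj)
    thus ?thesis using that by (simp add: dist_norm)
  qed
  have ball_pos: "Im z > 0" if "z \<in> ball v r" for z
    using that abs_Im_le_cmod[of "v - z"] y0 by (auto simp: dist_norm y0_def)
  have holJ: "J holomorphic_on S" if "open S" "\<And>z. z \<in> S \<Longrightarrow> Im z < 2 * y0 \<and> disc (cnj z + 2 * \<i> * of_real y0) \<noteq> 0" for S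
    unfolding J_def by (intro holomorphic_reflect holomorphic_klein_j) (use that in auto)
  define \<Psi> where "\<Psi> = (\<lambda>z. \<Sum>k\<le>n. B \<phi> k z * ((klein_j z + J z) / 2) ^ k)"
  have \<Psi>0: "\<Psi> z = 0" if "z \<in> ball v r" for z
  proof (rule holomorphic_eq_on_horizontal[OF _ _ r(1) _ that, of \<Psi> "\<lambda>_. 0"])
    have "J holomorphic_on ball v r"
    proof (rule holJ)
      fix z assume z: "z \<in> ball v r"
      show "Im z < 2 * y0 \<and> disc (cnj z + 2 * \<i> * of_real y0) \<noteq> 0"
        using ball_pos[OF refl_ball[OF z]] dsc[OF refl_ball[OF z]] by simp
    qed auto
    moreover have "klein_j holomorphic_on ball v r"
      by (rule holomorphic_klein_j) (use ball_pos dsc in blast)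
    ultimately show "\<Psi> holomorphic_on ball v r"
      unfolding \<Psi>_def by (intro holomorphic_intros holB hol\<phi>) auto
    fix t assume t: "\<bar>t\<bar> < r"
    have "cnj (v + of_real t) + 2 * \<i> * of_real y0 = v + of_real t"
      by (simp add: complex_eq_iff y0_def)
    hence "J (v + of_real t) = cnj (klein_j (v + of_real t))" by (simp only: J_def)
    hence "(klein_j (v + of_real t) + J (v + of_real t)) / 2 = of_real (Re (klein_j (v + of_real t)))"
      by (simp only: complex_add_cnj) simp
    thus "\<Psi> (v + of_real t) = 0" using rel[OF t] by (simp add: \<Psi>_def B_def)
  qed auto
  \<comment> \<open>The square of half side r / 2 around v fits into the ball. The height d lies
    strictly between y0 and its top, as the continuation gives up some room there.\<close>
  define e where "e = y0 - r / 2"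
  define d where "d = y0 + r / 4"
  have e: "0 < e" "e < y0" "y0 < d" "d < y0 + r / 2" using y0 r(1) by (auto simp: e_def d_def)
  have rect_ball: "rect (x0 - r / 2) (x0 + r / 2) e (y0 + r / 2) \<subseteq> ball v r"
  proof
    fix z assume "z \<in> rect (x0 - r / 2) (x0 + r / 2) e (y0 + r / 2)"
    hence "\<bar>Re (v - z)\<bar> < r / 2" "\<bar>Im (v - z)\<bar> < r / 2"
      unfolding mem_rect x0_def y0_def e_def minus_complex.simps by linarith+
    hence "norm (v - z) < r" using cmod_le[of "v - z"] by linarith
    thus "z \<in> ball v r" by (simp add: dist_norm)
  qed
  have "\<exists>a' b' g. x0 - r / 2 \<le> a' \<and> a' < b' \<and> b' \<le> x0 + r / 2 \<and>
      (\<forall>i<l. g i holomorphic_on rect a' b' (- 1) d \<and> (\<forall>z\<in>rect a' b' e d. g i z = \<phi> i z))"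
  proof (rule chain_extend[where p = p and X = "hcoord v" and d = "y0 + r / 2"])
    fix i z assume "i < l" "z \<in> rect (x0 - r / 2) (x0 + r / 2) e (y0 + r / 2)"
    thus "(\<phi> i has_field_derivative cpoly_eval (p i) (case_sum (\<lambda>x. hcoord v x z) (\<lambda>k. \<phi> k z))) (at z)"
      using ode[of i z] rect_ball by (auto simp: line_values_def)
  qed (use p r(1) e in \<open>auto intro: holomorphic_hcoord\<close>)
  then obtain a1 b1 g where ab1: "x0 - r / 2 \<le> a1" "a1 < b1" "b1 \<le> x0 + r / 2"
    and g: "\<And>i. i < l \<Longrightarrow> g i holomorphic_on rect a1 b1 (- 1) d"
      "\<And>i z. i < l \<Longrightarrow> z \<in> rect a1 b1 e d \<Longrightarrow> g i z = \<phi> i z" by blast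
  \<comment> \<open>\<open>J\<close> has the reflected \<open>disc\<close> as denominator. Thinning
    the strip once more makes this denominator nonzero down to height -1/2.\<close>
  obtain a b where ab: "a1 < a" "a < b" "b < b1"
    and strip: "\<And>z. a \<le> Re z \<Longrightarrow> Re z \<le> b \<Longrightarrow> - 1 / 2 \<le> Im z \<Longrightarrow> Im z \<le> y0 \<Longrightarrow>
      cnj (disc (cnj z + 2 * \<i> * of_real y0)) \<noteq> 0"
  proof (rule nonzero_strip[of "\<lambda>z. cnj (disc (cnj z + 2 * \<i> * of_real y0))" a1 b1 "- 1" d "- 1 / 2" y0])
    show "(\<lambda>z. cnj (disc (cnj z + 2 * \<i> * of_real y0))) holomorphic_on rect a1 b1 (- 1) d"
      by (intro holomorphic_reflect holomorphic_on_subset[OF holomorphic_disc])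
         (use e y0 in \<open>auto simp: mem_rect\<close>)
    obtain z where z: "z \<in> rect a1 b1 e d" using rect_nonempty[of a1 b1 e d] ab1 e by auto
    hence "z \<in> rect (x0 - r / 2) (x0 + r / 2) e (y0 + r / 2)" using ab1 e by (auto simp: mem_rect)
    hence "z \<in> ball v r" using rect_ball by blast
    hence "disc (cnj z + 2 * \<i> * of_real y0) \<noteq> 0" by (intro dsc refl_ball)
    moreover have "z \<in> rect a1 b1 (- 1) d" using z e by (auto simp: mem_rect)
    ultimately show "\<exists>z\<in>rect a1 b1 (- 1) d. cnj (disc (cnj z + 2 * \<i> * of_real y0)) \<noteq> 0" by auto
  qed (use ab1 e y0 in auto)
  define R where "R = rect a b (- 1 / 2) y0"
  define T where "T = rect a b e y0"
  have R: "open R" "connected R" by (simp_all add: R_def)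
  have T_ball: "T \<subseteq> ball v r"
  proof -
    have "T \<subseteq> rect (x0 - r / 2) (x0 + r / 2) e (y0 + r / 2)"
      unfolding T_def by (rule rect_subset) (use ab ab1 r(1) in auto)
    thus ?thesis using rect_ball by blast
  qed
  have T: "T \<subseteq> R" "T \<noteq> {}" "open T"
    using rect_nonempty[of a b e y0] ab e by (auto simp: T_def R_def mem_rect)
  have RJ: "J holomorphic_on R"
  proof (rule holJ[OF R(1)])
    show "Im z < 2 * y0 \<and> disc (cnj z + 2 * \<i> * of_real y0) \<noteq> 0" if "z \<in> R" for z
      using strip[of z] that y0 by (auto simp: R_def mem_rect)
  qed
  have Rg: "g i holomorphic_on R" if "i < l" for i
    by (rule holomorphic_on_subset[OF g(1)[OF that]]) (use ab e in \<open>auto simp: R_def mem_rect\<close>)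
  have RB: "B g k holomorphic_on R" if "k \<le> n" for k
    by (rule holB[OF Rg that])
  have TB: "B g k z = B \<phi> k z" if "k \<le> n" "z \<in> T" for k z
  proof (rule B_cong[OF _ that(1)])
    show "g i z = \<phi> i z" if "i < l" for i
      by (rule g(2)[OF that]) (use \<open>z \<in> T\<close> ab e in \<open>auto simp: T_def mem_rect\<close>)
  qed
  \<comment> \<open>In the summand of index k, k factors \<open>disc\<close> clear the denominator
    of j and n - k factors bring all summands to the common power n. So E is holomorphic on the
    whole part of the strip above the real axis, which is connected, and the identity theorem
    applies across zeros of \<open>disc\<close>.\<close>
  define E where "E = (\<lambda>z. \<Sum>k\<le>n. B g k z *
      ((1728 * weierstrass_g2 z ^ 3 + J z * disc z) / 2) ^ k * disc z ^ (n - k))"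
  have E_eq: "E z = disc z ^ n * (\<Sum>k\<le>n. B g k z * ((klein_j z + J z) / 2) ^ k)" if "disc z \<noteq> 0" for z
    unfolding E_def sum_distrib_left
  proof (intro sum.cong refl)
    fix k assume "k \<in> {..n}"
    have "(1728 * weierstrass_g2 z ^ 3 + J z * disc z) / 2 = disc z * ((klein_j z + J z) / 2)"
      using that by (simp add: klein_j_eq field_simps)
    moreover have pw: "disc z ^ n = disc z ^ k * disc z ^ (n - k)"
      using \<open>k \<in> {..n}\<close> by (simp flip: power_add)
    ultimately show "B g k z * ((1728 * weierstrass_g2 z ^ 3 + J z * disc z) / 2) ^ k * disc z ^ (n - k) =
        disc z ^ n * (B g k z * ((klein_j z + J z) / 2) ^ k)"
      by (simp only: pw power_mult_distrib mult_ac)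
  qed
  have E0: "E z = 0" if z: "z \<in> rect a b 0 y0" for z
  proof (rule analytic_continuation_open[OF T(3) open_rect T(2) connected_rect _ _ _ _ z, of E "\<lambda>_. 0"])
    show "T \<subseteq> rect a b 0 y0" using e by (auto simp: T_def mem_rect)
    have sub: "rect a b 0 y0 \<subseteq> R" "rect a b 0 y0 \<subseteq> {z. Im z > 0}" by (auto simp: R_def mem_rect)
    show "E holomorphic_on rect a b 0 y0"
      unfolding E_def
      by (intro holomorphic_intros holomorphic_on_subset[OF RB sub(1)] holomorphic_on_subset[OF RJ sub(1)]
          holomorphic_on_subset[OF holomorphic_g2 sub(2)] holomorphic_on_subset[OF holomorphic_disc sub(2)]) auto
    fix z assume z: "z \<in> T"
    hence zb: "z \<in> ball v r" using T_ball by blast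
    have "(\<Sum>k\<le>n. B g k z * ((klein_j z + J z) / 2) ^ k) = \<Psi> z"
      unfolding \<Psi>_def by (intro sum.cong refl arg_cong2[where f = "(*)"] TB z) simp
    thus "E z = 0" using E_eq[OF dsc[OF zb]] \<Psi>0[OF zb] by simp
  qed auto
  have fiber: "(\<Sum>k\<le>n. B g k z * ((klein_j w + J z) / 2) ^ k) = 0" if w: "Im w > 0" "disc w \<noteq> 0" and z: "z \<in> R" for w z
  proof -
    define x where "x = (a + b) / 2"
    \<comment> \<open>The value of j is frozen at w while \<open>J\<close> still varies with z,
      which makes \<Theta> holomorphic across the real axis. At the points of the orbit of w it
      coincides with the original relation.\<close>
    define \<Theta> where "\<Theta> = (\<lambda>z. \<Sum>k\<le>n. B g k z * ((klein_j w + J z) / 2) ^ k)"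
    obtain \<zeta> where \<zeta>: "\<And>n. Im (\<zeta> n) > 0" "\<And>n. disc (\<zeta> n) \<noteq> 0" "\<And>n. klein_j (\<zeta> n) = klein_j w"
      "\<zeta> \<longlonglongrightarrow> of_real x"
      by (rule orbit_accumulates[OF w, of x]) (rule that)
    have xR: "of_real x \<in> R" using ab y0 by (simp add: R_def mem_rect x_def)
    have "\<forall>\<^sub>F m in sequentially. \<zeta> m \<in> R" using \<zeta>(4) R(1) xR by (rule topological_tendstoD)
    then obtain m0 where m0: "\<And>m. m \<ge> m0 \<Longrightarrow> \<zeta> m \<in> R" unfolding eventually_sequentially by blast
    define U where "U = (\<lambda>m. \<zeta> (m + m0)) ` UNIV"
    have "of_real x islimpt U"
      unfolding islimpt_sequential
    proof (intro exI[of _ "\<lambda>m. \<zeta> (m + m0)"] conjI allI)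
      show "\<zeta> (m + m0) \<in> U - {of_real x}" for m
        using \<zeta>(1)[of "m + m0"] by (auto simp: U_def)
      show "(\<lambda>m. \<zeta> (m + m0)) \<longlonglongrightarrow> of_real x" by (rule LIMSEQ_ignore_initial_segment[OF \<zeta>(4)])
    qed
    moreover have "U \<subseteq> R" using m0 by (auto simp: U_def)
    moreover have "\<Theta> u = 0" if "u \<in> U" for u
    proof -
      obtain m where u: "u = \<zeta> (m + m0)" using \<open>u \<in> U\<close> by (auto simp: U_def)
      have "u \<in> rect a b 0 y0" using m0[of "m + m0"] \<zeta>(1)[of "m + m0"] by (auto simp: u R_def mem_rect)
      hence "E u = 0" by (rule E0)
      thus ?thesis using E_eq[of u] \<zeta>(2,3)[of "m + m0"] by (simp add: u \<Theta>_def)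
    qed
    moreover have "\<Theta> holomorphic_on R"
      unfolding \<Theta>_def by (intro holomorphic_intros RB RJ) auto
    ultimately have "\<Theta> z = 0" using analytic_continuation[of \<Theta> R U "of_real x" z] R xR z by blast
    thus ?thesis by (simp add: \<Theta>_def)
  qed
  \<comment> \<open>The point v lies just outside T, at the height of its top edge. The identity
    theorem on the ball around v transfers the nonvanishing to some point of T.\<close>
  have "\<exists>z\<in>T. B \<phi> i0 z \<noteq> 0"
  proof (rule ccontr)
    assume "\<not> ?thesis"
    hence zero: "B \<phi> i0 z = 0" if "z \<in> T" for z using that by blast
    have "B \<phi> i0 holomorphic_on ball v r" by (rule holB[OF hol\<phi> i0])
    hence "B \<phi> i0 v = 0"
      by (rule analytic_continuation_open[OF T(3) open_ball T(2) connected_ball T_ball, where g = "\<lambda>_. 0"])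
         (use zero r(1) in auto)
    thus False using P0 Q0 by (simp add: B_def)
  qed
  then obtain z where z: "z \<in> T" "B g i0 z \<noteq> 0" using TB[OF i0] by auto
  \<comment> \<open>For fixed z this is a nonzero polynomial in Y, yet (c + J z) / 2 is a root for
    every value c of j.\<close>
  have "finite {Y. (\<Sum>k\<le>n. B g k z * Y ^ k) = 0}"
    using polyfun_finite_roots[of "\<lambda>k. B g k z" n] z(2) i0 by blast
  moreover have "(\<lambda>c. (c + J z) / 2) ` (klein_j ` {w. Im w > 0 \<and> disc w \<noteq> 0}) \<subseteq> {Y. (\<Sum>k\<le>n. B g k z * Y ^ k) = 0}"
    using fiber z(1) T(1) by blast
  ultimately have "finite ((\<lambda>c. (c + J z) / 2) ` (klein_j ` {w. Im w > 0 \<and> disc w \<noteq> 0}))"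
    by (rule rev_finite_subset)
  hence "finite (klein_j ` {w. Im w > 0 \<and> disc w \<noteq> 0})"
    by (rule finite_imageD) (auto simp: inj_on_def)
  thus False using klein_j_range_infinite by simp
qed

theorem theorem3p3:
  fixes V :: "complex set"
  assumes "open V" and "V \<noteq> {}" and "V \<subseteq> modular_domain"
  shows "\<not> (\<exists>fs. pfaffian_chain V fs \<and>
            algebraic_over_field V (chain_field V fs) (\<lambda>z. Re (klein_j z)) \<and>
            algebraic_over_field V (chain_field V fs) (\<lambda>z. Im (klein_j z)))"
proof
  assume "\<exists>fs. pfaffian_chain V fs \<and>
            algebraic_over_field V (chain_field V fs) (\<lambda>z. Re (klein_j z)) \<and>
            algebraic_over_field V (chain_field V fs) (\<lambda>z. Im (klein_j z))"
  then obtain fs where chain: "pfaffian_chain V fs"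
    and alg: "algebraic_over_field V (chain_field V fs) (\<lambda>z. Re (klein_j z))" by blast
  define l where "l = length fs"
  have VH: "V \<subseteq> {z. Im z > 0}" using assms(3) by (auto simp: modular_domain_def)
  \<comment> \<open>Here j is holomorphic. This part of V is nonempty, since otherwise
    \<open>disc\<close> would vanish on the whole upper half plane, including rho.\<close>
  define U where "U = V \<inter> disc -` (- {0})"
  have U: "open U" "U \<subseteq> V"
    unfolding U_def using assms(1)
    by (auto intro!: continuous_open_preimage holomorphic_on_imp_continuous_on holomorphic_on_subset[OF holomorphic_disc VH])
  have "U \<noteq> {}"
  proof
    assume "U = {}"
    hence zero: "disc z = 0" if "z \<in> V" for z using that by (auto simp: U_def)
    have "disc rho = 0"
      by (rule analytic_continuation_open[OF assms(1) open_upper_half_plane assms(2) connected_upper_half_plane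
            VH holomorphic_disc, where g = "\<lambda>_. 0"]) (use zero Im_rho in auto)
    thus False using disc_rho by simp
  qed
  have contU: "continuous_on U (\<lambda>z. Re (klein_j z))"
    by (intro continuous_intros holomorphic_on_imp_continuous_on holomorphic_klein_j) (use VH in \<open>auto simp: U_def\<close>)
  have contf: "continuous_on V f" if "f \<in> set fs" for f
    by (rule real_analytic_on_imp_continuous_on) (use chain that in \<open>simp add: pfaffian_chain_def\<close>)
  obtain U' n P Q i0 where U': "open U'" "U' \<noteq> {}" "U' \<subseteq> U" and i0: "i0 \<le> n"
    and vars: "\<And>i. i \<le> n \<Longrightarrow> rpoly_vars (P i) \<union> rpoly_vars (Q i) \<subseteq> Inl ` Basis \<union> Inr ` {..<length fs}"
    and Q: "\<And>i x. i \<le> n \<Longrightarrow> x \<in> U' \<Longrightarrow> rpoly_eval (Q i) (chain_values fs x) \<noteq> 0"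
    and P: "\<And>x. x \<in> U' \<Longrightarrow> rpoly_eval (P i0) (chain_values fs x) \<noteq> 0"
    and rel: "\<And>x. x \<in> U' \<Longrightarrow>
       (\<Sum>i\<le>n. rpoly_eval (P i) (chain_values fs x) / rpoly_eval (Q i) (chain_values fs x) * Re (klein_j x) ^ i) = 0"
    by (rule algebraic_relation_on_open[OF assms(1) contf alg U(1) \<open>U \<noteq> {}\<close> U(2) contU]) (assumption, rule that)
  obtain v where v: "v \<in> U'" using U' by blast
  obtain r0 where r0: "r0 > 0" "ball v r0 \<subseteq> U'" using openE[OF U'(1) v] by blast
  have vV: "v \<in> V" using v U' U by blast
  obtain r1 \<phi> p where r1: "r1 > 0" "ball v r1 \<subseteq> V"
    and p: "\<And>i. i < length fs \<Longrightarrow> rpoly_vars (p i) \<subseteq> range Inl \<union> Inr ` {..i}"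
    and real: "\<And>i t. i < length fs \<Longrightarrow> \<bar>t\<bar> < r1 \<Longrightarrow> \<phi> i (v + of_real t) = of_real ((fs ! i) (v + of_real t))"
    and ode: "\<And>i z. i < length fs \<Longrightarrow> z \<in> ball v r1 \<Longrightarrow>
       (\<phi> i has_field_derivative cpoly_eval (p i) (line_values v \<phi> z)) (at z)"
    by (rule pfaffian_complexify[OF assms(1) vV chain]) (rule that)
  define r where "r = min r0 (min r1 (Im v))"
  have r: "r > 0" "r \<le> Im v" "r \<le> r0" "r \<le> r1" using r0 r1 VH vV by (auto simp: r_def)
  have eval: "cpoly_eval q (line_values v \<phi> (v + of_real t)) = of_real (rpoly_eval q (chain_values fs (v + of_real t)))"
    if "\<bar>t\<bar> < r" "rpoly_vars q \<subseteq> Inl ` Basis \<union> Inr ` {..<length fs}" for q t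
    using that r real by (intro cpoly_eval_line_real) auto
  have in_U': "v + of_real t \<in> U'" if "\<bar>t\<bar> < r" for t
    using r0(2) r that by (auto simp: dist_norm)
  show False
  proof (rule no_algebraic_relation[OF r(1,2), where l = "length fs" and p = p and P = P and Q = Q and n = n and \<phi> = \<phi> and ?i0.0 = i0])
    show "disc z \<noteq> 0" if "z \<in> ball v r" for z
    proof -
      have "z \<in> U'" using that r r0(2) by auto
      thus ?thesis using U'(3) by (auto simp: U_def)
    qed
    show "rpoly_vars (P i) \<union> rpoly_vars (Q i) \<subseteq> range Inl \<union> Inr ` {..<length fs}" if "i \<le> n" for i
      using vars[OF that] by blast
    show "cpoly_eval (Q i) (line_values v \<phi> v) \<noteq> 0" if "i \<le> n" for i
      using eval[of 0 "Q i"] vars[OF that] Q[OF that v] r(1) by simp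
    show "cpoly_eval (P i0) (line_values v \<phi> v) \<noteq> 0"
      using eval[of 0 "P i0"] vars[OF i0] P[OF v] r(1) by simp
    fix t assume t: "\<bar>t\<bar> < r"
    define x where "x = v + of_real t"
    define A C where "A = (\<lambda>k. rpoly_eval (P k) (chain_values fs x))" and "C = (\<lambda>k. rpoly_eval (Q k) (chain_values fs x))"
    have xU: "x \<in> U'" unfolding x_def by (rule in_U'[OF t])
    have C0: "C k \<noteq> 0" if "k \<le> n" for k using Q[OF that xU] by (simp add: C_def)
    \<comment> \<open>Multiplication by all denominators leaves, in the summand of index k, the
      product of those with other indices.\<close>
    have "(\<Sum>k\<le>n. A k * (\<Prod>m\<in>{..n} - {k}. C m) * Re (klein_j x) ^ k) =
        (\<Prod>m\<le>n. C m) * (\<Sum>k\<le>n. A k / C k * Re (klein_j x) ^ k)"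
      unfolding sum_distrib_left
    proof (intro sum.cong refl)
      fix k assume k: "k \<in> {..n}"
      have "(\<Prod>m\<le>n. C m) = C k * (\<Prod>m\<in>{..n} - {k}. C m)" using k by (intro prod.remove) auto
      thus "A k * (\<Prod>m\<in>{..n} - {k}. C m) * Re (klein_j x) ^ k = (\<Prod>m\<le>n. C m) * (A k / C k * Re (klein_j x) ^ k)"
        using C0[of k] k by simp
    qed
    also have "\<dots> = 0" using rel[OF xU] by (simp add: A_def C_def)
    finally have *: "(\<Sum>k\<le>n. A k * (\<Prod>m\<in>{..n} - {k}. C m) * Re (klein_j x) ^ k) = 0" .
    have "(\<Sum>k\<le>n. cpoly_eval (P k) (line_values v \<phi> x) * (\<Prod>m\<in>{..n} - {k}. cpoly_eval (Q m) (line_values v \<phi> x)) *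
        of_real (Re (klein_j x)) ^ k) = (\<Sum>k\<le>n. of_real (A k) * (\<Prod>m\<in>{..n} - {k}. of_real (C m)) * of_real (Re (klein_j x)) ^ k)"
      unfolding x_def A_def C_def
      by (intro sum.cong refl arg_cong2[where f = "(*)"] prod.cong eval t) (use vars in auto)
    also have "\<dots> = of_real (\<Sum>k\<le>n. A k * (\<Prod>m\<in>{..n} - {k}. C m) * Re (klein_j x) ^ k)" by simp
    finally show "(\<Sum>k\<le>n. cpoly_eval (P k) (line_values v \<phi> (v + of_real t)) *
       (\<Prod>m\<in>{..n} - {k}. cpoly_eval (Q m) (line_values v \<phi> (v + of_real t))) *
       of_real (Re (klein_j (v + of_real t))) ^ k) = 0"
      unfolding * by (simp add: x_def)
  qed (use p ode r i0 in auto)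
qed

end
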